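(* Let $n_1, n_2\ge 1$ be integers. Suppose that for all integers $d\ge 0$ and $m\ge 1$ the homogeneous linear system $\mathcal{L}_d(m^{n_1})$ is non-special, and that for all integers $d\ge 0$ and $m\ge 1$ the homogeneous linear system $\mathcal{L}_d(m^{n_2})$ is non-special. Then for all integers $d\ge 0$ and $m\ge 1$ the linear system $\mathcal{L}_d(m^{n_1n_2})$ is non-special.
   Context: Work over $\mathbb{C}$. For points $q_1,\dots,q_n$ of the projective plane $\mathbb{P}^2$, consider the linear system of plane curves of degree $d$ having multiplicity at least $m$ at each $q_i$. It is the projectivization of the vector space of homogeneous polynomials of degree $d$ in three variables (including $0$) that vanish to order at least $m$ at each $q_i$, i.e. whose Taylor expansion at each $q_i$ in local affine coordinates has no terms of degree less than $m$. Its dimension is the dimension of this vector space minus $1$, so the dimension is $-1$ exactly when the system is empty. The notation $\mathcal{L}_d(m^n)$ denotes this system for $n$ points $q_1,\dots,q_n$ in general position. Its dimension $l$ is the minimum value over all $n$-tuples of distinct points, which is attained on a nonempty Zariski open set of $n$-tuples. The virtual dimension is $v(d,m,n)=\frac{d(d+3)}{2}-n\,\frac{m(m+1)}{2}$, and the expected dimension is $e(d,m,n)=\max\{-1,\,v(d,m,n)\}$. One always has $l\ge e$. The system $\mathcal{L}_d(m^n)$ is called non-special if $l=e(d,m,n)$, and special otherwise. *)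

theory Defs
  imports "HOL-Analysis.Analysis" "HOL-Library.Poly_Mapping"
begin

definition proportional :: "complex ^ 3 \<Rightarrow> complex ^ 3 \<Rightarrow> bool" where
  "proportional v w \<longleftrightarrow> v \<noteq> 0 \<and> w \<noteq> 0 \<and> (\<exists>c. w = c *s v)"

lemma part_equivp_proportional: "part_equivp proportional"
proof (rule part_equivpI)
  show "\<exists>v. proportional v v"
    by (rule exI[of _ "axis 1 1"])
       (auto simp: proportional_def axis_eq_0_iff intro: exI[of _ 1])
  show "symp proportional"
  proof (rule sympI)
    fix v w assume "proportional v w"
    then obtain c where c: "v \<noteq> 0" "w \<noteq> 0" "w = c *s v"
      by (auto simp: proportional_def)
    then have "c \<noteq> 0" by auto
    then have "v = inverse c *s w"
      unfolding c(3) by (simp add: vector_smult_assoc)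
    with c(1,2) show "proportional w v" unfolding proportional_def by blast
  qed
  show "transp proportional"
    by (rule transpI) (auto simp: proportional_def vector_smult_assoc)
qed

quotient_type proj_plane = "complex ^ 3" / partial: proportional
  by (rule part_equivp_proportional)

type_synonym ternary_poly = "(3 \<Rightarrow>\<^sub>0 nat) \<Rightarrow>\<^sub>0 complex"

definition pscale :: "complex \<Rightarrow> ternary_poly \<Rightarrow> ternary_poly" where
  "pscale c F = Poly_Mapping.map ((*) c) F"

lemma lookup_pscale [simp]:
  "Poly_Mapping.lookup (pscale c F) t = c * Poly_Mapping.lookup F t"
  by (simp add: pscale_def Poly_Mapping.map.rep_eq when_def)

interpretation tpoly: vector_space pscale
  by (unfold_locales; rule poly_mapping_eqI; simp add: lookup_add distrib_left distrib_right)

definition mono_deg :: "(3 \<Rightarrow>\<^sub>0 nat) \<Rightarrow> nat" where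
  "mono_deg t = (\<Sum>i\<in>UNIV. Poly_Mapping.lookup t i)"

definition forms :: "nat \<Rightarrow> ternary_poly set" where
  "forms d = {F. \<forall>t\<in>Poly_Mapping.keys F. mono_deg t = d}"

definition pvar :: "3 \<Rightarrow> ternary_poly" where
  "pvar i = Poly_Mapping.single (Poly_Mapping.single i 1) 1"

definition pconst :: "complex \<Rightarrow> ternary_poly" where
  "pconst c = Poly_Mapping.single 0 c"

definition psubst :: "(3 \<Rightarrow> ternary_poly) \<Rightarrow> ternary_poly \<Rightarrow> ternary_poly" where
  "psubst \<sigma> F = (\<Sum>t\<in>Poly_Mapping.keys F.
     pscale (Poly_Mapping.lookup F t) (\<Prod>i\<in>UNIV. \<sigma> i ^ Poly_Mapping.lookup t i))"

text \<open>In the affine chart where the coordinate \<open>k\<close> is nonzero, the point with homogeneous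
  coordinates \<open>v\<close> has affine coordinates \<open>v $ i / v $ k\<close> (\<open>i \<noteq> k\<close>). Setting the \<open>k\<close>-th variable
  to \<open>1\<close> and translating this point to the origin gives the Taylor expansion, a polynomial in
  the two remaining variables.\<close>

definition taylor :: "3 \<Rightarrow> complex ^ 3 \<Rightarrow> ternary_poly \<Rightarrow> ternary_poly" where
  "taylor k v F = psubst (\<lambda>i. if i = k then 1 else pconst (v $ i / v $ k) + pvar i) F"

lemma taylor_proportional:
  assumes "proportional v w"
  shows "w $ k \<noteq> 0 \<longleftrightarrow> v $ k \<noteq> 0" and "taylor k w F = taylor k v F"
proof -
  obtain c where c: "w \<noteq> 0" "w = c *s v"
    using assms unfolding proportional_def by blast
  then have "c \<noteq> 0" by auto
  then show "w $ k \<noteq> 0 \<longleftrightarrow> v $ k \<noteq> 0"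
    unfolding c(2) by simp
  have "w $ i / w $ k = v $ i / v $ k" for i
    unfolding c(2) using \<open>c \<noteq> 0\<close> by simp
  then show "taylor k w F = taylor k v F"
    unfolding taylor_def by presburger
qed

text \<open>For homogeneous \<open>F\<close> the condition does not depend on the chart; it is required in every
  standard chart containing the point.\<close>

lift_definition vanishes_to_order :: "nat \<Rightarrow> ternary_poly \<Rightarrow> proj_plane \<Rightarrow> bool" is
  "\<lambda>m F v. \<forall>k t. v $ k \<noteq> 0 \<longrightarrow> mono_deg t < m \<longrightarrow>
     Poly_Mapping.lookup (taylor k v F) t = 0"
  subgoal premises prems for m F v w
    unfolding taylor_proportional[OF prems] by (rule refl)
  done

text \<open>The vector space whose projectivization is the linear system of curves of degree \<open>d\<close> with
  multiplicity at least \<open>m\<close> at \<open>q 0, \<dots>, q (n - 1)\<close>.\<close>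

definition system_space :: "nat \<Rightarrow> nat \<Rightarrow> nat \<Rightarrow> (nat \<Rightarrow> proj_plane) \<Rightarrow> ternary_poly set" where
  "system_space d m n q = {F \<in> forms d. \<forall>i<n. vanishes_to_order m F (q i)}"

text \<open>Dimension for points in general position: the minimum over all tuples of distinct points.\<close>

definition general_dim :: "nat \<Rightarrow> nat \<Rightarrow> nat \<Rightarrow> int" where
  "general_dim d m n =
     int (LEAST l. \<exists>q. inj_on q {..<n} \<and> l = tpoly.dim (system_space d m n q)) - 1"

definition virtual_dim :: "nat \<Rightarrow> nat \<Rightarrow> nat \<Rightarrow> int" where
  "virtual_dim d m n =
     int d * (int d + 3) div 2 - int n * (int m * (int m + 1) div 2)"

definition expected_dim :: "nat \<Rightarrow> nat \<Rightarrow> nat \<Rightarrow> int" where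
  "expected_dim d m n = max (- 1) (virtual_dim d m n)"

definition non_special :: "nat \<Rightarrow> nat \<Rightarrow> nat \<Rightarrow> bool" where
  "non_special d m n \<longleftrightarrow> general_dim d m n = expected_dim d m n"

end

theory Submission
  imports Defs
begin

text \<open>
  The points are specialised: near each of \<open>n2\<close> general points \<open>p\<close> of the plane sits a group of
  \<open>n1\<close> points of multiplicity \<open>m\<close>, and every group contracts to its \<open>p\<close> by a homothety with ratio
  tending to \<open>0\<close>. Dimensions can only jump up in a limit, so it suffices to bound the dimension of
  the space of forms satisfying the limit conditions; the expected dimension is a lower bound for
  every choice of points, by counting conditions.

  Let \<open>N\<close> be \<open>n1\<close> times \<open>m (m + 1) / 2\<close>, the number of conditions imposed by one group. Under the
  contraction, the homogeneous terms that a form of the limit space can have at \<open>p\<close> in local degree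
  \<open>e'\<close> are the terms of degree \<open>e'\<close> of affine polynomials of degree at most \<open>e'\<close> that vanish to order \<open>m\<close> at the points of the group, seen before the contraction. Since
  all systems with \<open>n1\<close> points are non-special, there are no such polynomials below the degree \<open>e\<close>
  with \<open>e (e + 1) / 2 \<le> N < (e + 1) (e + 2) / 2\<close>, and in degree \<open>e\<close> their terms of highest degree
  form a space \<open>W\<close> of binary forms of codimension at least \<open>c = N - e (e + 1) / 2\<close>. Hence the limit
  condition at \<open>p\<close> implies: multiplicity at least \<open>e\<close>, and the tangent cone belongs to \<open>W\<close>
  (lemma \<open>cluster_degeneration\<close>).

  It remains to see that \<open>c\<close> further conditions on each of the \<open>n2\<close> tangent cones are independent
  in the range where this is possible. Each group may be moved by an arbitrary linear map before it
  contracts, so \<open>W\<close> may be replaced at each point by a general translate under \<open>GL\<^sub>2\<close>. In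
  characteristic zero a general translate of \<open>W\<close> meets any given space of binary forms in the
  expected dimension (lemma \<open>transversal_substitution\<close>); thus imposing \<open>W\<close> at one point either costs
  \<open>c\<close> dimensions or forces multiplicity \<open>e + 1\<close> there. Repeating this, the dimension is zero or
  at most the maximum over \<open>k\<close> of \<open>f k - c (n2 - k)\<close>, where \<open>f k\<close> is the dimension for \<open>n2\<close> general points of
  which \<open>k\<close> have multiplicity \<open>e + 1\<close> and the others \<open>e\<close>. These mixed systems might be
  special, but \<open>f\<close> is convex: for fixed points, the spaces with one more condition of the stronger
  kind at \<open>p\<close> or at \<open>p'\<close> intersect in the space with both, and general points can be permuted. So
  the maximum is attained at \<open>k = 0\<close> or \<open>k = n2\<close> (lemma \<open>cluster_dim_endpoints\<close>), where the systems
  are homogeneous with \<open>n2\<close> points and therefore non-special. Both values are at most the expected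
  one for \<open>n1 * n2\<close> points of multiplicity \<open>m\<close>.

  A point of the plane is represented throughout by a frame, a \<open>3\<close> by \<open>3\<close> matrix whose last column
  is the point: orders of vanishing become statements about the coefficients of the form after a
  linear substitution, and these depend polynomially on the matrix.
\<close>

section \<open>Subspaces cut out by linear functionals\<close>

abbreviation functional :: "('a::field \<Rightarrow> 'b::ab_group_add \<Rightarrow> 'b) \<Rightarrow> ('b \<Rightarrow> 'a) \<Rightarrow> bool" where
  "functional s f \<equiv> Vector_Spaces.linear s (*) f"

context vector_space
begin

lemma functionalI:
  assumes "\<And>x y. f (x + y) = f x + f y" and "\<And>c x. f (scale c x) = c * f x"
  shows "functional scale f"
proof -
  have "vector_space ((*) :: 'a \<Rightarrow> 'a \<Rightarrow> 'a)"
    by unfold_locales (auto simp: algebra_simps)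
  then show ?thesis
    using assms vector_space_axioms by (simp add: Vector_Spaces.linear_iff)
qed

lemma
  assumes "functional scale f"
  shows functional_add: "f (x + y) = f x + f y"
    and functional_scale: "f (scale c x) = c * f x"
    and functional_diff: "f (x - y) = f x - f y"
    and functional_zero: "f 0 = 0"
proof -
  interpret Vector_Spaces.linear scale "(*)" f by fact
  show "f (x + y) = f x + f y" "f (scale c x) = c * f x" "f (x - y) = f x - f y" "f 0 = 0"
    by (auto simp: add scale diff)
qed

lemma functional_sum:
  assumes "functional scale f"
  shows "f (\<Sum>i\<in>I. g i) = (\<Sum>i\<in>I. f (g i))"
  by (induction I rule: infinite_finite_induct)
     (auto simp: functional_add[OF assms] functional_zero[OF assms])

lemma subspace_common_kernel:
  assumes "subspace V" and "\<And>r. r \<in> R \<Longrightarrow> functional scale (f r)"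
  shows "subspace {x \<in> V. \<forall>r\<in>R. f r x = 0}"
  unfolding subspace_def
proof (intro conjI ballI allI)
  show "0 \<in> {x \<in> V. \<forall>r\<in>R. f r x = 0}"
    using subspace_0[OF assms(1)] functional_zero[OF assms(2)] by simp
next
  fix x y
  assume "x \<in> {x \<in> V. \<forall>r\<in>R. f r x = 0}" and "y \<in> {x \<in> V. \<forall>r\<in>R. f r x = 0}"
  then show "x + y \<in> {x \<in> V. \<forall>r\<in>R. f r x = 0}"
    using subspace_add[OF assms(1)] functional_add[OF assms(2)] by simp
next
  fix c x
  assume "x \<in> {x \<in> V. \<forall>r\<in>R. f r x = 0}"
  then show "scale c x \<in> {x \<in> V. \<forall>r\<in>R. f r x = 0}"
    using subspace_scale[OF assms(1)] functional_scale[OF assms(2)] by simp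
qed

text \<open>
  The spaces below live in polynomial rings, which have infinite dimension. Every statement about
  dimensions therefore carries a finite set \<open>B\<close> whose span contains the spaces in question.
\<close>

lemma finite_basis_of:
  assumes "finite B" and "U \<subseteq> span B"
  obtains C where "finite C" "C \<subseteq> U" "independent C" "U \<subseteq> span C" "card C = dim U"
proof -
  obtain C where C: "C \<subseteq> U" "independent C" "U \<subseteq> span C" "card C = dim U"
    using basis_exists[of U] by metis
  moreover have "finite C"
    using independent_span_bound[OF assms(1) C(2)] C(1) assms(2) by blast
  ultimately show ?thesis using that by blast
qed

lemma dim_mono_finite:
  assumes "finite B" and "V \<subseteq> span B" and "U \<subseteq> V"
  shows "dim U \<le> dim V"
proof -
  obtain C where C: "finite C" "C \<subseteq> V" "independent C" "V \<subseteq> span C" "card C = dim V"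
    by (rule finite_basis_of[OF assms(1,2)])
  have "U \<subseteq> span C" using C(4) assms(3) by blast
  then show ?thesis using dim_le_card[of U C] C by simp
qed

lemma dim_less_if_proper:
  assumes "finite B" and "V \<subseteq> span B" and "subspace U" and "U \<subseteq> V" and "u \<in> V" and "u \<notin> U"
  shows "dim U < dim V"
proof -
  have UV: "U \<subseteq> V" by fact
  obtain C where C: "finite C" "C \<subseteq> U" "independent C" "U \<subseteq> span C" "card C = dim U"
    by (rule finite_basis_of[OF assms(1) subset_trans[OF UV assms(2)]])
  obtain D where D: "finite D" "D \<subseteq> V" "independent D" "V \<subseteq> span D" "card D = dim V"
    by (rule finite_basis_of[OF assms(1,2)])
  have "span C \<subseteq> U"
    using C(2) assms(3) by (rule span_minimal)
  then have u: "u \<notin> span C"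
    using assms(6) by blast
  have "independent (insert u C)"
    using u C(3) by (rule independent_insertI)
  moreover have "insert u C \<subseteq> span D"
    using assms(5) UV C(2) D(4) by blast
  ultimately have "card (insert u C) \<le> card D"
    using independent_span_bound[OF D(1)] by blast
  moreover have "u \<notin> C"
    using u span_base by blast
  ultimately show ?thesis
    using C D by simp
qed

lemma dim_cut_one:
  assumes "finite B" and "subspace V" and "V \<subseteq> span B" and f: "functional scale f"
  shows "dim V \<le> dim {x \<in> V. f x = 0} + 1"
proof (cases "\<forall>x\<in>V. f x = 0")
  case True
  then have "{x \<in> V. f x = 0} = V" by blast
  then show ?thesis by simp
next
  case False
  then obtain u where u: "u \<in> V" "f u \<noteq> 0" by blast
  have "{x \<in> V. f x = 0} \<subseteq> span B"
    using assms(3) by blast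
  then obtain C where C: "finite C" "C \<subseteq> {x \<in> V. f x = 0}" "independent C"
    "{x \<in> V. f x = 0} \<subseteq> span C" "card C = dim {x \<in> V. f x = 0}"
    by (rule finite_basis_of[OF assms(1)])
  have "V \<subseteq> span (insert u C)"
  proof
    fix x assume x: "x \<in> V"
    define y where "y = x - scale (f x / f u) u"
    have "y \<in> V"
      unfolding y_def using x u assms(2) by (intro subspace_diff subspace_scale)
    moreover have "f y = 0"
      using u by (simp add: y_def functional_diff[OF f] functional_scale[OF f])
    ultimately have "y \<in> span (insert u C)"
      using C(4) span_mono[of C "insert u C"] by blast
    moreover have "scale (f x / f u) u \<in> span (insert u C)"
      by (intro span_scale span_base) simp
    ultimately have "y + scale (f x / f u) u \<in> span (insert u C)"
      by (rule span_add)
    then show "x \<in> span (insert u C)"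
      by (simp add: y_def)
  qed
  then have "dim V \<le> card (insert u C)"
    using C(1) by (intro dim_le_card) auto
  also have "\<dots> \<le> card C + 1"
    by (simp add: card_insert_if C(1))
  finally show ?thesis
    using C by simp
qed

lemma dim_cut:
  assumes "finite B" and "V \<subseteq> span B" and "subspace V"
    and "finite I" and "\<And>i. i \<in> I \<Longrightarrow> functional scale (f i)"
  shows "dim V \<le> dim {x \<in> V. \<forall>i\<in>I. f i x = 0} + card I"
  using assms(4,5)
proof (induction I rule: finite_induct)
  case empty
  then show ?case by simp
next
  case (insert i I)
  let ?K = "{x \<in> V. \<forall>i\<in>I. f i x = 0}"
  have "dim ?K \<le> dim {x \<in> ?K. f i x = 0} + 1"
    using assms insert.prems
    by (intro dim_cut_one[of B] subspace_common_kernel) auto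
  moreover have "{x \<in> ?K. f i x = 0} = {x \<in> V. \<forall>i\<in>insert i I. f i x = 0}"
    by auto
  ultimately show ?case
    using insert by auto
qed

lemma extend_subspace_basis:
  assumes "finite B" and "V \<subseteq> span B" and "subspace V" and "subspace U" and "U \<subseteq> V"
  obtains C D where "finite C" "finite D" "C \<inter> D = {}" "independent (C \<union> D)"
    "U = span C" "V = span (C \<union> D)" "card C = dim U" "card C + card D = dim V"
proof -
  have UV: "U \<subseteq> V" by fact
  obtain C where C: "finite C" "C \<subseteq> U" "independent C" "U \<subseteq> span C" "card C = dim U"
    by (rule finite_basis_of[OF assms(1) subset_trans[OF UV assms(2)]])
  have "C \<subseteq> V" using C assms by blast
  then obtain E where E: "C \<subseteq> E" "E \<subseteq> V" "independent E" "V \<subseteq> span E"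
    using maximal_independent_subset_extend[of C V] C(3) by blast
  have finE: "finite E"
    using independent_span_bound[OF assms(1) E(3)] E(2) assms(2) by blast
  have "card E = dim V"
    using E basis_card_eq_dim by blast
  moreover have "card C + card (E - C) = card E"
    using E(1) finE by (metis C(1) add.commute card_Diff_subset card_mono le_add_diff_inverse2)
  moreover have "V = span E"
    using E span_minimal[OF E(2) assms(3)] by blast
  moreover have "U = span C"
    using C span_minimal[OF C(2) assms(4)] by blast
  moreover have "C \<union> (E - C) = E" using E(1) by blast
  ultimately show ?thesis
    using that[of C "E - C"] C finE E by auto
qed

lemma exists_functionals_cutting_out:
  assumes "finite B" and "V \<subseteq> span B" and "subspace V" and "subspace U" and "U \<subseteq> V"
  obtains I :: "'b set" and f where "finite I" "card I + dim U = dim V"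
    "\<And>i. i \<in> I \<Longrightarrow> functional scale (f i)" "U = {x \<in> V. \<forall>i\<in>I. f i x = 0}"
proof -
  obtain C D where CD: "finite C" "finite D" "C \<inter> D = {}" "independent (C \<union> D)"
    "U = span C" "V = span (C \<union> D)" "card C = dim U" "card C + card D = dim V"
    by (rule extend_subspace_basis[OF assms])
  obtain E where E: "C \<union> D \<subseteq> E" "independent E" "span E = UNIV"
    using CD(4) extend_basis_superset[OF CD(4)] independent_extend_basis[OF CD(4)]
      span_extend_basis[OF CD(4)] by blast
  define f where "f d x = representation E x d" for d x
  have lin: "functional scale (f d)" for d
    unfolding f_def using E by (intro linear_representation) auto
  have fb: "f d x = (if x = d then 1 else 0)" if "x \<in> E" for d x
    unfolding f_def using representation_basis[OF E(2) that] by auto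
  have "x \<in> U \<longleftrightarrow> x \<in> V \<and> (\<forall>d\<in>D. f d x = 0)" for x
  proof
    assume x: "x \<in> U"
    have "f d x = 0" if d: "d \<in> D" for d
    proof -
      have "span C \<subseteq> {x. f d x = 0}"
      proof (rule span_minimal)
        show "C \<subseteq> {x. f d x = 0}"
        proof
          fix x assume "x \<in> C"
          then have "x \<in> E" "x \<noteq> d"
            using CD(3) d E(1) by auto
          then show "x \<in> {x. f d x = 0}"
            by (simp add: fb)
        qed
        show "subspace {x. f d x = 0}"
          by (auto simp: subspace_def functional_add[OF lin] functional_scale[OF lin]
              functional_zero[OF lin])
      qed
      then show ?thesis using x CD(5) by blast
    qed
    then show "x \<in> V \<and> (\<forall>d\<in>D. f d x = 0)"
      using x assms(5) by blast
  next
    assume x: "x \<in> V \<and> (\<forall>d\<in>D. f d x = 0)"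
    then obtain g where g: "x = (\<Sum>b\<in>C \<union> D. scale (g b) b)"
      using CD(1,2,6) span_finite[of "C \<union> D"] by auto
    have "g d = 0" if d: "d \<in> D" for d
    proof -
      have "f d x = (\<Sum>b\<in>C \<union> D. g b * f d b)"
        unfolding g by (simp add: functional_sum[OF lin] functional_scale[OF lin])
      also have "\<dots> = (\<Sum>b\<in>C \<union> D. if b = d then g b else 0)"
        by (rule sum.cong) (use E(1) in \<open>auto simp: fb\<close>)
      also have "\<dots> = g d"
        using CD(1,2) d by (simp add: sum.delta)
      finally show ?thesis using x d by simp
    qed
    then have "x = (\<Sum>b\<in>C. scale (g b) b)"
      unfolding g using CD by (simp add: sum.union_disjoint)
    then show "x \<in> U"
      using CD(5) by (auto intro: span_sum span_scale span_base)
  qed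
  then show ?thesis
    using that[of D f] CD lin by auto
qed

text \<open>
  Writing \<open>S\<close> as the common kernel of \<open>dim V - dim S\<close> functionals on \<open>V\<close>, the bound says that
  imposing these functionals on \<open>T\<close> lowers its dimension by at most their number.
\<close>

lemma dim_Int_supermodular:
  assumes "finite B" and "V \<subseteq> span B" and "subspace V"
    and "subspace S" and "S \<subseteq> V" and "subspace T" and "T \<subseteq> V"
  shows "dim S + dim T \<le> dim V + dim (S \<inter> T)"
proof -
  obtain I :: "'b set" and f where I: "finite I" "card I + dim S = dim V"
    "\<And>i. i \<in> I \<Longrightarrow> functional scale (f i)" "S = {x \<in> V. \<forall>i\<in>I. f i x = 0}"
    by (rule exists_functionals_cutting_out[OF assms(1-3,4,5)]) blast
  have "dim T \<le> dim {x \<in> T. \<forall>i\<in>I. f i x = 0} + card I"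
    using assms I by (intro dim_cut[of B]) auto
  moreover have "{x \<in> T. \<forall>i\<in>I. f i x = 0} = S \<inter> T"
    using I(4) assms(7) by auto
  ultimately show ?thesis
    using I(2) by simp
qed

lemma exists_separating_functional:
  assumes "subspace S" and "h \<notin> S"
  obtains f where "functional scale f" "\<And>x. x \<in> S \<Longrightarrow> f x = 0" "f h = 1"
proof -
  obtain C where C: "C \<subseteq> S" "independent C" "S \<subseteq> span C"
    using maximal_independent_subset by metis
  have "span C \<subseteq> S"
    using C(1) assms(1) by (rule span_minimal)
  then have h: "h \<notin> span C" using assms(2) by blast
  then have hC: "independent (insert h C)"
    using C(2) by (rule independent_insertI)
  obtain E where E: "insert h C \<subseteq> E" "independent E" "span E = UNIV"
    using extend_basis_superset[OF hC] independent_extend_basis[OF hC]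
      span_extend_basis[OF hC] by blast
  define f where "f x = representation E x h" for x
  have lin: "functional scale f"
    unfolding f_def using E by (intro linear_representation) auto
  have fb: "f x = (if x = h then 1 else 0)" if "x \<in> E" for x
    unfolding f_def using representation_basis[OF E(2) that] by auto
  have "span C \<subseteq> {x. f x = 0}"
  proof (rule span_minimal)
    have "h \<notin> C" using h span_base by blast
    then show "C \<subseteq> {x. f x = 0}"
      using E(1) by (auto simp: fb)
    show "subspace {x. f x = 0}"
      by (auto simp: subspace_def functional_add[OF lin] functional_scale[OF lin]
          functional_zero[OF lin])
  qed
  then have "f x = 0" if "x \<in> S" for x
    using that C(3) by blast
  moreover have "f h = 1" using E(1) by (auto simp: fb)
  ultimately show ?thesis using that lin by blast
qed

text \<open>
  Linear conditions that depend polynomially on a parameter \<open>s\<close> have smaller rank than at \<open>s\<^sub>0\<close> only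
  for finitely many \<open>s\<close>. Instead of minors, the proof uses one step of Gaussian elimination: if
  \<open>f r s\<^sub>0 u \<noteq> 0\<close>, then \<open>f r s u\<close> vanishes for finitely many \<open>s\<close> only, and away from them the kernel
  plus the line through \<open>u\<close> is the kernel of the conditions \<open>g\<close>, which are polynomial in \<open>s\<close> again.
  The induction is on the codimension of the kernel at \<open>s\<^sub>0\<close>.
\<close>

lemma dim_kernel_semicontinuous:
  fixes f :: "'r \<Rightarrow> 'a \<Rightarrow> 'b \<Rightarrow> 'a"
  assumes B: "finite B" "V \<subseteq> span B" and V: "subspace V"
    and lin: "\<And>r s. r \<in> R \<Longrightarrow> functional scale (f r s)"
    and pol: "\<And>r x. r \<in> R \<Longrightarrow> x \<in> V \<Longrightarrow> \<exists>p. \<forall>s. f r s x = poly p s"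
  shows "finite {s. dim {x \<in> V. \<forall>r\<in>R. f r s\<^sub>0 x = 0} < dim {x \<in> V. \<forall>r\<in>R. f r s x = 0}}"
  using lin pol
proof (induction "dim V - dim {x \<in> V. \<forall>r\<in>R. f r s\<^sub>0 x = 0}" arbitrary: f rule: less_induct)
  case less
  note lin = less.prems(1) and pol = less.prems(2)
  define K where "K s = {x \<in> V. \<forall>r\<in>R. f r s x = 0}" for s
  have KV: "K s \<subseteq> V" for s by (auto simp: K_def)
  have subK: "subspace (K s)" for s
    unfolding K_def using V lin by (intro subspace_common_kernel)
  show ?case
  proof (cases "K s\<^sub>0 = V")
    case True
    have "dim (K s) \<le> dim V" for s
      using B KV by (rule dim_mono_finite)
    then have "{s. dim (K s\<^sub>0) < dim (K s)} = {}"
      by (simp add: True not_less)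
    then show ?thesis
      unfolding K_def by simp
  next
    case False
    then obtain u r where u: "u \<in> V" "r \<in> R" "f r s\<^sub>0 u \<noteq> 0"
      unfolding K_def by auto
    define g where "g r' s x = f r s u * f r' s x - f r s x * f r' s u" for r' s x
    define L where "L s = {x \<in> V. \<forall>r\<in>R. g r s x = 0}" for s
    have ling: "functional scale (g r' s)" if "r' \<in> R" for r' s
      using u(2) that
      by (intro functionalI)
         (auto simp: g_def functional_add[OF lin] functional_scale[OF lin] algebra_simps)
    have polg: "\<exists>p. \<forall>s. g r' s x = poly p s" if rR: "r' \<in> R" and xV: "x \<in> V" for r' x
    proof -
      obtain p1 where p1: "\<forall>s. f r s u = poly p1 s" using pol u(1,2) rR by blast
      obtain p2 where p2: "\<forall>s. f r' s x = poly p2 s" using pol xV u(2) rR by blast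
      obtain p3 where p3: "\<forall>s. f r s x = poly p3 s" using pol xV u(2) rR by blast
      obtain p4 where p4: "\<forall>s. f r' s u = poly p4 s" using pol u(1,2) rR by blast
      have "\<forall>s. g r' s x = poly (p1 * p2 - p3 * p4) s"
        by (simp add: g_def p1 p2 p3 p4)
      then show ?thesis by blast
    qed
    have LV: "L s \<subseteq> V" for s by (auto simp: L_def)
    have KL: "K s \<subseteq> L s" for s
      using u by (auto simp: K_def L_def g_def)
    have uL: "u \<in> L s" for s
      using u by (auto simp: L_def g_def)
    have uK: "u \<notin> K s" if "f r s u \<noteq> 0" for s
      using u that by (auto simp: K_def)
    have strict: "dim (K s) < dim (L s)" if "f r s u \<noteq> 0" for s
      using B(1) _ subK KL uL uK[OF that]
      by (rule dim_less_if_proper) (use LV B in blast)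
    have "L s\<^sub>0 \<inter> {x. f r s\<^sub>0 x = 0} \<subseteq> K s\<^sub>0"
      using u by (auto simp: K_def L_def g_def)
    then have "dim {x \<in> L s\<^sub>0. f r s\<^sub>0 x = 0} \<le> dim (K s\<^sub>0)"
      using B KV by (intro dim_mono_finite[of B]) auto
    moreover have "dim (L s\<^sub>0) \<le> dim {x \<in> L s\<^sub>0. f r s\<^sub>0 x = 0} + 1"
      using B LV lin u(2) ling V unfolding L_def
      by (intro dim_cut_one[of B] subspace_common_kernel) auto
    ultimately have L0: "dim (L s\<^sub>0) = dim (K s\<^sub>0) + 1"
      using strict[OF u(3)] by linarith
    moreover have "dim (L s\<^sub>0) \<le> dim V"
      using B LV by (rule dim_mono_finite)
    ultimately have "dim V - dim (L s\<^sub>0) < dim V - dim (K s\<^sub>0)"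
      by linarith
    then have fin: "finite {s. dim (L s\<^sub>0) < dim (L s)}"
      using less.hyps[of g] ling polg unfolding L_def K_def by blast
    obtain p where p: "\<forall>s. f r s u = poly p s"
      using pol u(1,2) by blast
    then have "p \<noteq> 0" using u(3) by auto
    then have "finite {s. f r s u = 0}"
      using p poly_roots_finite[of p] by simp
    then have "finite ({s. dim (L s\<^sub>0) < dim (L s)} \<union> {s. f r s u = 0})"
      using fin by blast
    moreover have "{s. dim (K s\<^sub>0) < dim (K s)} \<subseteq> {s. dim (L s\<^sub>0) < dim (L s)} \<union> {s. f r s u = 0}"
      using strict L0 by fastforce
    ultimately show ?thesis
      unfolding K_def by (rule rev_finite_subset)
  qed
qed

end

section \<open>Degeneration of linear conditions\<close>

context vector_space_pair
begin

text \<open>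
  The condition \<open>\<Sum>\<^sub>e t\<^sup>e C\<^sub>e x \<in> W\<close> is rescaled before passing to the limit \<open>t \<rightarrow> 0\<close>: a functional that
  kills \<open>W\<close> and the space \<open>X e\<close>, in which all terms below \<open>e\<close> lie, can be divided by \<open>t\<^sup>e\<close>, and its
  value at \<open>t = 0\<close> only sees \<open>C e x\<close>. Letting the functional vary, the limit conditions become
  \<open>C e x \<in> W + X e\<close>. This computes the initial forms of \<open>W\<close> with respect to a grading, and is used
  for contracting groups of points as well as for moving binary forms by a torus.
\<close>

lemma dim_degeneration:
  fixes C :: "'i \<Rightarrow> nat \<Rightarrow> 'b \<Rightarrow> 'c" and X :: "nat \<Rightarrow> 'c set"
  assumes B: "finite B" "V \<subseteq> vs1.span B" and V: "vs1.subspace V"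
    and lin: "\<And>i e. Vector_Spaces.linear s1 s2 (C i e)"
    and W: "vs2.subspace W" and X: "\<And>e. vs2.subspace (X e)"
    and CX: "\<And>i e e' x. i \<in> I \<Longrightarrow> e' < e \<Longrightarrow> x \<in> V \<Longrightarrow> C i e' x \<in> X e"
  shows "finite {t. t \<noteq> 0 \<and> vs1.dim {x \<in> V. \<forall>i\<in>I. \<forall>e\<le>D. \<exists>h\<in>X e. C i e x + h \<in> W}
    < vs1.dim {x \<in> V. \<forall>i\<in>I. (\<Sum>e\<le>D. s2 (t ^ e) (C i e x)) \<in> W}}" (is "finite ?E")
proof -
  define R where "R = {(i, e, f). i \<in> I \<and> e \<le> D \<and> functional s2 f \<and>
    (\<forall>y\<in>W. f y = 0) \<and> (\<forall>y\<in>X e. f y = 0)}"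
  define \<phi> where "\<phi> r t x = (case r of (i, e, f) \<Rightarrow> \<Sum>e'=e..D. t ^ (e' - e) * f (C i e' x))"
    for r :: "'i \<times> nat \<times> ('c \<Rightarrow> 'a)" and t x
  define K where "K t = {x \<in> V. \<forall>r\<in>R. \<phi> r t x = 0}" for t
  have KV: "K t \<subseteq> V" for t by (auto simp: K_def)
  have C_add: "C i e (x + y) = C i e x + C i e y" and C_scale: "C i e (s1 c x) = s2 c (C i e x)"
    for i e x y c
    using lin[of i e] by (simp_all add: Vector_Spaces.linear_iff)
  have "functional s1 (\<phi> r t)" if r: "r \<in> R" for r t
  proof -
    obtain i e f where r': "r = (i, e, f)" "functional s2 f"
      using r unfolding R_def by auto
    show ?thesis
      by (rule vs1.functionalI)
         (auto simp: r'(1) \<phi>_def C_add C_scale vs2.functional_add[OF r'(2)]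
           vs2.functional_scale[OF r'(2)] sum.distrib sum_distrib_left algebra_simps)
  qed
  moreover have "\<exists>p. \<forall>t. \<phi> r t x = poly p t" for r x
  proof -
    obtain i e f where r': "r = (i, e, f)"
      using prod_cases3 by blast
    have "\<phi> r t x = poly (\<Sum>e'=e..D. monom (f (C i e' x)) (e' - e)) t" for t
      by (auto simp: r' \<phi>_def poly_sum poly_monom intro!: sum.cong)
    then show ?thesis by blast
  qed
  ultimately have fin: "finite {t. vs1.dim (K 0) < vs1.dim (K t)}"
    unfolding K_def using B V by (intro vs1.dim_kernel_semicontinuous)
  have K0: "K 0 \<subseteq> {x \<in> V. \<forall>i\<in>I. \<forall>e\<le>D. \<exists>h\<in>X e. C i e x + h \<in> W}"
  proof
    fix x assume x: "x \<in> K 0"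
    have "\<exists>h\<in>X e. C i e x + h \<in> W" if ie: "i \<in> I" "e \<le> D" for i e
    proof -
      let ?S = "{w + h |w h. w \<in> W \<and> h \<in> X e}"
      have S: "vs2.subspace ?S"
        using W X by (rule vs2.subspace_sums)
      have "C i e x \<in> ?S"
      proof (rule ccontr)
        assume "C i e x \<notin> ?S"
        then obtain f where f: "functional s2 f" "\<And>y. y \<in> ?S \<Longrightarrow> f y = 0" "f (C i e x) = 1"
          by (rule vs2.exists_separating_functional[OF S]) blast
        (* f kills the sum, hence both summands, so it is one of the rescaled conditions *)
        have "f y = 0" if "y \<in> W" for y
          using f(2)[of y] that vs2.subspace_0[OF X] by (metis (mono_tags, lifting) add.right_neutral mem_Collect_eq)
        moreover have "f y = 0" if "y \<in> X e" for y
          using f(2)[of y] that vs2.subspace_0[OF W] by (metis (mono_tags, lifting) add.left_neutral mem_Collect_eq)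
        ultimately have "(i, e, f) \<in> R"
          using ie f(1) by (auto simp: R_def)
        then have "\<phi> (i, e, f) 0 x = 0"
          using x by (auto simp: K_def)
        also have "\<phi> (i, e, f) 0 x = (\<Sum>e'=e..D. if e' = e then f (C i e' x) else 0)"
          unfolding \<phi>_def prod.case by (rule sum.cong) auto
        also have "\<dots> = f (C i e x)"
          using ie by (simp add: sum.delta)
        finally show False using f(3) by simp
      qed
      then obtain w h where wh: "C i e x = w + h" "w \<in> W" "h \<in> X e" by blast
      then have "C i e x + (- h) \<in> W" by simp
      moreover have "- h \<in> X e"
        using wh(3) X by (rule vs2.subspace_neg[rotated])
      ultimately show ?thesis by blast
    qed
    then show "x \<in> {x \<in> V. \<forall>i\<in>I. \<forall>e\<le>D. \<exists>h\<in>X e. C i e x + h \<in> W}"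
      using x KV by blast
  qed
  have Kt: "{x \<in> V. \<forall>i\<in>I. (\<Sum>e\<le>D. s2 (t ^ e) (C i e x)) \<in> W} \<subseteq> K t" if t: "t \<noteq> 0" for t
  proof
    fix x assume x: "x \<in> {x \<in> V. \<forall>i\<in>I. (\<Sum>e\<le>D. s2 (t ^ e) (C i e x)) \<in> W}"
    have "\<phi> r t x = 0" if r: "r \<in> R" for r
    proof -
      obtain i e f where r': "r = (i, e, f)" "i \<in> I" "e \<le> D" "functional s2 f"
        "\<And>y. y \<in> W \<Longrightarrow> f y = 0" "\<And>y. y \<in> X e \<Longrightarrow> f y = 0"
        using r unfolding R_def by auto
      have "0 = f (\<Sum>e\<le>D. s2 (t ^ e) (C i e x))"
        using r' x by auto
      also have "\<dots> = (\<Sum>e'\<le>D. t ^ e' * f (C i e' x))"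
        by (simp add: vs2.functional_sum[OF r'(4)] vs2.functional_scale[OF r'(4)])
      also have "\<dots> = (\<Sum>e'=e..D. t ^ e' * f (C i e' x))"
        using r' x CX by (intro sum.mono_neutral_right) (auto simp: not_le)
      also have "\<dots> = t ^ e * \<phi> r t x"
        by (auto simp: r'(1) \<phi>_def sum_distrib_left power_add[symmetric] mult.assoc[symmetric] intro!: sum.cong)
      finally show ?thesis using t by simp
    qed
    then show "x \<in> K t" using x by (auto simp: K_def)
  qed
  have "?E \<subseteq> {t. vs1.dim (K 0) < vs1.dim (K t)}"
  proof
    fix t assume t: "t \<in> ?E"
    have "vs1.dim (K 0) \<le> vs1.dim {x \<in> V. \<forall>i\<in>I. \<forall>e\<le>D. \<exists>h\<in>X e. C i e x + h \<in> W}"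
      using B K0 by (intro vs1.dim_mono_finite[of B]) auto
    moreover have "vs1.dim {x \<in> V. \<forall>i\<in>I. (\<Sum>e\<le>D. s2 (t ^ e) (C i e x)) \<in> W} \<le> vs1.dim (K t)"
      using vs1.dim_mono_finite[OF B(1) subset_trans[OF KV B(2)] Kt] t by blast
    ultimately show "t \<in> {t. vs1.dim (K 0) < vs1.dim (K t)}"
      using t by auto
  qed
  then show ?thesis using fin by (rule finite_subset)
qed

end

section \<open>Generic frames\<close>

text \<open>
  A frame is a \<open>3\<close> by \<open>3\<close> matrix, thought of as a point of the plane (the last column) together with
  two tangent directions. Degenerate matrices are included, so that tuples of frames form an affine
  space, in which any two elements are joined by a line.
\<close>

type_synonym frame = "3 \<Rightarrow> 3 \<Rightarrow> complex"

definition line :: "(nat \<Rightarrow> frame) \<Rightarrow> (nat \<Rightarrow> frame) \<Rightarrow> complex \<Rightarrow> nat \<Rightarrow> frame" where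
  "line x y s = (\<lambda>i a b. (1 - s) * x i a b + s * y i a b)"

lemma line_1 [simp]: "line x y 1 = y"
  by (simp add: line_def)

lemma line_flip: "line y x s = line x y (1 - s)"
  by (simp add: line_def add.commute)

definition poly_on_lines :: "((nat \<Rightarrow> frame) \<Rightarrow> complex) \<Rightarrow> bool" where
  "poly_on_lines f \<longleftrightarrow> (\<forall>x y. \<exists>p. \<forall>s. f (line x y s) = poly p s)"

lemma poly_on_lines_const [simp]: "poly_on_lines (\<lambda>x. c)"
  unfolding poly_on_lines_def by (auto intro: exI[of _ "[:c:]"])

lemma poly_on_lines_coordinate [simp]: "poly_on_lines (\<lambda>x. x i a b)"
  unfolding poly_on_lines_def line_def
  by (intro allI, rule_tac x = "[:x i a b, y i a b - x i a b:]" in exI) (simp add: algebra_simps)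

lemma poly_on_lines_add:
  assumes "poly_on_lines f" "poly_on_lines g"
  shows "poly_on_lines (\<lambda>x. f x + g x)"
  using assms unfolding poly_on_lines_def by (metis poly_add)

lemma poly_on_lines_mult:
  assumes "poly_on_lines f" "poly_on_lines g"
  shows "poly_on_lines (\<lambda>x. f x * g x)"
  using assms unfolding poly_on_lines_def by (metis poly_mult)

lemma poly_on_lines_sum:
  assumes "\<And>i. i \<in> I \<Longrightarrow> poly_on_lines (f i)"
  shows "poly_on_lines (\<lambda>x. \<Sum>i\<in>I. f i x)"
  using assms by (induction I rule: infinite_finite_induct) (auto intro: poly_on_lines_add)

lemma poly_on_lines_diff:
  assumes "poly_on_lines f" "poly_on_lines g"
  shows "poly_on_lines (\<lambda>x. f x - g x)"
  using poly_on_lines_add[OF assms(1) poly_on_lines_mult[OF poly_on_lines_const[of "-1"] assms(2)]]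
  by simp

text \<open>
  A substitute for nonempty Zariski open sets that refers to lines only: every line through a member
  stays in the set up to finitely many parameters. Two such sets meet on the line joining a member
  of the first to a member of the second; this makes them closed under finite intersections.
\<close>

definition generic :: "(nat \<Rightarrow> frame) set \<Rightarrow> bool" where
  "generic S \<longleftrightarrow> S \<noteq> {} \<and> (\<forall>x. \<forall>y\<in>S. finite {s. line x y s \<notin> S})"

lemma generic_imp_nonempty: "generic S \<Longrightarrow> \<exists>x. x \<in> S"
  by (auto simp: generic_def)

lemma generic_UNIV [simp]: "generic UNIV"
  by (simp add: generic_def)

lemma generic_Int:
  assumes S: "generic S" and T: "generic T"
  shows "generic (S \<inter> T)"
proof -
  obtain x y where xy: "x \<in> S" "y \<in> T"
    using assms unfolding generic_def by blast
  have fT: "finite {s. line x y s \<notin> T}"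
    using T xy unfolding generic_def by blast
  have "finite {s. line y x s \<notin> S}"
    using S xy unfolding generic_def by blast
  then have "finite ((\<lambda>s. 1 - s) ` {s. line y x s \<notin> S})"
    by blast
  moreover have "{s. line x y s \<notin> S} \<subseteq> (\<lambda>s. 1 - s) ` {s. line y x s \<notin> S}"
    by (auto simp: line_flip[of y x] image_iff intro!: exI[of _ "1 - _"])
  ultimately have "finite {s. line x y s \<notin> S}"
    using finite_subset by blast
  with fT have "finite ({s. line x y s \<notin> S} \<union> {s. line x y s \<notin> T})"
    by blast
  then obtain s where "s \<notin> {s. line x y s \<notin> S} \<union> {s. line x y s \<notin> T}"
    using infinite_UNIV_char_0 ex_new_if_finite by metis
  then have "S \<inter> T \<noteq> {}" by blast
  moreover have "finite {s. line x y s \<notin> S \<inter> T}" if "y \<in> S \<inter> T" for x y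
  proof -
    have "{s. line x y s \<notin> S \<inter> T} = {s. line x y s \<notin> S} \<union> {s. line x y s \<notin> T}"
      by blast
    then show ?thesis
      using S T that unfolding generic_def by simp
  qed
  ultimately show ?thesis unfolding generic_def by blast
qed

lemma generic_INT:
  assumes "finite I" and "\<And>i. i \<in> I \<Longrightarrow> generic (S i)"
  shows "generic (\<Inter>i\<in>I. S i)"
  using assms by (induction I rule: finite_induct) (auto intro: generic_Int)

lemma generic_nonzero:
  assumes "poly_on_lines f" and "f x\<^sub>0 \<noteq> 0"
  shows "generic {x. f x \<noteq> 0}"
  unfolding generic_def
proof (intro conjI allI ballI)
  show "{x. f x \<noteq> 0} \<noteq> {}" using assms(2) by blast
  fix x y assume y: "y \<in> {x. f x \<noteq> 0}"
  obtain p where p: "\<And>s. f (line x y s) = poly p s"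
    using assms(1) unfolding poly_on_lines_def by blast
  have "poly p 1 \<noteq> 0" using p[of 1] y by simp
  then have "p \<noteq> 0" by auto
  then show "finite {s. line x y s \<notin> {x. f x \<noteq> 0}}"
    using poly_roots_finite[of p] by (simp add: p)
qed

lemma generic_dim_le:
  fixes f :: "'r \<Rightarrow> (nat \<Rightarrow> frame) \<Rightarrow> ternary_poly \<Rightarrow> complex"
  assumes B: "finite B" "V \<subseteq> tpoly.span B" and V: "tpoly.subspace V"
    and lin: "\<And>r x. r \<in> R \<Longrightarrow> functional pscale (f r x)"
    and pol: "\<And>r F. r \<in> R \<Longrightarrow> F \<in> V \<Longrightarrow> poly_on_lines (\<lambda>x. f r x F)"
    and x0: "tpoly.dim {F \<in> V. \<forall>r\<in>R. f r x\<^sub>0 F = 0} \<le> k"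
  shows "generic {x. tpoly.dim {F \<in> V. \<forall>r\<in>R. f r x F = 0} \<le> k}"
  unfolding generic_def
proof (intro conjI allI ballI)
  let ?d = "\<lambda>x. tpoly.dim {F \<in> V. \<forall>r\<in>R. f r x F = 0}"
  show "{x. ?d x \<le> k} \<noteq> {}" using x0 by blast
  fix x y assume y: "y \<in> {x. ?d x \<le> k}"
  have "finite {s. ?d (line x y 1) < ?d (line x y s)}"
    using tpoly.dim_kernel_semicontinuous[OF B V, of R "\<lambda>r s. f r (line x y s)" 1] lin pol
    unfolding poly_on_lines_def by blast
  moreover have "{s. line x y s \<notin> {x. ?d x \<le> k}} \<subseteq> {s. ?d (line x y 1) < ?d (line x y s)}"
    using y by auto
  ultimately show "finite {s. line x y s \<notin> {x. ?d x \<le> k}}"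
    by (rule rev_finite_subset)
qed

section \<open>Linear substitutions in ternary forms\<close>

lemma lookup_mult_sum:
  fixes F G :: ternary_poly
  assumes "finite S" "finite T" "Poly_Mapping.keys F \<subseteq> S" "Poly_Mapping.keys G \<subseteq> T"
  shows "Poly_Mapping.lookup (F * G) u = (\<Sum>s\<in>S. \<Sum>t\<in>T.
    if s + t = u then Poly_Mapping.lookup F s * Poly_Mapping.lookup G t else 0)"
proof -
  have expand: "H = (\<Sum>s\<in>S. Poly_Mapping.single s (Poly_Mapping.lookup H s))"
    if "finite S" "Poly_Mapping.keys H \<subseteq> S" for H :: ternary_poly and S
  proof (rule poly_mapping_eqI)
    fix t
    have "t \<notin> S \<Longrightarrow> Poly_Mapping.lookup H t = 0"
      using that by (auto simp: in_keys_iff)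
    then show "Poly_Mapping.lookup H t =
      Poly_Mapping.lookup (\<Sum>s\<in>S. Poly_Mapping.single s (Poly_Mapping.lookup H s)) t"
      using that(1) by (simp add: lookup_sum lookup_single when_def)
  qed
  have "F * G = (\<Sum>s\<in>S. Poly_Mapping.single s (Poly_Mapping.lookup F s)) *
    (\<Sum>t\<in>T. Poly_Mapping.single t (Poly_Mapping.lookup G t))"
    using expand[OF assms(1,3)] expand[OF assms(2,4)] by simp
  also have "\<dots> = (\<Sum>s\<in>S. \<Sum>t\<in>T.
      Poly_Mapping.single (s + t) (Poly_Mapping.lookup F s * Poly_Mapping.lookup G t))"
    by (simp add: sum_product mult_single)
  finally show ?thesis
    by (simp add: lookup_sum lookup_single when_def)
qed

definition mon_eval :: "(3 \<Rightarrow> ternary_poly) \<Rightarrow> (3 \<Rightarrow>\<^sub>0 nat) \<Rightarrow> ternary_poly" where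
  "mon_eval \<sigma> t = (\<Prod>i\<in>UNIV. \<sigma> i ^ Poly_Mapping.lookup t i)"

lemma mon_eval_add: "mon_eval \<sigma> (s + t) = mon_eval \<sigma> s * mon_eval \<sigma> t"
  by (simp add: mon_eval_def lookup_add power_add prod.distrib)

lemma psubst_superset:
  assumes "finite S" "Poly_Mapping.keys F \<subseteq> S"
  shows "psubst \<sigma> F = (\<Sum>t\<in>S. pscale (Poly_Mapping.lookup F t) (mon_eval \<sigma> t))"
  unfolding psubst_def mon_eval_def
  using assms by (intro sum.mono_neutral_left) (auto simp: in_keys_iff)

lemma psubst_add: "psubst \<sigma> (F + G) = psubst \<sigma> F + psubst \<sigma> G"
proof -
  let ?S = "Poly_Mapping.keys F \<union> Poly_Mapping.keys G"
  have "Poly_Mapping.keys (F + G) \<subseteq> ?S" by (rule keys_add)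
  then show ?thesis
    by (simp add: psubst_superset[of ?S] lookup_add tpoly.scale_left_distrib sum.distrib)
qed

lemma psubst_pscale: "psubst \<sigma> (pscale c F) = pscale c (psubst \<sigma> F)"
proof -
  have "Poly_Mapping.keys (pscale c F) \<subseteq> Poly_Mapping.keys F"
    by (auto simp: in_keys_iff)
  then show ?thesis
    by (simp add: psubst_superset[of "Poly_Mapping.keys F"] tpoly.scale_sum_right)
qed

lemma psubst_single: "psubst \<sigma> (Poly_Mapping.single t c) = pscale c (mon_eval \<sigma> t)"
  by (subst psubst_superset[of "{t}"]) auto

lemma psubst_0 [simp]: "psubst \<sigma> 0 = 0"
  by (simp add: psubst_def)

lemma psubst_sum: "psubst \<sigma> (\<Sum>i\<in>I. F i) = (\<Sum>i\<in>I. psubst \<sigma> (F i))"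
  by (induction I rule: infinite_finite_induct) (auto simp: psubst_add)

lemma sum_monomials: "F = (\<Sum>t\<in>Poly_Mapping.keys F. Poly_Mapping.single t (Poly_Mapping.lookup F t))"
  for F :: ternary_poly
  by (rule poly_mapping_eqI) (simp add: lookup_sum lookup_single when_def in_keys_iff)

lemma pscale_conv_mult: "pscale c F = pconst c * F"
  by (simp add: pscale_def pconst_def mult_map_scale_conv_mult)

lemma pscale_mult: "pscale c F * pscale d G = pscale (c * d) (F * G)"
proof -
  have "pconst (c * d) = pconst c * pconst d"
    by (simp add: pconst_def mult_single)
  then show ?thesis by (simp add: pscale_conv_mult algebra_simps)
qed

text \<open>
  Both sides are bilinear, and on monomials the claim is \<open>mon_eval_add\<close>.
\<close>

lemma psubst_mult: "psubst \<sigma> (F * G) = psubst \<sigma> F * psubst \<sigma> G"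
proof -
  let ?F = "\<Sum>s\<in>Poly_Mapping.keys F. Poly_Mapping.single s (Poly_Mapping.lookup F s)"
  let ?G = "\<Sum>t\<in>Poly_Mapping.keys G. Poly_Mapping.single t (Poly_Mapping.lookup G t)"
  have "psubst \<sigma> (?F * ?G) = psubst \<sigma> ?F * psubst \<sigma> ?G"
    by (simp add: sum_product mult_single psubst_sum psubst_single mon_eval_add pscale_mult)
  then show ?thesis
    using sum_monomials[of F] sum_monomials[of G] by simp
qed

lemma psubst_1 [simp]: "psubst \<sigma> 1 = 1"
proof -
  have "mon_eval \<sigma> 0 = 1" by (simp add: mon_eval_def)
  then show ?thesis
    using psubst_single[of \<sigma> 0 1] by simp
qed

lemma psubst_power: "psubst \<sigma> (F ^ n) = psubst \<sigma> F ^ n"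
  by (induction n) (auto simp: psubst_mult)

lemma psubst_prod: "psubst \<sigma> (\<Prod>i\<in>I. F i) = (\<Prod>i\<in>I. psubst \<sigma> (F i))"
  by (induction I rule: infinite_finite_induct) (auto simp: psubst_mult)

lemma mon_eval_single: "mon_eval \<sigma> (Poly_Mapping.single i n) = \<sigma> i ^ n"
proof -
  have "mon_eval \<sigma> (Poly_Mapping.single i n) = (\<Prod>j\<in>UNIV. if j = i then \<sigma> i ^ n else 1)"
    unfolding mon_eval_def by (rule prod.cong) (auto simp: lookup_single when_def)
  then show ?thesis by simp
qed

lemma psubst_pvar [simp]: "psubst \<sigma> (pvar i) = \<sigma> i"
  by (simp add: pvar_def psubst_single mon_eval_single)

lemma psubst_psubst: "psubst \<tau> (psubst \<sigma> F) = psubst (\<lambda>i. psubst \<tau> (\<sigma> i)) F"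
proof -
  have "psubst \<tau> (mon_eval \<sigma> t) = mon_eval (\<lambda>i. psubst \<tau> (\<sigma> i)) t" for t
    by (simp add: mon_eval_def psubst_prod psubst_power)
  then show ?thesis
    by (simp add: psubst_superset[of "Poly_Mapping.keys F"] psubst_sum psubst_pscale)
qed

lemma mon_eval_pvar: "mon_eval pvar t = Poly_Mapping.single t 1"
proof -
  have power: "pvar i ^ n = Poly_Mapping.single (Poly_Mapping.single i n) 1" for i n
    by (induction n) (auto simp: pvar_def mult_single single_add[symmetric])
  have prod: "(\<Prod>i\<in>I. Poly_Mapping.single (g i) 1) = (Poly_Mapping.single (\<Sum>i\<in>I. g i) 1 :: ternary_poly)"
    if "finite I" for I :: "3 set" and g
    using that by (induction I rule: finite_induct) (auto simp: mult_single)
  have "(\<Sum>i\<in>UNIV. Poly_Mapping.single i (Poly_Mapping.lookup t i)) = t"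
    by (rule poly_mapping_eqI) (simp add: lookup_sum lookup_single when_def)
  then show ?thesis
    by (simp add: mon_eval_def power prod)
qed

lemma psubst_pvar_id: "psubst pvar F = F"
  using sum_monomials[of F]
  by (simp add: psubst_superset[of "Poly_Mapping.keys F"] mon_eval_pvar)
     (metis (no_types, lifting) lookup_pscale lookup_single mult.right_neutral mult_zero_right poly_mapping_eqI sum.cong when_def)

definition linear_form :: "frame \<Rightarrow> 3 \<Rightarrow> ternary_poly" where
  "linear_form A i = (\<Sum>j\<in>UNIV. pscale (A i j) (pvar j))"

definition lsubst :: "frame \<Rightarrow> ternary_poly \<Rightarrow> ternary_poly" where
  "lsubst A = psubst (linear_form A)"

definition frame_mult :: "frame \<Rightarrow> frame \<Rightarrow> frame" where
  "frame_mult A B i j = (\<Sum>k\<in>UNIV. A i k * B k j)"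

definition frame_one :: frame where
  "frame_one i j = (if i = j then 1 else 0)"

lemma lsubst_lsubst: "lsubst B (lsubst A F) = lsubst (frame_mult A B) F"
proof -
  have "psubst (linear_form B) (linear_form A i) = linear_form (frame_mult A B) i" for i
  proof -
    have "psubst (linear_form B) (linear_form A i) =
      (\<Sum>k\<in>UNIV. pscale (A i k) (\<Sum>j\<in>UNIV. pscale (B k j) (pvar j)))"
      by (simp add: linear_form_def psubst_sum psubst_pscale)
    also have "\<dots> = (\<Sum>k\<in>UNIV. \<Sum>j\<in>UNIV. pscale (A i k * B k j) (pvar j))"
      by (simp add: tpoly.scale_sum_right)
    also have "\<dots> = (\<Sum>j\<in>UNIV. \<Sum>k\<in>UNIV. pscale (A i k * B k j) (pvar j))"
      by (rule sum.swap)
    finally show ?thesis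
      by (simp add: linear_form_def frame_mult_def tpoly.scale_sum_left)
  qed
  then show ?thesis
    by (simp add: lsubst_def psubst_psubst)
qed

lemma lsubst_frame_one [simp]: "lsubst frame_one F = F"
proof -
  have "linear_form frame_one i = (\<Sum>j\<in>UNIV. if j = i then pvar i else 0)" for i
    unfolding linear_form_def frame_one_def by (rule sum.cong) auto
  then have "linear_form frame_one = pvar"
    by (intro ext) simp
  then show ?thesis
    by (simp add: lsubst_def psubst_pvar_id)
qed

lemma lsubst_add: "lsubst A (F + G) = lsubst A F + lsubst A G"
  and lsubst_pscale: "lsubst A (pscale c F) = pscale c (lsubst A F)"
  by (simp_all add: lsubst_def psubst_add psubst_pscale)

lemma keys_pscale: "Poly_Mapping.keys (pscale c F) \<subseteq> Poly_Mapping.keys F"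
  by (auto simp: in_keys_iff)

text \<open>
  The degree in the local coordinates at the \<open>k\<close>-th coordinate point, in the chart where the \<open>k\<close>-th
  variable is \<open>1\<close>.
\<close>

definition local_deg :: "3 \<Rightarrow> (3 \<Rightarrow>\<^sub>0 nat) \<Rightarrow> nat" where
  "local_deg k t = (\<Sum>i\<in>UNIV - {k}. Poly_Mapping.lookup t i)"

lemma local_deg_add: "local_deg k (s + t) = local_deg k s + local_deg k t"
  by (simp add: local_deg_def lookup_add sum.distrib)

lemma mono_deg_add: "mono_deg (s + t) = mono_deg s + mono_deg t"
  by (simp add: mono_deg_def lookup_add sum.distrib)

lemma mono_deg_local_deg: "mono_deg t = local_deg k t + Poly_Mapping.lookup t k"
  unfolding mono_deg_def local_deg_def by (subst sum.remove[of _ k]) auto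

lemma mono_deg_single [simp]: "mono_deg (Poly_Mapping.single i n) = n"
  by (simp add: mono_deg_def lookup_single when_def)

lemma local_deg_single: "local_deg k (Poly_Mapping.single i n) = (if i = k then 0 else n)"
  using mono_deg_local_deg[of "Poly_Mapping.single i n" k] by (auto simp: lookup_single when_def)

text \<open>The polynomials vanishing to order \<open>m\<close> at the \<open>k\<close>-th coordinate point.\<close>

definition ord_ge :: "3 \<Rightarrow> nat \<Rightarrow> ternary_poly set" where
  "ord_ge k m = {F. \<forall>t\<in>Poly_Mapping.keys F. m \<le> local_deg k t}"

lemma ord_ge_iff: "F \<in> ord_ge k m \<longleftrightarrow> (\<forall>t. local_deg k t < m \<longrightarrow> Poly_Mapping.lookup F t = 0)"
  by (auto simp: ord_ge_def in_keys_iff not_less[symmetric])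

lemma subspace_ord_ge: "tpoly.subspace (ord_ge k m)"
  by (auto simp: tpoly.subspace_def ord_ge_iff lookup_add)

lemma ord_ge_mult:
  assumes "F \<in> ord_ge k a" "G \<in> ord_ge k b"
  shows "F * G \<in> ord_ge k (a + b)"
proof -
  have "a + b \<le> local_deg k u" if u: "u \<in> Poly_Mapping.keys (F * G)" for u
  proof -
    obtain s t where "s \<in> Poly_Mapping.keys F" "t \<in> Poly_Mapping.keys G" "u = s + t"
      using keys_mult[of F G] u by blast
    then show ?thesis
      using assms by (auto simp: ord_ge_def local_deg_add intro: add_mono)
  qed
  then show ?thesis by (simp add: ord_ge_def)
qed

text \<open>
  Needed for two gradings: the total degree, and the local degree at a coordinate point.
\<close>

definition homog :: "((3 \<Rightarrow>\<^sub>0 nat) \<Rightarrow> nat) \<Rightarrow> nat \<Rightarrow> ternary_poly set" where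
  "homog w d = {F. \<forall>t\<in>Poly_Mapping.keys F. w t = d}"

lemma forms_eq_homog: "forms d = homog mono_deg d"
  by (simp add: forms_def homog_def)

lemma subspace_homog: "tpoly.subspace (homog w d)"
proof -
  have "homog w d = {F. \<forall>t. w t \<noteq> d \<longrightarrow> Poly_Mapping.lookup F t = 0}"
    by (auto simp: homog_def in_keys_iff)
  then show ?thesis by (auto simp: tpoly.subspace_def lookup_add)
qed

lemma subspace_forms: "tpoly.subspace (forms d)"
  unfolding forms_eq_homog by (rule subspace_homog)

context
  fixes w :: "(3 \<Rightarrow>\<^sub>0 nat) \<Rightarrow> nat"
  assumes w_add: "w (s + t) = w s + w t"
begin

lemma homog_mult:
  assumes "F \<in> homog w a" "G \<in> homog w b"
  shows "F * G \<in> homog w (a + b)"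
proof -
  have "w u = a + b" if u: "u \<in> Poly_Mapping.keys (F * G)" for u
  proof -
    obtain s t where "s \<in> Poly_Mapping.keys F" "t \<in> Poly_Mapping.keys G" "u = s + t"
      using keys_mult[of F G] u by blast
    then show ?thesis
      using assms by (auto simp: homog_def w_add)
  qed
  then show ?thesis by (simp add: homog_def)
qed

lemma one_in_homog: "1 \<in> homog w 0"
  using w_add[of 0 0] by (simp add: homog_def)

lemma homog_power: "F \<in> homog w a \<Longrightarrow> F ^ n \<in> homog w (n * a)"
  by (induction n) (auto simp: one_in_homog intro: homog_mult)

lemma homog_prod:
  assumes "\<And>i. i \<in> I \<Longrightarrow> F i \<in> homog w (a i)"
  shows "(\<Prod>i\<in>I. F i) \<in> homog w (\<Sum>i\<in>I. a i)"
  using assms by (induction I rule: infinite_finite_induct) (auto simp: one_in_homog intro: homog_mult)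

lemma mon_eval_in_homog:
  assumes "\<And>i. \<sigma> i \<in> homog w (a i)"
  shows "mon_eval \<sigma> t \<in> homog w (\<Sum>i\<in>UNIV. Poly_Mapping.lookup t i * a i)"
  unfolding mon_eval_def by (intro homog_prod homog_power assms)

end

lemma one_in_ord_ge: "1 \<in> ord_ge k 0"
  by (simp add: ord_ge_def)

lemma ord_ge_power: "F \<in> ord_ge k a \<Longrightarrow> F ^ n \<in> ord_ge k (n * a)"
  by (induction n) (auto simp: one_in_ord_ge intro: ord_ge_mult)

lemma ord_ge_prod:
  assumes "\<And>i. i \<in> I \<Longrightarrow> F i \<in> ord_ge k (a i)"
  shows "(\<Prod>i\<in>I. F i) \<in> ord_ge k (\<Sum>i\<in>I. a i)"
  using assms by (induction I rule: infinite_finite_induct) (auto simp: one_in_ord_ge intro: ord_ge_mult)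

lemma single_in_forms [simp]: "Poly_Mapping.single t c \<in> forms (mono_deg t)"
  by (auto simp: forms_def)

lemma linear_form_in_forms: "linear_form A i \<in> forms 1"
proof -
  have "pvar j \<in> forms 1" for j
    using single_in_forms[of "Poly_Mapping.single j 1" 1] by (simp add: pvar_def)
  then show ?thesis
    unfolding linear_form_def
    by (intro tpoly.subspace_sum[OF subspace_forms] tpoly.subspace_scale[OF subspace_forms])
qed

lemma lsubst_eq: "lsubst A F = (\<Sum>t\<in>Poly_Mapping.keys F.
    pscale (Poly_Mapping.lookup F t) (mon_eval (linear_form A) t))"
  by (simp add: lsubst_def psubst_superset[of "Poly_Mapping.keys F"])

lemma lsubst_in_forms:
  assumes "F \<in> forms d"
  shows "lsubst A F \<in> forms d"
proof -
  have "mon_eval (linear_form A) t \<in> forms d" if "t \<in> Poly_Mapping.keys F" for t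
  proof -
    have "mon_eval (linear_form A) t \<in> forms (\<Sum>i\<in>UNIV. Poly_Mapping.lookup t i * 1)"
      using linear_form_in_forms unfolding forms_eq_homog
      by (intro mon_eval_in_homog) (auto simp: mono_deg_add)
    then show ?thesis
      using assms that by (auto simp: mono_deg_def[symmetric] forms_def)
  qed
  then show ?thesis
    unfolding lsubst_eq
    by (intro tpoly.subspace_sum[OF subspace_forms] tpoly.subspace_scale[OF subspace_forms])
qed

text \<open>
  The hypothesis says that the \<open>l\<close>-th column of \<open>B\<close> is a multiple of the \<open>k\<close>-th unit vector, so the
  substitution takes the \<open>l\<close>-th coordinate point to the \<open>k\<close>-th. The variables other than the \<open>k\<close>-th
  become linear forms without the \<open>l\<close>-th variable, and each of them contributes one to the order.
\<close>

lemma lsubst_ord_ge: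
  assumes F: "F \<in> ord_ge k m" and B: "\<And>i. i \<noteq> k \<Longrightarrow> B i l = 0"
  shows "lsubst B F \<in> ord_ge l m"
proof -
  have lf: "linear_form B i \<in> ord_ge l (if i = k then 0 else 1)" for i
  proof (cases "i = k")
    case False
    have "pscale (B i j) (pvar j) \<in> ord_ge l 1" for j
      using B[OF False] by (auto simp: ord_ge_iff pvar_def lookup_single when_def local_deg_single)
    then show ?thesis
      using False unfolding linear_form_def by (auto intro: tpoly.subspace_sum[OF subspace_ord_ge])
  qed (simp add: ord_ge_iff)
  have "mon_eval (linear_form B) t \<in> ord_ge l m" if "t \<in> Poly_Mapping.keys F" for t
  proof -
    have "mon_eval (linear_form B) t \<in>
        ord_ge l (\<Sum>i\<in>UNIV. Poly_Mapping.lookup t i * (if i = k then 0 else 1))"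
      unfolding mon_eval_def by (intro ord_ge_prod ord_ge_power lf)
    moreover have "(\<Sum>i\<in>UNIV. Poly_Mapping.lookup t i * (if i = k then 0 else 1)) = local_deg k t"
      unfolding local_deg_def by (rule sum.mono_neutral_cong_right) auto
    moreover have "m \<le> local_deg k t"
      using F that by (simp add: ord_ge_def)
    ultimately show ?thesis
      by (auto simp: ord_ge_def)
  qed
  then show ?thesis
    unfolding lsubst_eq
    by (intro tpoly.subspace_sum[OF subspace_ord_ge] tpoly.subspace_scale[OF subspace_ord_ge])
qed

lemma lookup_single_mult:
  "Poly_Mapping.lookup (Poly_Mapping.single u c * G) (u + r) = c * Poly_Mapping.lookup G r"
  for G :: ternary_poly
proof -
  have "Poly_Mapping.lookup (Poly_Mapping.single u c * G) (u + r) =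
    (\<Sum>t\<in>insert r (Poly_Mapping.keys G). if t = r then c * Poly_Mapping.lookup G t else 0)"
    by (subst lookup_mult_sum[of "{u}" "insert r (Poly_Mapping.keys G)"]) auto
  also have "\<dots> = c * Poly_Mapping.lookup G r"
    by (subst sum.delta) auto
  finally show ?thesis .
qed

text \<open>
  A linear form with nonzero coefficient at the third variable is a unit in the local ring of the
  third coordinate point. In a term of \<open>G\<close> of minimal local degree, multiplication by this coefficient
  cannot be cancelled by the other two variables, because they raise the local degree.
\<close>

lemma ord_ge_cancel_unit:
  assumes "linear_form A i * G \<in> ord_ge 3 m" and A: "A i 3 \<noteq> 0"
  shows "G \<in> ord_ge 3 m"
proof (rule ccontr)
  assume "G \<notin> ord_ge 3 m"
  then obtain u0 where u0: "u0 \<in> Poly_Mapping.keys G" "local_deg 3 u0 < m"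
    by (auto simp: ord_ge_def not_le)
  obtain u where u: "u \<in> Poly_Mapping.keys G" "\<And>t. t \<in> Poly_Mapping.keys G \<Longrightarrow> local_deg 3 u \<le> local_deg 3 t"
    using ex_has_least_nat[of "\<lambda>t. t \<in> Poly_Mapping.keys G" u0 "local_deg 3"] u0 by blast
  let ?v = "u + Poly_Mapping.single 3 1"
  have coeff: "Poly_Mapping.lookup (pvar j * G) ?v = (if j = 3 then Poly_Mapping.lookup G u else 0)" for j
  proof (cases "j = 3")
    case True
    then show ?thesis
      using lookup_single_mult[of "Poly_Mapping.single 3 1" 1 G u]
      by (simp add: pvar_def add.commute)
  next
    case False
    have "?v \<notin> Poly_Mapping.keys (pvar j * G)"
    proof
      assume "?v \<in> Poly_Mapping.keys (pvar j * G)"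
      then obtain t where t: "t \<in> Poly_Mapping.keys G" "?v = Poly_Mapping.single j 1 + t"
        using keys_mult[of "pvar j" G] by (auto simp: pvar_def)
      have "local_deg 3 ?v = local_deg 3 (Poly_Mapping.single j 1 + t)"
        using t(2) by (rule arg_cong)
      then have "local_deg 3 u = 1 + local_deg 3 t"
        unfolding local_deg_add local_deg_single using False by simp
      then show False using u(2)[OF t(1)] by simp
    qed
    then show ?thesis using False by (simp add: in_keys_iff)
  qed
  have "Poly_Mapping.lookup (linear_form A i * G) ?v =
    (\<Sum>j\<in>UNIV. A i j * Poly_Mapping.lookup (pvar j * G) ?v)"
  proof -
    have "linear_form A i * G = (\<Sum>j\<in>UNIV. pscale (A i j) (pvar j * G))"
      by (simp add: linear_form_def sum_distrib_right pscale_conv_mult mult.assoc)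
    then show ?thesis by (simp add: lookup_sum)
  qed
  also have "\<dots> = (\<Sum>j\<in>(UNIV :: 3 set). if j = 3 then A i 3 * Poly_Mapping.lookup G u else 0)"
    unfolding coeff by (rule sum.cong) auto
  also have "\<dots> = A i 3 * Poly_Mapping.lookup G u"
    by simp
  also have "\<dots> \<noteq> 0"
    using A u(1) by (simp add: in_keys_iff)
  finally have "?v \<in> Poly_Mapping.keys (linear_form A i * G)"
    by (simp add: in_keys_iff)
  then have "m \<le> local_deg 3 ?v"
    using assms(1) by (simp add: ord_ge_def)
  also have "\<dots> = local_deg 3 u"
    by (simp add: local_deg_add local_deg_single)
  also have "\<dots> \<le> local_deg 3 u0"
    using u(2) u0 by blast
  finally show False using u0 by simp
qed

lemma ord_ge_cancel_unit_power:
  assumes "linear_form A i ^ n * G \<in> ord_ge 3 m" and A: "A i 3 \<noteq> 0"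
  shows "G \<in> ord_ge 3 m"
  using assms(1)
proof (induction n)
  case (Suc n)
  then show ?case
    using ord_ge_cancel_unit[of A i "linear_form A i ^ n * G"] A by (simp add: mult.assoc)
qed simp

definition local_part :: "nat \<Rightarrow> ternary_poly \<Rightarrow> ternary_poly" where
  "local_part e G = (\<Sum>t\<in>{t \<in> Poly_Mapping.keys G. local_deg 3 t = e}.
     Poly_Mapping.single t (Poly_Mapping.lookup G t))"

lemma lookup_local_part [simp]:
  "Poly_Mapping.lookup (local_part e G) t = (if local_deg 3 t = e then Poly_Mapping.lookup G t else 0)"
  by (auto simp: local_part_def lookup_sum lookup_single when_def in_keys_iff)

lemma local_part_add: "local_part e (F + G) = local_part e F + local_part e G"
  and local_part_pscale: "local_part e (pscale c F) = pscale c (local_part e F)"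
  by (auto intro!: poly_mapping_eqI simp: lookup_add)

lemma local_part_in_forms: "G \<in> forms d \<Longrightarrow> local_part e G \<in> forms d"
  by (auto simp: forms_def in_keys_iff split: if_splits)

text \<open>The homothety with ratio \<open>c\<close> centred at the third coordinate point.\<close>

definition frame_dilation :: "complex \<Rightarrow> frame" where
  "frame_dilation c i j = (if i \<noteq> j then 0 else if i = 3 then 1 else c)"

lemma lookup_lsubst_frame_dilation:
  "Poly_Mapping.lookup (lsubst (frame_dilation c) G) u = c ^ local_deg 3 u * Poly_Mapping.lookup G u"
proof -
  have lf: "linear_form (frame_dilation c) i = pconst (if i = 3 then 1 else c) * pvar i" for i
  proof -
    have "linear_form (frame_dilation c) i = (\<Sum>j\<in>UNIV. if j = i then pscale (if i = 3 then 1 else c) (pvar i) else 0)"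
      unfolding linear_form_def by (rule sum.cong) (auto simp: frame_dilation_def)
    then show ?thesis by (simp add: pscale_conv_mult)
  qed
  have pow: "pconst a ^ n = pconst (a ^ n)" for a n
    by (induction n) (auto simp: pconst_def mult_single)
  have prodc: "(\<Prod>i\<in>I. pconst (g i)) = pconst (\<Prod>i\<in>I. g i)" for g and I :: "3 set"
    by (induction I rule: infinite_finite_induct) (auto simp: pconst_def mult_single)
  have "mon_eval (linear_form (frame_dilation c)) t = pscale (c ^ local_deg 3 t) (Poly_Mapping.single t 1)" for t
  proof -
    have "mon_eval (linear_form (frame_dilation c)) t =
      pconst (\<Prod>i\<in>UNIV. (if i = 3 then 1 else c) ^ Poly_Mapping.lookup t i) * mon_eval pvar t"
      unfolding mon_eval_def lf by (simp add: power_mult_distrib prod.distrib pow prodc)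
    also have "(\<Prod>i\<in>UNIV. (if i = 3 then 1 else c) ^ Poly_Mapping.lookup t i) =
      (\<Prod>i\<in>UNIV - {3}. c ^ Poly_Mapping.lookup t i)"
      by (rule prod.mono_neutral_cong_right) auto
    also have "\<dots> = c ^ local_deg 3 t"
      by (simp add: local_deg_def power_sum)
    finally show ?thesis
      by (simp add: mon_eval_pvar pscale_conv_mult)
  qed
  then show ?thesis
    unfolding lsubst_eq by (simp add: lookup_sum lookup_single when_def in_keys_iff if_distrib cong: if_cong)
qed

lemma lsubst_frame_dilation:
  assumes "G \<in> forms d"
  shows "lsubst (frame_dilation c) G = (\<Sum>e\<le>d. pscale (c ^ e) (local_part e G))"
proof (rule poly_mapping_eqI)
  fix u
  have "Poly_Mapping.lookup (\<Sum>e\<le>d. pscale (c ^ e) (local_part e G)) u =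
    (\<Sum>e\<le>d. if e = local_deg 3 u then c ^ e * Poly_Mapping.lookup G u else 0)"
    unfolding lookup_sum by (rule sum.cong) auto
  also have "\<dots> = c ^ local_deg 3 u * Poly_Mapping.lookup G u"
    using assms mono_deg_local_deg[of u 3] by (auto simp: forms_def in_keys_iff sum.delta)
  finally show "Poly_Mapping.lookup (lsubst (frame_dilation c) G) u =
    Poly_Mapping.lookup (\<Sum>e\<le>d. pscale (c ^ e) (local_part e G)) u"
    by (simp add: lookup_lsubst_frame_dilation)
qed

lemma pvar_power: "pvar i ^ n = Poly_Mapping.single (Poly_Mapping.single i n) 1"
  by (metis mon_eval_pvar mon_eval_single)

text \<open>
  Homogeneous version of the fact that an affine polynomial of degree at most \<open>e\<close> is the
  dehomogenization of a form of degree \<open>e\<close>.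
\<close>

lemma dehomogenize:
  assumes H: "H \<in> forms d" and e: "e \<le> d" and deg: "\<And>t. t \<in> Poly_Mapping.keys H \<Longrightarrow> local_deg 3 t \<le> e"
  obtains K where "K \<in> forms e" "H = pvar 3 ^ (d - e) * K"
proof -
  let ?u = "Poly_Mapping.single 3 (d - e) :: 3 \<Rightarrow>\<^sub>0 nat"
  define K where "K = (\<Sum>t\<in>Poly_Mapping.keys H. Poly_Mapping.single (t - ?u) (Poly_Mapping.lookup H t))"
  have t: "?u + (t - ?u) = t" "mono_deg (t - ?u) = e" if "t \<in> Poly_Mapping.keys H" for t
  proof -
    have md: "mono_deg t = d"
      using H that by (simp add: forms_def)
    then have "d - e \<le> Poly_Mapping.lookup t 3"
      using deg[OF that] e mono_deg_local_deg[of t 3] by simp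
    then show eq: "?u + (t - ?u) = t"
      by (intro poly_mapping_eqI) (auto simp: lookup_add lookup_minus lookup_single when_def)
    then have "mono_deg ?u + mono_deg (t - ?u) = d"
      using md by (metis mono_deg_add)
    then show "mono_deg (t - ?u) = e"
      using e by simp
  qed
  have "K \<in> forms e"
    unfolding K_def using t(2) single_in_forms by (intro tpoly.subspace_sum[OF subspace_forms]) metis
  moreover have "pvar 3 ^ (d - e) * K = H"
  proof -
    have "pvar 3 ^ (d - e) * K = (\<Sum>t\<in>Poly_Mapping.keys H. Poly_Mapping.single (?u + (t - ?u)) (Poly_Mapping.lookup H t))"
      by (simp add: pvar_power K_def sum_distrib_left mult_single)
    also have "\<dots> = (\<Sum>t\<in>Poly_Mapping.keys H. Poly_Mapping.single t (Poly_Mapping.lookup H t))"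
      by (rule sum.cong) (simp_all add: t)
    finally show ?thesis using sum_monomials[of H] by simp
  qed
  ultimately show ?thesis using that by blast
qed

text \<open>
  With a finite set of monomials that serves for all parameters, a coefficient of a product becomes a
  sum over an index set not depending on the parameter.
\<close>

definition poly_family :: "((nat \<Rightarrow> frame) \<Rightarrow> ternary_poly) \<Rightarrow> bool" where
  "poly_family Q \<longleftrightarrow> (\<exists>S. finite S \<and> (\<forall>x. Poly_Mapping.keys (Q x) \<subseteq> S)) \<and>
     (\<forall>t. poly_on_lines (\<lambda>x. Poly_Mapping.lookup (Q x) t))"

lemma poly_family_const [simp]: "poly_family (\<lambda>x. F)"
  unfolding poly_family_def by (auto intro: exI[of _ "Poly_Mapping.keys F"])

lemma poly_family_add:
  assumes "poly_family P" "poly_family Q"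
  shows "poly_family (\<lambda>x. P x + Q x)"
proof -
  obtain S where S: "finite S" "\<forall>x. Poly_Mapping.keys (P x) \<subseteq> S"
    using assms(1) unfolding poly_family_def by blast
  obtain T where T: "finite T" "\<forall>x. Poly_Mapping.keys (Q x) \<subseteq> T"
    using assms(2) unfolding poly_family_def by blast
  have "Poly_Mapping.keys (P x + Q x) \<subseteq> S \<union> T" for x
    using keys_add[of "P x" "Q x"] S(2)[rule_format, of x] T(2)[rule_format, of x] by auto
  moreover have "poly_on_lines (\<lambda>x. Poly_Mapping.lookup (P x + Q x) t)" for t
    using assms unfolding poly_family_def lookup_add by (intro poly_on_lines_add) auto
  ultimately show ?thesis
    using S(1) T(1) unfolding poly_family_def by (metis finite_UnI)
qed

lemma poly_family_mult:
  assumes "poly_family P" "poly_family Q"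
  shows "poly_family (\<lambda>x. P x * Q x)"
proof -
  obtain S where S: "finite S" "\<forall>x. Poly_Mapping.keys (P x) \<subseteq> S"
    using assms(1) unfolding poly_family_def by blast
  obtain T where T: "finite T" "\<forall>x. Poly_Mapping.keys (Q x) \<subseteq> T"
    using assms(2) unfolding poly_family_def by blast
  note ST = S(1) S(2)[rule_format] T(1) T(2)[rule_format]
  have "finite ((\<lambda>(s, t). s + t) ` (S \<times> T))"
    using ST by simp
  moreover have "Poly_Mapping.keys (P x * Q x) \<subseteq> (\<lambda>(s, t). s + t) ` (S \<times> T)" for x
    using keys_mult[of "P x" "Q x"] ST(2)[of x] ST(4)[of x] by fastforce
  moreover have "poly_on_lines (\<lambda>x. Poly_Mapping.lookup (P x * Q x) u)" for u
  proof -
    have "poly_on_lines (\<lambda>x. if s + t = u then Poly_Mapping.lookup (P x) s * Poly_Mapping.lookup (Q x) t else 0)" for s t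
      using assms by (cases "s + t = u") (auto simp: poly_family_def intro: poly_on_lines_mult)
    then show ?thesis
      using ST by (simp add: lookup_mult_sum[of S T] poly_on_lines_sum)
  qed
  ultimately show ?thesis unfolding poly_family_def by blast
qed

lemma poly_family_pscale:
  assumes "poly_on_lines f" "poly_family Q"
  shows "poly_family (\<lambda>x. pscale (f x) (Q x))"
proof -
  obtain S where S: "finite S" "\<forall>x. Poly_Mapping.keys (Q x) \<subseteq> S"
    using assms(2) unfolding poly_family_def by blast
  have "Poly_Mapping.keys (pscale (f x) (Q x)) \<subseteq> S" for x
    using keys_pscale[of "f x" "Q x"] S(2)[rule_format, of x] by auto
  moreover have "poly_on_lines (\<lambda>x. Poly_Mapping.lookup (pscale (f x) (Q x)) t)" for t
    using assms unfolding poly_family_def lookup_pscale by (intro poly_on_lines_mult) auto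
  ultimately show ?thesis
    using S(1) unfolding poly_family_def by metis
qed

lemma poly_family_sum:
  assumes "\<And>i. i \<in> I \<Longrightarrow> poly_family (Q i)"
  shows "poly_family (\<lambda>x. \<Sum>i\<in>I. Q i x)"
  using assms by (induction I rule: infinite_finite_induct) (auto intro: poly_family_add)

lemma poly_family_power: "poly_family Q \<Longrightarrow> poly_family (\<lambda>x. Q x ^ n)"
  by (induction n) (auto intro: poly_family_mult)

lemma poly_family_prod:
  assumes "\<And>i. i \<in> I \<Longrightarrow> poly_family (Q i)"
  shows "poly_family (\<lambda>x. \<Prod>i\<in>I. Q i x)"
  using assms by (induction I rule: infinite_finite_induct) (auto intro: poly_family_mult)

lemma poly_on_lines_lookup_lsubst: "poly_on_lines (\<lambda>x. Poly_Mapping.lookup (lsubst (x i) F) t)"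
proof -
  have "poly_family (\<lambda>x. lsubst (x i) F)"
    unfolding lsubst_eq mon_eval_def linear_form_def
    by (intro poly_family_sum poly_family_pscale poly_family_prod poly_family_power
        poly_on_lines_const poly_on_lines_coordinate poly_family_const)
  then show ?thesis by (simp add: poly_family_def)
qed

section \<open>Counting monomials\<close>

definition monomial :: "nat \<Rightarrow> nat \<Rightarrow> nat \<Rightarrow> 3 \<Rightarrow>\<^sub>0 nat" where
  "monomial a b c = Poly_Mapping.single 1 a + Poly_Mapping.single 2 b + Poly_Mapping.single 3 c"

lemma lookup_monomial [simp]:
  "Poly_Mapping.lookup (monomial a b c) 1 = a"
  "Poly_Mapping.lookup (monomial a b c) 2 = b"
  "Poly_Mapping.lookup (monomial a b c) 3 = c"
  by (simp_all add: monomial_def lookup_add lookup_single)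

lemma monomial_lookup:
  "monomial (Poly_Mapping.lookup t 1) (Poly_Mapping.lookup t 2) (Poly_Mapping.lookup t 3) = t"
proof (rule poly_mapping_eqI)
  fix k :: 3
  show "Poly_Mapping.lookup (monomial (Poly_Mapping.lookup t 1) (Poly_Mapping.lookup t 2)
    (Poly_Mapping.lookup t 3)) k = Poly_Mapping.lookup t k"
    using exhaust_3[of k] by auto
qed

lemma mono_deg_eq: "mono_deg t = Poly_Mapping.lookup t 1 + Poly_Mapping.lookup t 2 + Poly_Mapping.lookup t 3"
  by (simp add: mono_deg_def sum_3)

lemma local_deg_3_eq: "local_deg 3 t = Poly_Mapping.lookup t 1 + Poly_Mapping.lookup t 2"
  using mono_deg_local_deg[of t 3] mono_deg_eq[of t] by simp

lemma monomials_of_degree: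
  "{t. mono_deg t = d \<and> local_deg 3 t < n} = (\<lambda>(a, b). monomial a b (d - a - b)) ` {(a, b). a + b \<le> d \<and> a + b < n}"
  (is "?L = ?f ` ?R")
proof
  show "?L \<subseteq> ?f ` ?R"
  proof
    fix t assume t: "t \<in> ?L"
    then have "t = ?f (Poly_Mapping.lookup t 1, Poly_Mapping.lookup t 2)"
      using monomial_lookup[of t] by (auto simp: mono_deg_eq)
    moreover have "(Poly_Mapping.lookup t 1, Poly_Mapping.lookup t 2) \<in> ?R"
      using t by (auto simp: mono_deg_eq local_deg_3_eq)
    ultimately show "t \<in> ?f ` ?R" by blast
  qed
  show "?f ` ?R \<subseteq> ?L"
    by (auto simp: mono_deg_eq local_deg_3_eq)
qed

lemma card_pairs_below: "finite {(a, b). a + b < n}" "card {(a, b). a + b < n} = n * (n + 1) div 2"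
proof -
  have eq: "{(a, b). a + b < n} = Sigma {..<n} (\<lambda>a. {..<n - a})" by auto
  show "finite {(a, b). a + b < n}" unfolding eq by simp
  have "card {(a, b). a + b < n} = (\<Sum>a<n. n - a)"
    unfolding eq by simp
  also have "\<dots> = (\<Sum>a<n. a + 1)"
    by (rule sum.reindex_bij_witness[where i = "\<lambda>a. n - 1 - a" and j = "\<lambda>a. n - 1 - a"]) auto
  also have "\<dots> = n * (n + 1) div 2"
    by (induction n) auto
  finally show "card {(a, b). a + b < n} = n * (n + 1) div 2" .
qed

lemma finite_monomials: "finite {t. mono_deg t = d}"
  and card_monomials: "card {t. mono_deg t = d} = (d + 1) * (d + 2) div 2"
proof -
  have "local_deg 3 t < d + 1" if "mono_deg t = d" for t
    using that mono_deg_local_deg[of t 3] by simp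
  then have eq: "{t. mono_deg t = d} = (\<lambda>(a, b). monomial a b (d - a - b)) ` {(a, b). a + b < d + 1}"
    using monomials_of_degree[of d "d + 1"] by (auto simp: less_Suc_eq_le)
  show "finite {t. mono_deg t = d}"
    unfolding eq using card_pairs_below(1) by blast
  have "inj_on (\<lambda>(a, b). monomial a b (d - a - b)) {(a, b). a + b < d + 1}"
    by (auto simp: inj_on_def) (metis lookup_monomial)+
  then show "card {t. mono_deg t = d} = (d + 1) * (d + 2) div 2"
    unfolding eq using card_pairs_below(2)[of "d + 1"] by (simp add: card_image)
qed

lemma card_monomials_of_low_weight:
  "finite {t. mono_deg t = d \<and> local_deg 3 t < n}"
  "card {t. mono_deg t = d \<and> local_deg 3 t < n} \<le> n * (n + 1) div 2"
proof -
  show "finite {t. mono_deg t = d \<and> local_deg 3 t < n}"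
    by (rule finite_subset[OF _ finite_monomials[of d]]) auto
  have "{(a, b). a + b \<le> d \<and> a + b < n} \<subseteq> {(a, b). a + b < n}" by auto
  then have "card {t. mono_deg t = d \<and> local_deg 3 t < n} \<le> card {(a :: nat, b). a + b < n}"
    unfolding monomials_of_degree
    using card_pairs_below(1)[of n] by (meson card_image_le card_mono finite_subset le_trans)
  then show "card {t. mono_deg t = d \<and> local_deg 3 t < n} \<le> n * (n + 1) div 2"
    using card_pairs_below(2) by simp
qed

definition monomial_basis :: "nat \<Rightarrow> ternary_poly set" where
  "monomial_basis d = (\<lambda>t. Poly_Mapping.single t 1) ` {t. mono_deg t = d}"

lemma finite_monomial_basis: "finite (monomial_basis d)"
  unfolding monomial_basis_def using finite_monomials by blast

lemma forms_eq_span: "forms d = tpoly.span (monomial_basis d)"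
proof
  show "tpoly.span (monomial_basis d) \<subseteq> forms d"
    by (rule tpoly.span_minimal[OF _ subspace_forms]) (auto simp: monomial_basis_def)
  show "forms d \<subseteq> tpoly.span (monomial_basis d)"
  proof
    fix F assume F: "F \<in> forms d"
    have "F = (\<Sum>t\<in>Poly_Mapping.keys F. pscale (Poly_Mapping.lookup F t) (Poly_Mapping.single t 1))"
      by (rule poly_mapping_eqI) (simp add: lookup_sum lookup_single when_def in_keys_iff if_distrib cong: if_cong)
    also have "\<dots> \<in> tpoly.span (monomial_basis d)"
      using F by (intro tpoly.span_sum tpoly.span_scale tpoly.span_base) (auto simp: forms_def monomial_basis_def)
    finally show "F \<in> tpoly.span (monomial_basis d)" .
  qed
qed

lemma inj_on_single: "inj_on (\<lambda>t. Poly_Mapping.single t 1 :: ternary_poly) S"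
  by (rule inj_onI) (metis keys_single one_neq_zero singleton_inject)

lemma dim_forms: "tpoly.dim (forms d) = (d + 1) * (d + 2) div 2"
proof -
  have ind: "tpoly.independent (monomial_basis d)"
  proof (rule tpoly.independent_if_scalars_zero[OF finite_monomial_basis])
    fix f G assume f: "(\<Sum>G\<in>monomial_basis d. pscale (f G) G) = 0" and G: "G \<in> monomial_basis d"
    obtain u where u: "G = Poly_Mapping.single u 1" "mono_deg u = d"
      using G by (auto simp: monomial_basis_def)
    have "0 = Poly_Mapping.lookup (\<Sum>G\<in>monomial_basis d. pscale (f G) G) u"
      using f by simp
    also have "\<dots> = (\<Sum>t\<in>{t. mono_deg t = d}. f (Poly_Mapping.single t 1) * (1 when t = u))"
      unfolding monomial_basis_def sum.reindex[OF inj_on_single] o_def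
      by (simp add: lookup_sum lookup_single)
    also have "\<dots> = f G"
      using finite_monomials[of d] u by (simp add: when_def if_distrib sum.delta cong: if_cong)
    finally show "f G = 0" by simp
  qed
  have "card (monomial_basis d) = card {t. mono_deg t = d}"
    unfolding monomial_basis_def by (rule card_image[OF inj_on_single])
  then show ?thesis
    using tpoly.dim_span_eq_card_independent[OF ind] card_monomials by (simp add: forms_eq_span)
qed

section \<open>Points without inflection\<close>

interpretation cpoly: vector_space "smult :: complex \<Rightarrow> complex poly \<Rightarrow> complex poly"
  by unfold_locales (auto simp: smult_add_right smult_add_left)

interpretation tpoly_cpoly: vector_space_pair pscale "smult :: complex \<Rightarrow> complex poly \<Rightarrow> complex poly" ..

interpretation tpoly_tpoly: vector_space_pair pscale pscale ..

lemma dvd_pderiv: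
  fixes y :: "complex poly"
  assumes "[:-a, 1:] ^ Suc n dvd y"
  shows "[:-a, 1:] ^ n dvd pderiv y"
proof -
  obtain q where "y = [:-a, 1:] ^ Suc n * q" using assms by (rule dvdE)
  then have "pderiv y = [:-a, 1:] ^ n * (smult (of_nat (Suc n)) q + [:-a, 1:] * pderiv q)"
    by (simp add: pderiv_mult pderiv_power_Suc pderiv_pCons algebra_simps del: power_Suc)
       (simp add: algebra_simps)
  then show ?thesis by (metis dvd_triv_left)
qed

text \<open>
  A space of polynomials of dimension at most \<open>card S\<close> has, at almost every point \<open>a\<close>, no nonzero
  element vanishing to order \<open>card S\<close>; this holds since the characteristic is zero. The usual
  argument through the Wronskian is replaced by an induction: with \<open>y\<^sub>0\<close> in the space, the operator
  \<open>D y = y' y\<^sub>0 - y y\<^sub>0'\<close> kills \<open>y\<^sub>0\<close>, so its image is spanned by one polynomial less, and it lowers the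
  order at \<open>a\<close> by at most one.
\<close>

lemma finite_inflection_points:
  fixes S :: "complex poly set"
  assumes "finite S"
  shows "finite {a. \<exists>y\<in>cpoly.span S. y \<noteq> 0 \<and> [:-a, 1:] ^ card S dvd y}"
  using assms
proof (induction "card S" arbitrary: S rule: less_induct)
  case less
  let ?bad = "\<lambda>S. {a. \<exists>y\<in>cpoly.span S. y \<noteq> 0 \<and> [:-a, 1:] ^ card S dvd y}"
  show ?case
  proof (cases "S = {}")
    case True
    then show ?thesis by simp
  next
    case False
    then obtain y\<^sub>0 T where S: "S = insert y\<^sub>0 T" "y\<^sub>0 \<notin> T" and finT: "finite T"
      using less.prems by (metis all_not_in_conv finite_Diff insert_Diff Diff_iff insertI1)
    have cS: "card S = Suc (card T)"
      using S finT by simp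
    show ?thesis
    proof (cases "y\<^sub>0 = 0")
      case True
      have "?bad S \<subseteq> ?bad T"
        unfolding cS unfolding S(1) True cpoly.span_insert_0
        using power_le_dvd[of _ "Suc (card T)" _ "card T"] le_SucI[OF order_refl] by blast
      moreover have "finite (?bad T)"
        using less.hyps[of T] cS finT by simp
      ultimately show ?thesis by (rule finite_subset)
    next
      case False
      define D where "D y = pderiv y * y\<^sub>0 - y * pderiv y\<^sub>0" for y
      have linD: "Vector_Spaces.linear smult smult D"
        by (auto simp: Vector_Spaces.linear_iff D_def pderiv_add pderiv_smult algebra_simps
            smult_diff_right cpoly.vector_space_axioms)
      interpret D: Vector_Spaces.linear smult smult D by (rule linD)
      have card: "card (D ` T) \<le> card T"
        using finT by (rule card_image_le)
      then have "finite (?bad (D ` T))"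
        using less.hyps[of "D ` T"] cS finT by simp
      moreover have "finite {a. poly y\<^sub>0 a = 0}"
        using False by (rule poly_roots_finite)
      moreover have "?bad S \<subseteq> ?bad (D ` T) \<union> {a. poly y\<^sub>0 a = 0}"
      proof
        fix a assume "a \<in> ?bad S"
        then obtain y where y: "y \<in> cpoly.span S" "y \<noteq> 0" "[:-a, 1:] ^ Suc (card T) dvd y"
          unfolding cS by blast
        show "a \<in> ?bad (D ` T) \<union> {a. poly y\<^sub>0 a = 0}"
        proof (cases "poly y\<^sub>0 a = 0")
          case y0a: False
          have "order a y \<noteq> 0"
            using y(2,3) by (simp add: order_divides del: power_Suc)
          then have order: "order a y = Suc (order a (pderiv y))" and py: "pderiv y \<noteq> 0"
          proof -
            show "pderiv y \<noteq> 0"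
            proof
              assume "pderiv y = 0"
              then have "degree y = 0" by (simp add: pderiv_eq_0_iff)
              then obtain k where "y = [:k:]" by (rule degree_eq_zeroE)
              then show False
                using y(2) \<open>order a y \<noteq> 0\<close> by (simp add: order_0I)
            qed
            then show "order a y = Suc (order a (pderiv y))"
              using \<open>order a y \<noteq> 0\<close> y(2) by (intro order_pderiv) (auto simp: order_root)
          qed
          (* at a zero a of y that is not a zero of y0, the order of y' y0 is one less than that of y *)
          have "D y \<noteq> 0"
          proof
            assume "D y = 0"
            then have eq: "pderiv y * y\<^sub>0 = y * pderiv y\<^sub>0"
              by (simp add: D_def)
            then have nz: "y * pderiv y\<^sub>0 \<noteq> 0"
              using py False by (metis mult_eq_0_iff)
            have "order a (pderiv y * y\<^sub>0) = order a (pderiv y)"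
              using order_mult[of "pderiv y" y\<^sub>0 a] py False y0a by (simp add: order_0I)
            moreover have "order a (y * pderiv y\<^sub>0) \<ge> order a y"
              using order_mult[OF nz, of a] by simp
            ultimately show False using order eq by simp
          qed
          moreover have "D y \<in> cpoly.span (D ` T)"
          proof -
            obtain k where "y - smult k y\<^sub>0 \<in> cpoly.span T"
              using y(1) unfolding S(1) cpoly.span_insert by blast
            then have "D (y - smult k y\<^sub>0) \<in> D ` cpoly.span T" by blast
            also have "D ` cpoly.span T = cpoly.span (D ` T)"
              by (rule D.span_image[symmetric])
            also have "D (y - smult k y\<^sub>0) = D y"
              by (simp add: D_def pderiv_diff pderiv_smult algebra_simps)
            finally show ?thesis .
          qed
          moreover have "[:-a, 1:] ^ card (D ` T) dvd D y"
          proof -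
            have "[:-a, 1:] ^ card T dvd y"
              using y(3) by (rule dvd_trans[rotated]) (simp add: le_imp_power_dvd del: power_Suc)
            then have "[:-a, 1:] ^ card T dvd D y"
              unfolding D_def using dvd_pderiv[OF y(3)] by (intro dvd_diff dvd_mult2)
            then show ?thesis
              using card by (meson dvd_trans le_imp_power_dvd)
          qed
          ultimately show ?thesis by blast
        qed simp
      qed
      ultimately show ?thesis
        by (meson finite_UnI finite_subset)
    qed
  qed
qed

section \<open>Leading forms at a point\<close>

text \<open>
  The substitution \<open>(1, x, 1)\<close> for the three variables. Binary forms of degree \<open>e\<close> in the first two
  variables are encoded by univariate polynomials of degree at most \<open>e\<close> in this way.
\<close>

definition dehom :: "ternary_poly \<Rightarrow> complex poly" where
  "dehom F = (\<Sum>t\<in>Poly_Mapping.keys F. monom (Poly_Mapping.lookup F t) (Poly_Mapping.lookup t 2))"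

lemma dehom_superset:
  assumes "finite S" "Poly_Mapping.keys F \<subseteq> S"
  shows "dehom F = (\<Sum>t\<in>S. monom (Poly_Mapping.lookup F t) (Poly_Mapping.lookup t 2))"
  unfolding dehom_def using assms by (intro sum.mono_neutral_left) (auto simp: in_keys_iff)

lemma dehom_add: "dehom (F + G) = dehom F + dehom G"
proof -
  let ?S = "Poly_Mapping.keys F \<union> Poly_Mapping.keys G"
  have "Poly_Mapping.keys (F + G) \<subseteq> ?S" by (rule keys_add)
  then show ?thesis
    by (simp add: dehom_superset[of ?S] lookup_add add_monom[symmetric] sum.distrib)
qed

lemma dehom_pscale: "dehom (pscale c F) = smult c (dehom F)"
  using keys_pscale[of c F]
  by (simp add: dehom_superset[of "Poly_Mapping.keys F"] cpoly.scale_sum_right smult_monom)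

lemma dehom_single: "dehom (Poly_Mapping.single t c) = monom c (Poly_Mapping.lookup t 2)"
  by (subst dehom_superset[of "{t}"]) auto

lemma dehom_0 [simp]: "dehom 0 = 0"
  by (simp add: dehom_def)

lemma dehom_sum: "dehom (\<Sum>i\<in>I. F i) = (\<Sum>i\<in>I. dehom (F i))"
  by (induction I rule: infinite_finite_induct) (auto simp: dehom_add)

lemma dehom_mult: "dehom (F * G) = dehom F * dehom G"
proof -
  let ?F = "\<Sum>s\<in>Poly_Mapping.keys F. Poly_Mapping.single s (Poly_Mapping.lookup F s)"
  let ?G = "\<Sum>t\<in>Poly_Mapping.keys G. Poly_Mapping.single t (Poly_Mapping.lookup G t)"
  have "dehom (?F * ?G) = dehom ?F * dehom ?G"
    by (simp add: sum_product mult_single dehom_sum dehom_single lookup_add mult_monom)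
  then show ?thesis
    using sum_monomials[of F] sum_monomials[of G] by simp
qed

lemma dehom_1 [simp]: "dehom 1 = 1"
  using dehom_single[of 0 1] by simp

lemma dehom_power: "dehom (F ^ n) = dehom F ^ n"
  by (induction n) (auto simp: dehom_mult)

text \<open>
  The homogeneous term of degree \<open>e\<close> in the local expansion at the third coordinate point, which is
  the equation of the tangent cone if all lower terms vanish.
\<close>

definition leading_form :: "nat \<Rightarrow> ternary_poly \<Rightarrow> complex poly" where
  "leading_form e G = dehom (local_part e G)"

lemma leading_form_add: "leading_form e (F + G) = leading_form e F + leading_form e G"
  and leading_form_pscale: "leading_form e (pscale c F) = smult c (leading_form e F)"
  by (simp_all add: leading_form_def local_part_add local_part_pscale dehom_add dehom_pscale)

lemma coeff_leading_form:
  assumes "G \<in> forms d"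
  shows "coeff (leading_form e G) i = (if i \<le> e then Poly_Mapping.lookup G (monomial (e - i) i (d - e)) else 0)"
proof -
  let ?u = "monomial (e - i) i (d - e)"
  have "coeff (leading_form e G) i = (\<Sum>t\<in>insert ?u (Poly_Mapping.keys G).
      if Poly_Mapping.lookup t 2 = i then Poly_Mapping.lookup (local_part e G) t else 0)"
  proof -
    have "Poly_Mapping.keys (local_part e G) \<subseteq> insert ?u (Poly_Mapping.keys G)"
      by (auto simp: in_keys_iff split: if_splits)
    then have "leading_form e G = (\<Sum>t\<in>insert ?u (Poly_Mapping.keys G).
        monom (Poly_Mapping.lookup (local_part e G) t) (Poly_Mapping.lookup t 2))"
      unfolding leading_form_def by (intro dehom_superset) auto
    then show ?thesis by (simp only: coeff_sum coeff_monom)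
  qed
  also have "\<dots> = (\<Sum>t\<in>insert ?u (Poly_Mapping.keys G).
      if t = ?u then (if i \<le> e then Poly_Mapping.lookup G ?u else 0) else 0)"
  proof (rule sum.cong[OF refl])
    fix t assume t: "t \<in> insert ?u (Poly_Mapping.keys G)"
    show "(if Poly_Mapping.lookup t 2 = i then Poly_Mapping.lookup (local_part e G) t else 0) =
      (if t = ?u then (if i \<le> e then Poly_Mapping.lookup G ?u else 0) else 0)"
    proof (cases "t = ?u")
      case True
      then show ?thesis by (auto simp: local_deg_3_eq)
    next
      case False
      have "Poly_Mapping.lookup (local_part e G) t = 0" if "Poly_Mapping.lookup t 2 = i"
      proof (rule ccontr)
        assume "Poly_Mapping.lookup (local_part e G) t \<noteq> 0"
        then have "local_deg 3 t = e" "t \<in> Poly_Mapping.keys G"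
          by (auto simp: in_keys_iff split: if_splits)
        then have "t = ?u"
          using assms that monomial_lookup[of t] by (auto simp: forms_def local_deg_3_eq mono_deg_eq)
        then show False using False by simp
      qed
      then show ?thesis using False by simp
    qed
  qed
  also have "\<dots> = (if i \<le> e then Poly_Mapping.lookup G ?u else 0)"
    by (simp add: sum.delta)
  finally show ?thesis .
qed

lemma degree_leading_form: "degree (leading_form e G) \<le> e"
  unfolding leading_form_def dehom_def
proof (rule degree_sum_le)
  fix t assume "t \<in> Poly_Mapping.keys (local_part e G)"
  then have "Poly_Mapping.lookup t 2 \<le> e"
    by (auto simp: in_keys_iff local_deg_3_eq split: if_splits)
  then show "degree (monom (Poly_Mapping.lookup (local_part e G) t) (Poly_Mapping.lookup t 2)) \<le> e"
    using degree_monom_le le_trans by blast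
qed simp

lemma leading_form_eq_0_iff:
  assumes "G \<in> forms d"
  shows "leading_form e G = 0 \<longleftrightarrow> local_part e G = 0"
proof
  assume "leading_form e G = 0"
  then have c: "coeff (leading_form e G) i = 0" for i by simp
  show "local_part e G = 0"
  proof (rule poly_mapping_eqI)
    fix t
    show "Poly_Mapping.lookup (local_part e G) t = Poly_Mapping.lookup 0 t"
    proof (cases "t \<in> Poly_Mapping.keys G \<and> local_deg 3 t = e")
      case True
      then have "Poly_Mapping.lookup t 2 \<le> e"
        "t = monomial (e - Poly_Mapping.lookup t 2) (Poly_Mapping.lookup t 2) (d - e)"
        using assms monomial_lookup[of t] by (auto simp: forms_def local_deg_3_eq mono_deg_eq)
      then show ?thesis
        using c[of "Poly_Mapping.lookup t 2"] by (simp add: coeff_leading_form[OF assms])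
    qed (auto simp: in_keys_iff)
  qed
qed (simp add: leading_form_def)

lemma ord_ge_Suc_iff: "G \<in> ord_ge 3 (Suc e) \<longleftrightarrow> G \<in> ord_ge 3 e \<and> local_part e G = 0"
  by (auto simp: ord_ge_iff less_Suc_eq poly_mapping_eq_iff fun_eq_iff)

lemma ord_ge_iff_local_part: "G \<in> ord_ge 3 m \<longleftrightarrow> (\<forall>e<m. local_part e G = 0)"
  by (auto simp: ord_ge_iff poly_mapping_eq_iff fun_eq_iff)

section \<open>A general translate of a space of binary forms\<close>

text \<open>
  The substitution of linear forms \<open>u\<close>, \<open>v\<close> in the binary form of degree \<open>e\<close> that \<open>y\<close> encodes.
\<close>

definition binary_subst :: "nat \<Rightarrow> complex poly \<Rightarrow> complex poly \<Rightarrow> complex poly \<Rightarrow> complex poly" where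
  "binary_subst e u v y = (\<Sum>i\<le>e. smult (coeff y i) (u ^ (e - i) * v ^ i))"

lemma binary_subst_add: "binary_subst e u v (y + z) = binary_subst e u v y + binary_subst e u v z"
  and binary_subst_smult: "binary_subst e u v (smult c y) = smult c (binary_subst e u v y)"
  by (simp_all add: binary_subst_def smult_add_left sum.distrib cpoly.scale_sum_right)

lemma binary_subst_sum: "binary_subst e u v (\<Sum>i\<in>I. y i) = (\<Sum>i\<in>I. binary_subst e u v (y i))"
proof -
  have "binary_subst e u v 0 = 0" by (simp add: binary_subst_def)
  then show ?thesis
    by (induction I rule: infinite_finite_induct) (auto simp: binary_subst_add)
qed

lemma binary_subst_monom:
  assumes "i \<le> e"
  shows "binary_subst e u v (monom c i) = smult c (u ^ (e - i) * v ^ i)"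
proof -
  have "binary_subst e u v (monom c i) = (\<Sum>j\<le>e. if j = i then smult c (u ^ (e - i) * v ^ i) else 0)"
    unfolding binary_subst_def by (rule sum.cong) auto
  then show ?thesis using assms by simp
qed

lemma binary_subst_power:
  assumes "k \<le> e"
  shows "binary_subst e u v ([:-b, 1:] ^ k) = u ^ (e - k) * (v - smult b u) ^ k"
proof -
  have expand: "[:-b, 1:] ^ k = (\<Sum>i\<le>k. monom (of_nat (k choose i) * (-b) ^ (k - i)) i)"
  proof (rule poly_eqI)
    fix j
    have "coeff (\<Sum>i\<le>k. monom (of_nat (k choose i) * (-b) ^ (k - i)) i) j =
      (\<Sum>i\<le>k. if i = j then of_nat (k choose i) * (-b) ^ (k - i) else 0)"
      by (simp add: coeff_sum)
    then show "coeff ([:-b, 1:] ^ k) j =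
        coeff (\<Sum>i\<le>k. monom (of_nat (k choose i) * (-b) ^ (k - i)) i) j"
      by (cases "j \<le> k") (simp_all add: coeff_linear_poly_power coeff_eq_0 degree_linear_power)
  qed
  have "u ^ (e - k) * (v - smult b u) ^ k = u ^ (e - k) * (v + smult (-b) u) ^ k"
    by simp
  also have "\<dots> = (\<Sum>i\<le>k. u ^ (e - k) * (of_nat (k choose i) * v ^ i * smult (-b) u ^ (k - i)))"
    unfolding binomial_ring by (simp add: sum_distrib_left)
  also have "\<dots> = (\<Sum>i\<le>k. smult (of_nat (k choose i) * (-b) ^ (k - i)) (u ^ (e - i) * v ^ i))"
  proof (rule sum.cong[OF refl])
    fix i assume "i \<in> {..k}"
    then have "u ^ (e - i) = u ^ (e - k) * u ^ (k - i)"
      using assms by (simp add: power_add[symmetric])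
    then show "u ^ (e - k) * (of_nat (k choose i) * v ^ i * smult (-b) u ^ (k - i)) =
        smult (of_nat (k choose i) * (-b) ^ (k - i)) (u ^ (e - i) * v ^ i)"
      unfolding smult_power[of "-b"] by (simp add: of_nat_poly mult_ac)
  qed
  also have "\<dots> = (\<Sum>i\<le>k. binary_subst e u v (monom (of_nat (k choose i) * (-b) ^ (k - i)) i))"
    using assms by (intro sum.cong) (auto simp: binary_subst_monom)
  also have "\<dots> = binary_subst e u v ([:-b, 1:] ^ k)"
    unfolding expand binary_subst_sum ..
  finally show ?thesis ..
qed

definition taylor_coeff :: "complex \<Rightarrow> nat \<Rightarrow> complex poly \<Rightarrow> complex" where
  "taylor_coeff b k y = coeff (pcompose y [:b, 1:]) k"

lemma taylor_coeff_add: "taylor_coeff b k (y + z) = taylor_coeff b k y + taylor_coeff b k z"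
  and taylor_coeff_smult: "taylor_coeff b k (smult c y) = c * taylor_coeff b k y"
  by (simp_all add: taylor_coeff_def pcompose_add pcompose_smult)

lemma taylor_expansion:
  assumes "degree y \<le> e"
  shows "y = (\<Sum>k\<le>e. smult (taylor_coeff b k y) ([:-b, 1:] ^ k))"
proof -
  let ?z = "pcompose y [:b, 1:]"
  have monom: "pcompose (monom c k) [:-b, 1:] = smult c ([:-b, 1:] ^ k)" for c k
    by (induction k) (auto simp: monom_0 monom_Suc pcompose_pCons)
  have "degree ?z \<le> e"
    using assms by (simp add: degree_pcompose)
  then have "?z = (\<Sum>k\<le>e. monom (coeff ?z k) k)"
    by (rule poly_as_sum_of_monoms'[symmetric])
  then have "pcompose ?z [:-b, 1:] = pcompose (\<Sum>k\<le>e. monom (coeff ?z k) k) [:-b, 1:]"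
    by (rule arg_cong)
  also have "\<dots> = (\<Sum>k\<le>e. pcompose (monom (coeff ?z k) k) [:-b, 1:])"
    by (rule pcompose_sum)
  also have "pcompose ?z [:-b, 1:] = y"
    by (simp add: pcompose_assoc[symmetric] pcompose_pCons)
  finally show ?thesis by (simp add: taylor_coeff_def monom)
qed

lemma dvd_if_taylor_coeffs_0:
  assumes "\<And>k. k < n \<Longrightarrow> taylor_coeff b k y = 0"
  shows "[:-b, 1:] ^ n dvd y"
proof -
  have "[:-b, 1:] ^ n dvd smult (taylor_coeff b k y) ([:-b, 1:] ^ k)" for k
    using assms[of k] by (cases "k < n") (auto simp: le_imp_power_dvd dvd_smult)
  then show ?thesis
    by (subst taylor_expansion[OF order_refl, of y b]) (intro dvd_sum, auto)
qed

text \<open>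
  The linear form \<open>v - b u\<close> that replaces \<open>x - b\<close> is the constant \<open>s\<close>. So a term of order \<open>k\<close> at \<open>b\<close>
  becomes one of order \<open>e - k\<close> at \<open>a\<close>, and \<open>s\<close> is the parameter of a one-dimensional torus that
  separates the Taylor coefficients at \<open>b\<close>.
\<close>

lemma binary_subst_reversal:
  assumes "degree y \<le> e"
  shows "binary_subst e [:-a, 1:] [:s - a * b, b:] y =
    (\<Sum>k\<le>e. smult (s ^ k) (smult (taylor_coeff b k y) ([:-a, 1:] ^ (e - k))))"
proof -
  let ?u = "[:-a, 1:]" and ?v = "[:s - a * b, b:]"
  have v: "?v - smult b ?u = [:s:]" by simp
  have "binary_subst e ?u ?v y = binary_subst e ?u ?v (\<Sum>k\<le>e. smult (taylor_coeff b k y) ([:-b, 1:] ^ k))"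
    using taylor_expansion[OF assms, of b] by simp
  also have "\<dots> = (\<Sum>k\<le>e. smult (taylor_coeff b k y) (?u ^ (e - k) * [:s:] ^ k))"
    unfolding binary_subst_sum binary_subst_smult v[symmetric] by (intro sum.cong) (auto simp: binary_subst_power)
  finally show ?thesis
    by (simp add: poly_const_pow mult.commute)
qed

text \<open>
  A general translate of \<open>W\<close> has the expected intersection with the image of \<open>Y\<close>. Choose \<open>a\<close> without
  inflection for \<open>W\<close> and \<open>b\<close> without inflection for the image of \<open>Y\<close>, and let \<open>s \<rightarrow> 0\<close> in
  \<open>binary_subst_reversal\<close>. The limit of the condition involves elements of \<open>W\<close> divisible by
  \<open>(x - a) ^ (e - k)\<close>, which for \<open>k < c\<close> must vanish by the choice of \<open>a\<close>; so it forces the first \<open>c\<close>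
  Taylor coefficients at \<open>b\<close> to vanish. By the choice of \<open>b\<close> these are independent conditions on
  the image of \<open>Y\<close>, until only \<open>0\<close> is left.
\<close>

lemma transversal_substitution:
  fixes Y :: "ternary_poly \<Rightarrow> complex poly"
  assumes B: "finite B" "U \<subseteq> tpoly.span B" and U: "tpoly.subspace U"
    and Y: "Vector_Spaces.linear pscale smult Y" and deg: "\<And>F. degree (Y F) \<le> e"
    and W: "cpoly.subspace W" "W \<subseteq> cpoly.span T" "finite T" "card T + c \<le> e + 1"
  obtains p q r s where "p * s - q * r \<noteq> 0"
    "tpoly.dim {F \<in> U. binary_subst e [:p, q:] [:r, s:] (Y F) \<in> W} \<le>
      max (tpoly.dim {F \<in> U. Y F = 0}) (tpoly.dim U - c)"
proof -
  interpret Y: Vector_Spaces.linear pscale smult Y by (rule Y)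
  let ?Z = "{F \<in> U. Y F = 0}"
  have "tpoly.subspace ?Z"
    using U by (auto simp: tpoly.subspace_def Y.add Y.scale)
  then obtain C D where CD: "finite C" "finite D" "C \<inter> D = {}" "tpoly.independent (C \<union> D)"
    "?Z = tpoly.span C" "U = tpoly.span (C \<union> D)" "card C = tpoly.dim ?Z" "card C + card D = tpoly.dim U"
    by (rule tpoly.extend_subspace_basis[OF B U]) auto
  have YU: "Y F \<in> cpoly.span (Y ` D)" if "F \<in> U" for F
  proof -
    have "Y F \<in> Y ` tpoly.span (C \<union> D)" using that CD(6) by blast
    also have "\<dots> = cpoly.span (Y ` (C \<union> D))" by (rule Y.span_image[symmetric])
    also have "\<dots> \<subseteq> cpoly.span (Y ` D)"
    proof (rule cpoly.span_minimal[OF _ cpoly.subspace_span])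
      have "Y G = 0" if "G \<in> C" for G
        using that CD(5) tpoly.span_base[of G C] by auto
      then show "Y ` (C \<union> D) \<subseteq> cpoly.span (Y ` D)"
        by (auto intro: cpoly.span_zero cpoly.span_base)
    qed
    finally show ?thesis .
  qed
  have "finite {a. \<exists>y\<in>cpoly.span T. y \<noteq> 0 \<and> [:-a, 1:] ^ card T dvd y}"
    using W(3) by (rule finite_inflection_points)
  from ex_new_if_finite[OF infinite_UNIV_char_0 this] obtain a
    where "a \<notin> {a. \<exists>y\<in>cpoly.span T. y \<noteq> 0 \<and> [:-a, 1:] ^ card T dvd y}" ..
  then have a: "y = 0" if "y \<in> W" "[:-a, 1:] ^ card T dvd y" for y
    using that W(2) by auto
  have "finite {b. \<exists>y\<in>cpoly.span (Y ` D). y \<noteq> 0 \<and> [:-b, 1:] ^ card (Y ` D) dvd y}"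
    using CD(2) by (intro finite_inflection_points) simp
  from ex_new_if_finite[OF infinite_UNIV_char_0 this] obtain b
    where "b \<notin> {b. \<exists>y\<in>cpoly.span (Y ` D). y \<noteq> 0 \<and> [:-b, 1:] ^ card (Y ` D) dvd y}" ..
  then have b: "y = 0" if "y \<in> cpoly.span (Y ` D)" "[:-b, 1:] ^ card (Y ` D) dvd y" for y
    using that by auto
  define X where "X k = {y. [:-a, 1:] ^ (e + 1 - k) dvd y}" for k
  define Cf where "Cf i k F = (if k \<le> e then smult (taylor_coeff b k (Y F)) ([:-a, 1:] ^ (e - k)) else 0)"
    for i :: unit and k F
  define L where "L = {F \<in> U. \<forall>k<c. taylor_coeff b k (Y F) = 0}"
  have "finite {t. t \<noteq> 0 \<and> tpoly.dim {F \<in> U. \<forall>i\<in>UNIV. \<forall>k\<le>e. \<exists>h\<in>X k. Cf i k F + h \<in> W}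
    < tpoly.dim {F \<in> U. \<forall>i\<in>UNIV. (\<Sum>k\<le>e. smult (t ^ k) (Cf i k F)) \<in> W}}"
  proof (rule tpoly_cpoly.dim_degeneration[OF B U])
    show "Vector_Spaces.linear pscale smult (Cf i k)" for i k
      by (auto simp: Vector_Spaces.linear_iff Cf_def Y.add Y.scale taylor_coeff_add taylor_coeff_smult
          smult_add_left tpoly.vector_space_axioms cpoly.vector_space_axioms)
    show "cpoly.subspace (X k)" for k
      by (auto simp: cpoly.subspace_def X_def dvd_smult)
    show "Cf i k' F \<in> X k" if "k' < k" for i k k' F
      using that by (auto simp: Cf_def X_def intro!: dvd_smult le_imp_power_dvd)
  qed (rule W(1))
  then have "finite ({0} \<union> {t. t \<noteq> 0 \<and> tpoly.dim {F \<in> U. \<forall>i\<in>UNIV. \<forall>k\<le>e. \<exists>h\<in>X k. Cf i k F + h \<in> W}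
    < tpoly.dim {F \<in> U. \<forall>i\<in>UNIV. (\<Sum>k\<le>e. smult (t ^ k) (Cf i k F)) \<in> W}})"
    by simp
  from ex_new_if_finite[OF infinite_UNIV_char_0 this] obtain s where s: "s \<noteq> 0"
    "tpoly.dim {F \<in> U. \<forall>i\<in>UNIV. (\<Sum>k\<le>e. smult (s ^ k) (Cf i k F)) \<in> W} \<le>
     tpoly.dim {F \<in> U. \<forall>i\<in>UNIV. \<forall>k\<le>e. \<exists>h\<in>X k. Cf i k F + h \<in> W}"
    by (auto simp: not_less)
  have "(\<Sum>k\<le>e. smult (s ^ k) (Cf i k F)) = binary_subst e [:-a, 1:] [:s - a * b, b:] (Y F)" for i F
    unfolding binary_subst_reversal[OF deg] by (rule sum.cong) (auto simp: Cf_def)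
  then have "tpoly.dim {F \<in> U. binary_subst e [:-a, 1:] [:s - a * b, b:] (Y F) \<in> W} \<le>
     tpoly.dim {F \<in> U. \<forall>i\<in>UNIV. \<forall>k\<le>e. \<exists>h\<in>X k. Cf i k F + h \<in> W}"
    using s(2) by simp
  also have "\<dots> \<le> tpoly.dim L"
  proof (rule tpoly.dim_mono_finite[OF B(1)])
    show "L \<subseteq> tpoly.span B" using B(2) by (auto simp: L_def)
    show "{F \<in> U. \<forall>i\<in>UNIV. \<forall>k\<le>e. \<exists>h\<in>X k. Cf i k F + h \<in> W} \<subseteq> L"
    proof
      fix F assume F: "F \<in> {F \<in> U. \<forall>i\<in>UNIV. \<forall>k\<le>e. \<exists>h\<in>X k. Cf i k F + h \<in> W}"
      have "taylor_coeff b k (Y F) = 0" if k: "k < c" for k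
      proof -
        have ke: "k \<le> e" "card T \<le> e - k" using k W(4) by auto
        then obtain h where h: "h \<in> X k" "Cf () k F + h \<in> W"
          using F by blast
        have h': "[:-a, 1:] ^ Suc (e - k) dvd h"
          using h(1) ke by (simp add: X_def Suc_diff_le del: power_Suc)
        have "[:-a, 1:] ^ (e - k) dvd Cf () k F"
          using ke by (simp add: Cf_def dvd_smult)
        moreover have "[:-a, 1:] ^ (e - k) dvd h"
          using h' by (rule dvd_trans[rotated]) (simp add: le_imp_power_dvd del: power_Suc)
        ultimately have "[:-a, 1:] ^ (e - k) dvd Cf () k F + h"
          by (rule dvd_add)
        then have "[:-a, 1:] ^ card T dvd Cf () k F + h"
          using ke(2) by (meson dvd_trans le_imp_power_dvd)
        then have "Cf () k F + h = 0" using a h(2) by blast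
        then have "[:-a, 1:] ^ Suc (e - k) dvd Cf () k F"
          using h' by (metis add_eq_0_iff2 dvd_minus_iff)
        then have d: "[:-a, 1:] ^ Suc (e - k) dvd smult (taylor_coeff b k (Y F)) ([:-a, 1:] ^ (e - k))"
          using ke by (simp add: Cf_def del: power_Suc)
        show ?thesis
        proof (rule ccontr)
          assume nz: "taylor_coeff b k (Y F) \<noteq> 0"
          then have "[:-a, 1:] ^ Suc (e - k) dvd [:-a, 1:] ^ (e - k)"
            using d by (simp add: dvd_smult_iff del: power_Suc)
          then have "degree ([:-a, 1:] ^ Suc (e - k)) \<le> degree ([:-a, 1:] ^ (e - k))"
            by (rule dvd_imp_degree_le) simp
          then show False
            by (simp add: degree_linear_power del: power_Suc)
        qed
      qed
      then show "F \<in> L" using F by (auto simp: L_def)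
    qed
  qed
  (* card (Y ` D) is at most the rank of Y on U *)
  also have "tpoly.dim L \<le> max (tpoly.dim ?Z) (tpoly.dim U - c)"
  proof (cases "card (Y ` D) \<le> c")
    case True
    have "L \<subseteq> ?Z"
    proof
      fix F assume F: "F \<in> L"
      then have "[:-b, 1:] ^ card (Y ` D) dvd Y F"
        using True by (intro dvd_if_taylor_coeffs_0) (auto simp: L_def)
      then show "F \<in> ?Z"
        using b YU F by (auto simp: L_def)
    qed
    then have "tpoly.dim L \<le> tpoly.dim ?Z"
      using B by (intro tpoly.dim_mono_finite[of B]) auto
    then show ?thesis by simp
  next
    case False
    let ?I = "{c..<card (Y ` D)}"
    have "tpoly.dim L \<le> tpoly.dim {F \<in> L. \<forall>k\<in>?I. taylor_coeff b k (Y F) = 0} + card ?I"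
    proof (rule tpoly.dim_cut[OF B(1)])
      show "L \<subseteq> tpoly.span B" using B(2) by (auto simp: L_def)
      show "tpoly.subspace L"
        using U by (auto simp: tpoly.subspace_def L_def Y.add Y.scale Y.zero taylor_coeff_add taylor_coeff_smult)
           (simp add: taylor_coeff_def)
      show "functional pscale (\<lambda>F. taylor_coeff b k (Y F))" for k
        by (rule tpoly.functionalI) (auto simp: Y.add Y.scale taylor_coeff_add taylor_coeff_smult)
    qed simp
    moreover have "{F \<in> L. \<forall>k\<in>?I. taylor_coeff b k (Y F) = 0} \<subseteq> ?Z"
    proof
      fix F assume F: "F \<in> {F \<in> L. \<forall>k\<in>?I. taylor_coeff b k (Y F) = 0}"
      have "taylor_coeff b k (Y F) = 0" if "k < card (Y ` D)" for k
        using F that by (cases "k < c") (auto simp: L_def)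
      then have "[:-b, 1:] ^ card (Y ` D) dvd Y F"
        by (intro dvd_if_taylor_coeffs_0) auto
      then show "F \<in> ?Z"
        using b YU F by (auto simp: L_def)
    qed
    then have "tpoly.dim {F \<in> L. \<forall>k\<in>?I. taylor_coeff b k (Y F) = 0} \<le> tpoly.dim ?Z"
      using B by (intro tpoly.dim_mono_finite[of B]) auto
    ultimately have "tpoly.dim L \<le> tpoly.dim ?Z + (card (Y ` D) - c)" by simp
    moreover have "card (Y ` D) \<le> card D" using CD(2) by (rule card_image_le)
    ultimately have "tpoly.dim L \<le> tpoly.dim U - c"
      using CD(7,8) False by linarith
    then show ?thesis by simp
  qed
  finally have "tpoly.dim {F \<in> U. binary_subst e [:-a, 1:] [:s - a * b, b:] (Y F) \<in> W} \<le>
      max (tpoly.dim ?Z) (tpoly.dim U - c)" .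
  moreover have "(-a) * b - 1 * (s - a * b) \<noteq> 0" using s(1) by simp
  ultimately show ?thesis by (intro that)
qed

section \<open>Conditions on tangent cones at several points\<close>

lemma leading_form_sum: "leading_form e (\<Sum>i\<in>I. F i) = (\<Sum>i\<in>I. leading_form e (F i))"
proof -
  have "leading_form e 0 = 0" using leading_form_pscale[of e 0 0] by simp
  then show ?thesis
    by (induction I rule: infinite_finite_induct) (auto simp: leading_form_add)
qed

lemma lookup_eq_0_if_homog: "F \<in> homog w k \<Longrightarrow> w t \<noteq> k \<Longrightarrow> Poly_Mapping.lookup F t = 0"
  by (auto simp: homog_def in_keys_iff)

text \<open>
  A change of the two tangent directions of a frame, which leaves the point fixed.
\<close>

definition frame_block :: "complex \<Rightarrow> complex \<Rightarrow> complex \<Rightarrow> complex \<Rightarrow> frame" where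
  "frame_block p q r s i j = (if i = 3 \<or> j = 3 then (if i = j then 1 else 0)
     else if i = 1 then (if j = 1 then p else q) else (if j = 1 then r else s))"

lemma frame_block_simps [simp]:
  "frame_block p q r s 1 1 = p" "frame_block p q r s 1 2 = q" "frame_block p q r s 2 1 = r" "frame_block p q r s 2 2 = s"
  "frame_block p q r s 3 1 = 0" "frame_block p q r s 3 2 = 0" "frame_block p q r s 1 3 = 0" "frame_block p q r s 2 3 = 0"
  "frame_block p q r s 3 3 = 1"
  by (simp_all add: frame_block_def)

lemma leading_form_lsubst_frame_block:
  "leading_form e (lsubst (frame_block p q r s) G) = binary_subst e [:p, q:] [:r, s:] (leading_form e G)"
proof -
  let ?g = "frame_block p q r s" and ?u = "[:p, q:]" and ?v = "[:r, s:]"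
  have pv: "pvar j \<in> homog (local_deg 3) (if j = 3 then 0 else 1)" for j
    by (auto simp: homog_def pvar_def local_deg_single)
  have lf: "linear_form ?g i \<in> homog (local_deg 3) (if i = 3 then 0 else 1)" for i
  proof -
    have "pscale (?g i j) (pvar j) \<in> homog (local_deg 3) (if i = 3 then 0 else 1)" for j
    proof (cases "i = 3 \<longleftrightarrow> j = 3")
      case True
      then show ?thesis using pv[of j] by (auto intro: tpoly.subspace_scale[OF subspace_homog])
    next
      case False
      then have "?g i j = 0" by (auto simp: frame_block_def)
      then show ?thesis by (simp add: tpoly.subspace_0[OF subspace_homog])
    qed
    then show ?thesis
      unfolding linear_form_def by (intro tpoly.subspace_sum[OF subspace_homog])
  qed
  have dlf: "dehom (linear_form ?g i) = (if i = 3 then 1 else if i = 1 then ?u else ?v)" for i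
  proof -
    have "dehom (pvar j) = (if j = 2 then [:0, 1:] else 1)" for j
      by (auto simp: pvar_def dehom_single lookup_single when_def monom_altdef)
    then show ?thesis
      using exhaust_3[of i] by (auto simp: linear_form_def dehom_sum dehom_add dehom_pscale sum_3)
  qed
  have mon: "leading_form e (mon_eval (linear_form ?g) t) =
    (if local_deg 3 t = e then ?u ^ Poly_Mapping.lookup t 1 * ?v ^ Poly_Mapping.lookup t 2 else 0)" for t
  proof -
    let ?M = "mon_eval (linear_form ?g) t"
    have "?M \<in> homog (local_deg 3) (\<Sum>i\<in>UNIV. Poly_Mapping.lookup t i * (if i = 3 then 0 else 1))"
      by (rule mon_eval_in_homog[OF local_deg_add lf])
    moreover have "(\<Sum>i\<in>UNIV. Poly_Mapping.lookup t i * (if i = 3 then 0 else 1)) = local_deg 3 t"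
      by (simp add: sum_3 local_deg_3_eq)
    ultimately have "?M \<in> homog (local_deg 3) (local_deg 3 t)" by simp
    then have "local_part e ?M = (if local_deg 3 t = e then ?M else 0)"
      by (intro poly_mapping_eqI) (auto simp: lookup_eq_0_if_homog)
    moreover have "dehom ?M = ?u ^ Poly_Mapping.lookup t 1 * ?v ^ Poly_Mapping.lookup t 2"
    proof -
      have "dehom (\<Prod>i\<in>I. H i) = (\<Prod>i\<in>I. dehom (H i))" for I :: "3 set" and H
        by (induction I rule: infinite_finite_induct) (auto simp: dehom_mult)
      then have "dehom ?M = (\<Prod>i\<in>UNIV. dehom (linear_form ?g i) ^ Poly_Mapping.lookup t i)"
        by (simp add: mon_eval_def dehom_power)
      also have "\<dots> = ?u ^ Poly_Mapping.lookup t 1 * ?v ^ Poly_Mapping.lookup t 2"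
        unfolding UNIV_3 by (simp add: dlf)
      finally show ?thesis .
    qed
    ultimately show ?thesis by (simp add: leading_form_def)
  qed
  have "leading_form e (lsubst ?g G) = (\<Sum>t\<in>Poly_Mapping.keys G. smult (Poly_Mapping.lookup G t)
    (if local_deg 3 t = e then ?u ^ Poly_Mapping.lookup t 1 * ?v ^ Poly_Mapping.lookup t 2 else 0))"
    unfolding lsubst_eq leading_form_sum leading_form_pscale mon ..
  also have "\<dots> = (\<Sum>t\<in>{t \<in> Poly_Mapping.keys G. local_deg 3 t = e}.
      binary_subst e ?u ?v (monom (Poly_Mapping.lookup G t) (Poly_Mapping.lookup t 2)))"
    by (rule sum.mono_neutral_cong_right) (auto simp: binary_subst_monom local_deg_3_eq)
  also have "\<dots> = binary_subst e ?u ?v (leading_form e G)"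
    by (simp add: leading_form_def local_part_def dehom_sum dehom_single binary_subst_sum)
  finally show ?thesis .
qed

lemma ord_ge_lsubst_frame_block_cancel:
  assumes "p * s - q * r \<noteq> 0" and "lsubst (frame_block p q r s) G \<in> ord_ge 3 m"
  shows "G \<in> ord_ge 3 m"
proof -
  let ?d = "p * s - q * r"
  let ?h = "frame_block (s / ?d) (- q / ?d) (- r / ?d) (p / ?d)"
  have "frame_mult (frame_block p q r s) ?h = frame_one"
  proof (intro ext)
    fix i j :: 3
    show "frame_mult (frame_block p q r s) ?h i j = frame_one i j"
      using exhaust_3[of i] exhaust_3[of j] assms(1)
      by (auto simp: frame_mult_def frame_one_def sum_3 divide_simps)
  qed
  then have "G = lsubst ?h (lsubst (frame_block p q r s) G)"
    by (simp add: lsubst_lsubst)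
  also have "\<dots> \<in> ord_ge 3 m"
    by (rule lsubst_ord_ge[OF assms(2)]) (auto simp: frame_block_def)
  finally show ?thesis .
qed

text \<open>
  The condition at a point of \<open>B\<close> is the limit of a contracting group; \<open>B = {}\<close> gives systems with
  multiplicities \<open>e\<close> and \<open>e + 1\<close>. The tangent cone is read in the coordinates of the frame, so that
  moving the frame amounts to replacing \<open>W\<close> by a translate.
\<close>

definition cluster_space ::
  "nat \<Rightarrow> nat \<Rightarrow> complex poly set \<Rightarrow> nat \<Rightarrow> nat set \<Rightarrow> nat set \<Rightarrow> (nat \<Rightarrow> frame) \<Rightarrow> ternary_poly set"
where
  "cluster_space d e W n B C x = {F \<in> forms d. \<forall>i<n.
     lsubst (x i) F \<in> ord_ge 3 (if i \<in> C then Suc e else e) \<and>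
     (i \<in> B \<longrightarrow> leading_form e (lsubst (x i) F) \<in> W)}"

definition cluster_dim :: "nat \<Rightarrow> nat \<Rightarrow> complex poly set \<Rightarrow> nat \<Rightarrow> nat set \<Rightarrow> nat set \<Rightarrow> nat" where
  "cluster_dim d e W n B C = (LEAST k. \<exists>x. k = tpoly.dim (cluster_space d e W n B C x))"

lemma cluster_space_subset_span: "cluster_space d e W n B C x \<subseteq> tpoly.span (monomial_basis d)"
  by (auto simp: cluster_space_def forms_eq_span)

lemma subspace_cluster_space:
  assumes "cpoly.subspace W"
  shows "tpoly.subspace (cluster_space d e W n B C x)"
  using assms subspace_forms[of d] subspace_ord_ge
  by (auto simp: tpoly.subspace_def cpoly.subspace_def cluster_space_def lsubst_add lsubst_pscale
      leading_form_add leading_form_pscale) (simp_all add: lsubst_def leading_form_def local_part_def)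

lemma functional_lookup_lsubst: "functional pscale (\<lambda>F. Poly_Mapping.lookup (lsubst A F) t)"
  by (rule tpoly.functionalI) (auto simp: lsubst_add lsubst_pscale lookup_add)

text \<open>
  All conditions are the vanishing of functionals that are polynomial in the frames; membership in
  \<open>W\<close> is expressed by the functionals that vanish on \<open>W\<close>.
\<close>

lemma generic_cluster_space:
  assumes W: "cpoly.subspace W" and x0: "tpoly.dim (cluster_space d e W n B C x\<^sub>0) \<le> k"
  shows "generic {x. tpoly.dim (cluster_space d e W n B C x) \<le> k}"
proof -
  define R :: "(nat \<times> ((3 \<Rightarrow>\<^sub>0 nat) + (complex poly \<Rightarrow> complex))) set" where
    "R = {(i, Inl t) |i t. i < n \<and> local_deg 3 t < (if i \<in> C then Suc e else e)} \<union>
      {(i, Inr f) |i f. i < n \<and> i \<in> B \<and> functional smult f \<and> (\<forall>y\<in>W. f y = 0)}"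
  define \<phi> where "\<phi> r x F = (case r of
      (i, Inl t) \<Rightarrow> Poly_Mapping.lookup (lsubst (x i) F) t
    | (i, Inr f) \<Rightarrow> f (leading_form e (lsubst (x i) F)))"
    for r :: "nat \<times> ((3 \<Rightarrow>\<^sub>0 nat) + (complex poly \<Rightarrow> complex))" and x :: "nat \<Rightarrow> frame" and F
  have eq: "cluster_space d e W n B C x = {F \<in> forms d. \<forall>r\<in>R. \<phi> r x F = 0}" for x
  proof -
    have "(\<forall>r\<in>R. \<phi> r x F = 0) \<longleftrightarrow> (\<forall>i<n. lsubst (x i) F \<in> ord_ge 3 (if i \<in> C then Suc e else e) \<and>
       (i \<in> B \<longrightarrow> leading_form e (lsubst (x i) F) \<in> W))" for F
    proof
      assume L: "\<forall>r\<in>R. \<phi> r x F = 0"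
      show "\<forall>i<n. lsubst (x i) F \<in> ord_ge 3 (if i \<in> C then Suc e else e) \<and>
       (i \<in> B \<longrightarrow> leading_form e (lsubst (x i) F) \<in> W)"
      proof (intro allI impI conjI)
        fix i assume i: "i < n"
        show "lsubst (x i) F \<in> ord_ge 3 (if i \<in> C then Suc e else e)"
          unfolding ord_ge_iff
        proof (intro allI impI)
          fix t assume "local_deg 3 t < (if i \<in> C then Suc e else e)"
          then have "(i, Inl t) \<in> R" using i by (auto simp: R_def)
          then show "Poly_Mapping.lookup (lsubst (x i) F) t = 0"
            using L by (force simp: \<phi>_def)
        qed
        assume iB: "i \<in> B"
        show "leading_form e (lsubst (x i) F) \<in> W"
        proof (rule ccontr)
          assume "leading_form e (lsubst (x i) F) \<notin> W"
          then obtain f where f: "functional smult f" "\<And>y. y \<in> W \<Longrightarrow> f y = 0" "f (leading_form e (lsubst (x i) F)) = 1"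
            by (rule cpoly.exists_separating_functional[OF W]) auto
          then have "(i, Inr f) \<in> R" using i iB by (auto simp: R_def)
          then have "\<phi> (i, Inr f) x F = 0" using L by blast
          then show False using f(3) by (simp add: \<phi>_def)
        qed
      qed
    next
      assume "\<forall>i<n. lsubst (x i) F \<in> ord_ge 3 (if i \<in> C then Suc e else e) \<and>
       (i \<in> B \<longrightarrow> leading_form e (lsubst (x i) F) \<in> W)"
      then show "\<forall>r\<in>R. \<phi> r x F = 0"
        by (auto simp: R_def \<phi>_def ord_ge_iff split: if_splits)
    qed
    then show ?thesis by (auto simp: cluster_space_def)
  qed
  show ?thesis
    unfolding eq
  proof (rule generic_dim_le[OF finite_monomial_basis])
    show "forms d \<subseteq> tpoly.span (monomial_basis d)" by (simp add: forms_eq_span)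
    show "tpoly.subspace (forms d)" by (rule subspace_forms)
    show "functional pscale (\<phi> r x)" if rR: "r \<in> R" for r x
    proof (cases "\<exists>i t. r = (i, Inl t)")
      case True
      then show ?thesis
        by (auto simp: \<phi>_def[abs_def] functional_lookup_lsubst)
    next
      case False
      then obtain i f where r: "r = (i, Inr f)" and f: "functional smult f"
        using rR by (auto simp: R_def)
      show ?thesis
        by (rule tpoly.functionalI)
           (auto simp: r \<phi>_def lsubst_add lsubst_pscale leading_form_add leading_form_pscale
             cpoly.functional_add[OF f] cpoly.functional_scale[OF f])
    qed
    show "poly_on_lines (\<lambda>x. \<phi> r x F)" if r: "r \<in> R" and F: "F \<in> forms d" for r F
    proof (cases "\<exists>i t. r = (i, Inl t)")
      case True
      then show ?thesis
        by (auto simp: \<phi>_def[abs_def] poly_on_lines_lookup_lsubst)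
    next
      case False
      then obtain i f where r: "r = (i, Inr f)" and f: "functional smult f"
        using r by (auto simp: R_def)
      have "\<phi> r x F = (\<Sum>j\<le>e. Poly_Mapping.lookup (lsubst (x i) F) (monomial (e - j) j (d - e)) *
        f (monom 1 j))" for x
      proof -
        have G: "lsubst (x i) F \<in> forms d" using F by (rule lsubst_in_forms)
        have "leading_form e (lsubst (x i) F) = (\<Sum>j\<le>e. monom (coeff (leading_form e (lsubst (x i) F)) j) j)"
          using degree_leading_form by (rule poly_as_sum_of_monoms'[symmetric])
        also have "\<dots> = (\<Sum>j\<le>e. smult (Poly_Mapping.lookup (lsubst (x i) F) (monomial (e - j) j (d - e))) (monom 1 j))"
          by (rule sum.cong) (auto simp: coeff_leading_form[OF G] smult_monom)
        finally show ?thesis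
          by (simp add: r \<phi>_def cpoly.functional_sum[OF f] cpoly.functional_scale[OF f])
      qed
      then show ?thesis
        by (simp only:) (intro poly_on_lines_sum poly_on_lines_mult poly_on_lines_const poly_on_lines_lookup_lsubst)
    qed
    show "tpoly.dim {F \<in> forms d. \<forall>r\<in>R. \<phi> r x\<^sub>0 F = 0} \<le> k"
      using x0 unfolding eq .
  qed
qed

lemma cluster_dim_le: "cluster_dim d e W n B C \<le> tpoly.dim (cluster_space d e W n B C x)"
  unfolding cluster_dim_def by (rule Least_le) blast

lemma cluster_dim_attained:
  obtains x where "tpoly.dim (cluster_space d e W n B C x) = cluster_dim d e W n B C"
proof -
  have "\<exists>x. cluster_dim d e W n B C = tpoly.dim (cluster_space d e W n B C x)"
    unfolding cluster_dim_def by (rule LeastI_ex) blast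
  then show ?thesis using that by metis
qed

lemma generic_cluster_dim:
  assumes "cpoly.subspace W"
  shows "generic {x. tpoly.dim (cluster_space d e W n B C x) \<le> cluster_dim d e W n B C}"
proof -
  obtain x where "tpoly.dim (cluster_space d e W n B C x) = cluster_dim d e W n B C"
    by (rule cluster_dim_attained)
  then show ?thesis using generic_cluster_space[OF assms, of d e n B C x] by simp
qed

lemma cluster_dim_simultaneous:
  assumes "cpoly.subspace W"
  obtains x where "tpoly.dim (cluster_space d e W n B C x) \<le> cluster_dim d e W n B C"
    and "tpoly.dim (cluster_space d e W n B' C' x) \<le> cluster_dim d e W n B' C'"
  using generic_Int[OF generic_cluster_dim[OF assms, of d e n B C] generic_cluster_dim[OF assms, of d e n B' C']]
  unfolding generic_def by blast

lemma cluster_dim_supermodular: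
  assumes "cpoly.subspace W" and "i \<notin> C" "j \<notin> C"
  shows "cluster_dim d e W n {} (insert i C) + cluster_dim d e W n {} (insert j C) \<le>
    cluster_dim d e W n {} C + cluster_dim d e W n {} (insert i (insert j C))"
proof -
  let ?S = "cluster_space d e W n {}"
  obtain x where x: "tpoly.dim (?S C x) \<le> cluster_dim d e W n {} C"
    "tpoly.dim (?S (insert i (insert j C)) x) \<le> cluster_dim d e W n {} (insert i (insert j C))"
    by (rule cluster_dim_simultaneous[OF assms(1)])
  have mono: "ord_ge 3 (Suc e) \<subseteq> ord_ge 3 e" by (auto simp: ord_ge_Suc_iff)
  have sub: "?S (insert k C) x \<subseteq> ?S C x" for k
    using mono by (auto simp: cluster_space_def split: if_splits)
  have inter: "?S (insert i C) x \<inter> ?S (insert j C) x = ?S (insert i (insert j C)) x"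
    using mono by (auto simp: cluster_space_def split: if_splits)
  have "tpoly.dim (?S (insert i C) x) + tpoly.dim (?S (insert j C) x) \<le>
    tpoly.dim (?S C x) + tpoly.dim (?S (insert i C) x \<inter> ?S (insert j C) x)"
    using subspace_cluster_space[OF assms(1)] sub
    by (intro tpoly.dim_Int_supermodular[OF finite_monomial_basis cluster_space_subset_span])
  then show ?thesis
    unfolding inter using x cluster_dim_le[of d e W n "{}" "insert i C" x] cluster_dim_le[of d e W n "{}" "insert j C" x]
    by linarith
qed

lemma cluster_dim_permute:
  assumes \<pi>: "bij_betw \<pi> {..<n} {..<n}" and C: "\<And>i. i < n \<Longrightarrow> \<pi> i \<in> C' \<longleftrightarrow> i \<in> C"
  shows "cluster_dim d e W n {} C \<le> cluster_dim d e W n {} C'"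
proof -
  obtain x where x: "tpoly.dim (cluster_space d e W n {} C' x) = cluster_dim d e W n {} C'"
    by (rule cluster_dim_attained)
  have img: "{..<n} = \<pi> ` {..<n}"
    using \<pi> by (simp add: bij_betw_def)
  have "(\<forall>i<n. P i (i \<in> C')) \<longleftrightarrow> (\<forall>i<n. P (\<pi> i) (i \<in> C))" for P
  proof -
    have "(\<forall>i<n. P i (i \<in> C')) \<longleftrightarrow> (\<forall>i\<in>\<pi> ` {..<n}. P i (i \<in> C'))"
      using img by auto
    also have "\<dots> \<longleftrightarrow> (\<forall>i<n. P (\<pi> i) (i \<in> C))"
      using C by auto
    finally show ?thesis .
  qed
  from this[of "\<lambda>i b. lsubst (x i) F \<in> ord_ge 3 (if b then Suc e else e)" for F]
  have "cluster_space d e W n {} C' x = cluster_space d e W n {} C (x \<circ> \<pi>)"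
    by (simp add: cluster_space_def)
  then show ?thesis
    using x cluster_dim_le[of d e W n "{}" C "x \<circ> \<pi>"] by simp
qed

lemma cluster_dim_cong_card:
  assumes "C \<subseteq> {..<n}" "C' \<subseteq> {..<n}" "card C = card C'"
  shows "cluster_dim d e W n {} C \<le> cluster_dim d e W n {} C'"
proof -
  have fin: "finite C" "finite C'" using assms finite_subset by auto
  obtain f where f: "bij_betw f C C'"
    using assms(3) fin finite_same_card_bij by blast
  have "card ({..<n} - C) = card ({..<n} - C')"
    using assms fin by (simp add: card_Diff_subset)
  then obtain g where g: "bij_betw g ({..<n} - C) ({..<n} - C')"
    using finite_same_card_bij[of "{..<n} - C" "{..<n} - C'"] by blast
  define \<pi> where "\<pi> i = (if i \<in> C then f i else g i)" for i
  have "bij_betw \<pi> C C'"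
    using f by (subst bij_betw_cong[of _ _ f]) (auto simp: \<pi>_def)
  moreover have "bij_betw \<pi> ({..<n} - C) ({..<n} - C')"
    using g by (subst bij_betw_cong[of _ _ g]) (auto simp: \<pi>_def)
  ultimately have "bij_betw \<pi> (C \<union> ({..<n} - C)) (C' \<union> ({..<n} - C'))"
    by (rule bij_betw_combine) auto
  then have "bij_betw \<pi> {..<n} {..<n}"
    using assms by (simp add: Un_absorb1)
  moreover have "\<pi> i \<in> C' \<longleftrightarrow> i \<in> C" if "i < n" for i
    using f g that by (auto simp: \<pi>_def bij_betw_def)
  ultimately show ?thesis by (rule cluster_dim_permute)
qed

text \<open>
  For general frames, turning the frame at \<open>b\<close> by a suitable element of \<open>GL\<^sub>2\<close> puts \<open>W\<close> in general
  position to the tangent cones that occur at \<open>b\<close>. The forms without term of degree \<open>e\<close> at \<open>b\<close>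
  are those vanishing there to order \<open>e + 1\<close>.
\<close>

lemma cluster_dim_recursion:
  assumes W: "cpoly.subspace W" "W \<subseteq> cpoly.span T" "finite T" "card T + c \<le> e + 1"
    and b: "b < n" "b \<notin> B" "b \<notin> C"
  shows "cluster_dim d e W n (insert b B) C \<le>
    max (cluster_dim d e W n B (insert b C)) (cluster_dim d e W n B C - c)"
proof -
  obtain x where x: "tpoly.dim (cluster_space d e W n B C x) \<le> cluster_dim d e W n B C"
    "tpoly.dim (cluster_space d e W n B (insert b C) x) \<le> cluster_dim d e W n B (insert b C)"
    by (rule cluster_dim_simultaneous[OF W(1)])
  let ?U = "cluster_space d e W n B C x"
  let ?Y = "\<lambda>F. leading_form e (lsubst (x b) F)"
  obtain p q r s where g: "p * s - q * r \<noteq> 0"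
    "tpoly.dim {F \<in> ?U. binary_subst e [:p, q:] [:r, s:] (?Y F) \<in> W} \<le>
      max (tpoly.dim {F \<in> ?U. ?Y F = 0}) (tpoly.dim ?U - c)"
  proof (rule transversal_substitution[OF finite_monomial_basis cluster_space_subset_span
        subspace_cluster_space[OF W(1)] _ degree_leading_form W])
    show "Vector_Spaces.linear pscale smult ?Y"
      by (simp add: Vector_Spaces.linear_iff lsubst_add lsubst_pscale leading_form_add leading_form_pscale
          tpoly.vector_space_axioms cpoly.vector_space_axioms)
  qed
  define x' where "x' = x(b := frame_mult (x b) (frame_block p q r s))"
  have kernel: "{F \<in> ?U. ?Y F = 0} = cluster_space d e W n B (insert b C) x"
  proof -
    have "lsubst (x b) F \<in> ord_ge 3 (Suc e) \<longleftrightarrow> lsubst (x b) F \<in> ord_ge 3 e \<and> ?Y F = 0" if "F \<in> forms d" for F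
      using leading_form_eq_0_iff[OF lsubst_in_forms[OF that]] by (simp add: ord_ge_Suc_iff)
    then show ?thesis
      using b by (auto simp: cluster_space_def)
  qed
  have "cluster_space d e W n (insert b B) C x' \<subseteq> {F \<in> ?U. binary_subst e [:p, q:] [:r, s:] (?Y F) \<in> W}"
  proof
    fix F assume F: "F \<in> cluster_space d e W n (insert b B) C x'"
    have b': "lsubst (x' b) F \<in> ord_ge 3 e" "leading_form e (lsubst (x' b) F) \<in> W"
      using F b by (auto simp: cluster_space_def)
    have xb: "lsubst (x' b) F = lsubst (frame_block p q r s) (lsubst (x b) F)"
      by (simp add: x'_def lsubst_lsubst)
    have "lsubst (x b) F \<in> ord_ge 3 e"
      using ord_ge_lsubst_frame_block_cancel[OF g(1)] b'(1) xb by simp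
    moreover have "lsubst (x i) F \<in> ord_ge 3 (if i \<in> C then Suc e else e) \<and>
        (i \<in> B \<longrightarrow> leading_form e (lsubst (x i) F) \<in> W)" if "i < n" "i \<noteq> b" for i
    proof -
      have "x' i = x i" using that(2) by (simp add: x'_def)
      moreover have "lsubst (x' i) F \<in> ord_ge 3 (if i \<in> C then Suc e else e) \<and>
          (i \<in> insert b B \<longrightarrow> leading_form e (lsubst (x' i) F) \<in> W)"
        using F that(1) unfolding cluster_space_def by blast
      ultimately show ?thesis by simp
    qed
    ultimately have "lsubst (x i) F \<in> ord_ge 3 (if i \<in> C then Suc e else e) \<and>
        (i \<in> B \<longrightarrow> leading_form e (lsubst (x i) F) \<in> W)" if "i < n" for i
      using b that by (cases "i = b") auto
    then have "F \<in> ?U"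
      using F unfolding cluster_space_def by blast
    moreover have "binary_subst e [:p, q:] [:r, s:] (?Y F) \<in> W"
      using b'(2) unfolding xb leading_form_lsubst_frame_block .
    ultimately show "F \<in> {F \<in> ?U. binary_subst e [:p, q:] [:r, s:] (?Y F) \<in> W}" by blast
  qed
  then have "tpoly.dim (cluster_space d e W n (insert b B) C x') \<le>
      tpoly.dim {F \<in> ?U. binary_subst e [:p, q:] [:r, s:] (?Y F) \<in> W}"
    using cluster_space_subset_span[of d e W n B C x]
    by (intro tpoly.dim_mono_finite[OF finite_monomial_basis[of d]]) auto
  also have "\<dots> \<le> max (cluster_dim d e W n B (insert b C)) (cluster_dim d e W n B C - c)"
    using g(2) x unfolding kernel by linarith
  finally show ?thesis
    using cluster_dim_le[of d e W n "insert b B" C x'] by linarith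
qed

text \<open>
  The recursion unfolded: at each point of \<open>B\<close> either \<open>c\<close> dimensions are lost, or the order of
  vanishing increases; \<open>I\<close> collects the points of the second kind.
\<close>

lemma cluster_dim_bound:
  assumes W: "cpoly.subspace W" "W \<subseteq> cpoly.span T" "finite T" "card T + c \<le> e + 1"
    and "finite B" "B \<subseteq> {..<n}" "B \<inter> C = {}"
  shows "cluster_dim d e W n B C = 0 \<or>
    (\<exists>I\<subseteq>B. cluster_dim d e W n B C + c * card (B - I) \<le> cluster_dim d e W n {} (C \<union> I))"
  using assms(5-7)
proof (induction B arbitrary: C rule: finite_induct)
  case empty
  then show ?case by auto
next
  case (insert b B)
  let ?f = "cluster_dim d e W n"
  have rec: "?f (insert b B) C \<le> max (?f B (insert b C)) (?f B C - c)"
    using insert by (intro cluster_dim_recursion[OF W]) auto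
  show ?case
  proof (cases "?f (insert b B) C = 0")
    case False
    consider "?f (insert b B) C \<le> ?f B (insert b C)" | "?f (insert b B) C \<le> ?f B C - c"
      using rec by linarith
    then show ?thesis
    proof cases
      case 1
      then have nz: "?f B (insert b C) \<noteq> 0" using False by simp
      have "B \<subseteq> {..<n}" "B \<inter> insert b C = {}" using insert by auto
      from insert.IH[OF this] nz
      obtain I where I: "I \<subseteq> B" "?f B (insert b C) + c * card (B - I) \<le> ?f {} (insert b C \<union> I)"
        by blast
      have "insert b B - insert b I = B - I" using insert.hyps by auto
      then have "?f (insert b B) C + c * card (insert b B - insert b I) \<le> ?f {} (C \<union> insert b I)"
        using I(2) 1 by simp
      then show ?thesis using I(1) by blast
    next
      case 2
      then have nz: "?f B C \<noteq> 0" "c \<le> ?f B C" using False by auto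
      have "B \<subseteq> {..<n}" "B \<inter> C = {}" using insert by auto
      from insert.IH[OF this] nz
      obtain I where I: "I \<subseteq> B" "?f B C + c * card (B - I) \<le> ?f {} (C \<union> I)"
        by blast
      have "insert b B - I = insert b (B - I)" using insert.hyps I(1) by auto
      then have "card (insert b B - I) = Suc (card (B - I))"
        using insert.hyps by simp
      then have "?f (insert b B) C + c * card (insert b B - I) \<le> ?f {} (C \<union> I)"
        using I(2) 2 nz(2) by simp
      then show ?thesis using I(1) by blast
    qed
  qed simp
qed

lemma convex_le_max_endpoints:
  fixes f :: "nat \<Rightarrow> int"
  assumes conv: "\<And>k. k + 2 \<le> n \<Longrightarrow> 2 * f (k + 1) \<le> f k + f (k + 2)" and k: "k \<le> n"
  shows "f k \<le> max (f 0) (f n)"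
proof (rule ccontr)
  assume "\<not> f k \<le> max (f 0) (f n)"
  then have less: "f 0 < f k" "f n < f k" by auto
  have "\<exists>j<k. f j < f (j + 1)"
  proof (rule ccontr)
    assume "\<not> (\<exists>j<k. f j < f (j + 1))"
    have step: "f (i + 1) \<le> f i" if "i < k" for i
      using \<open>\<not> (\<exists>j<k. f j < f (j + 1))\<close> that by (meson not_less)
    have "f i \<le> f 0" if "i \<le> k" for i
      using that
    proof (induction i)
      case (Suc i)
      then show ?case using step[of i] by simp
    qed simp
    then show False using less(1) by fastforce
  qed
  then obtain j where j: "j < k" "f j < f (j + 1)" by blast
  have incr: "f i < f (i + 1)" if "j \<le> i" "i + 1 \<le> n" for i
    using that
  proof (induction i rule: dec_induct)
    case base
    then show ?case using j by simp
  next
    case (step i)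
    then show ?case using conv[of i] by simp
  qed
  have "f k \<le> f i" if "k \<le> i" "i \<le> n" for i
    using that
  proof (induction i rule: dec_induct)
    case (step i)
    then show ?case using incr[of i] j(1) by simp
  qed simp
  then show False using less(2) k by fastforce
qed

text \<open>
  General points may be permuted, so the bound of \<open>cluster_dim_bound\<close> depends on \<open>I\<close> only through its
  cardinality. Supermodularity of dimensions makes it a convex function of the latter.
\<close>

lemma cluster_dim_endpoints:
  assumes W: "cpoly.subspace W" "W \<subseteq> cpoly.span T" "finite T" "card T + c \<le> e + 1"
  shows "cluster_dim d e W n {..<n} {} \<le>
    max (cluster_dim d e W n {} {} - c * n) (cluster_dim d e W n {} {..<n})"
proof (cases "cluster_dim d e W n {..<n} {} = 0")
  case False
  let ?f = "\<lambda>k. cluster_dim d e W n {} {..<k}"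
  define h where "h k = int (?f k) + int c * int k" for k
  obtain I where I: "I \<subseteq> {..<n}"
    "cluster_dim d e W n {..<n} {} + c * card ({..<n} - I) \<le> cluster_dim d e W n {} I"
    using cluster_dim_bound[OF W, of "{..<n}" n "{}" d] False by auto
  have cI: "card I \<le> n" using card_mono[OF _ I(1)] by simp
  have "cluster_dim d e W n {} I \<le> ?f (card I)"
    using I(1) cI by (intro cluster_dim_cong_card) auto
  moreover have "card ({..<n} - I) = n - card I"
    using I(1) by (simp add: card_Diff_subset finite_subset)
  ultimately have "cluster_dim d e W n {..<n} {} + c * (n - card I) \<le> ?f (card I)"
    using I(2) by simp
  moreover obtain l where "n = card I + l" using cI le_Suc_ex by blast
  ultimately have "cluster_dim d e W n {..<n} {} + c * n \<le> ?f (card I) + c * card I"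
    by (simp add: algebra_simps)
  then have "int (cluster_dim d e W n {..<n} {} + c * n) \<le> int (?f (card I) + c * card I)"
    by (simp only: of_nat_le_iff)
  then have "int (cluster_dim d e W n {..<n} {}) + int c * int n \<le> h (card I)"
    by (simp add: h_def)
  also have "h (card I) \<le> max (h 0) (h n)"
  proof (rule convex_le_max_endpoints[OF _ cI])
    fix k assume k: "k + 2 \<le> n"
    have s: "insert k {..<k} = {..<k + 1}" "insert k (insert (k + 1) {..<k}) = {..<k + 2}" by auto
    have "cluster_dim d e W n {} (insert k {..<k}) + cluster_dim d e W n {} (insert (k + 1) {..<k}) \<le>
      ?f k + cluster_dim d e W n {} (insert k (insert (k + 1) {..<k}))"
      by (rule cluster_dim_supermodular[OF W(1)]) auto
    moreover have "?f (k + 1) \<le> cluster_dim d e W n {} (insert (k + 1) {..<k})"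
      using k by (intro cluster_dim_cong_card) auto
    ultimately have "2 * ?f (k + 1) \<le> ?f k + ?f (k + 2)"
      unfolding s by linarith
    then have "2 * int (?f (k + 1)) \<le> int (?f k) + int (?f (k + 2))" by linarith
    then show "2 * h (k + 1) \<le> h k + h (k + 2)"
      by (simp add: h_def algebra_simps)
  qed
  finally have "int (cluster_dim d e W n {..<n} {}) + int (c * n) \<le>
      max (int (?f 0)) (int (?f n) + int (c * n))"
    by (simp add: h_def)
  then consider "int (cluster_dim d e W n {..<n} {}) + int (c * n) \<le> int (?f 0)"
    | "int (cluster_dim d e W n {..<n} {}) \<le> int (?f n)"
    by linarith
  then show ?thesis
  proof cases
    case 1
    then have "cluster_dim d e W n {..<n} {} + c * n \<le> cluster_dim d e W n {} {}"
      unfolding of_nat_add[symmetric] of_nat_le_iff lessThan_0 .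
    then show ?thesis by linarith
  qed simp
qed simp

section \<open>Contracting groups of points\<close>

lemma leading_form_pvar_power_mult:
  assumes K: "K \<in> forms e" and "e \<le> d"
  shows "leading_form e (pvar 3 ^ (d - e) * K) = leading_form e K"
proof (rule poly_eqI)
  fix i
  have "pvar 3 ^ (d - e) \<in> forms (d - e)"
    using single_in_forms[of "Poly_Mapping.single 3 (d - e)" 1] by (simp add: pvar_power)
  then have "pvar 3 ^ (d - e) * K \<in> forms ((d - e) + e)"
    using K unfolding forms_eq_homog by (rule homog_mult[of mono_deg, OF mono_deg_add])
  then have H: "pvar 3 ^ (d - e) * K \<in> forms d"
    using assms(2) by simp
  have "monomial (e - i) i (d - e) = Poly_Mapping.single 3 (d - e) + monomial (e - i) i 0"
    by (simp add: monomial_def add.commute)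
  then have "Poly_Mapping.lookup (pvar 3 ^ (d - e) * K) (monomial (e - i) i (d - e)) =
      Poly_Mapping.lookup K (monomial (e - i) i 0)"
    using lookup_single_mult[of "Poly_Mapping.single 3 (d - e)" 1 K "monomial (e - i) i 0"]
    by (simp add: pvar_power)
  then show "coeff (leading_form e (pvar 3 ^ (d - e) * K)) i = coeff (leading_form e K) i"
    by (simp add: coeff_leading_form[OF H] coeff_leading_form[OF K])
qed

text \<open>
  The points of the \<open>i\<close>-th group are the images of the points of the frames \<open>P j\<close> under the homothety with ratio \<open>t\<close>
  in the frame \<open>x i\<close>. In these coordinates the homothety multiplies the part of local degree \<open>e'\<close>
  by \<open>t ^ e'\<close>, so \<open>dim_degeneration\<close> describes the limit: each part agrees, up to parts of
  lower local degree, with a form vanishing to order \<open>m\<close> at these points. Such a form has local degree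
  at most \<open>e'\<close>, hence is a form of degree \<open>e'\<close> times a power of the third variable, and that power
  does not affect the orders, because these points do not lie on the line at infinity.
\<close>

lemma cluster_degeneration:
  assumes W: "cpoly.subspace W" and P: "\<And>j. j < k \<Longrightarrow> P j 3 3 \<noteq> 0"
    and low: "\<And>e' H. e' < e \<Longrightarrow> H \<in> forms e' \<Longrightarrow> \<forall>j<k. lsubst (P j) H \<in> ord_ge 3 m \<Longrightarrow> H = 0"
    and leading_form_W: "\<And>H. H \<in> forms e \<Longrightarrow> \<forall>j<k. lsubst (P j) H \<in> ord_ge 3 m \<Longrightarrow> leading_form e H \<in> W"
  obtains t where "tpoly.dim {F \<in> forms d. \<forall>i<n. \<forall>j<k.
      lsubst (frame_mult (frame_mult (x i) (frame_dilation t)) (P j)) F \<in> ord_ge 3 m}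
    \<le> tpoly.dim (cluster_space d e W n {..<n} {} x)"
proof -
  define W' where "W' = {G. \<forall>j<k. lsubst (P j) G \<in> ord_ge 3 m}"
  define X where "X e' = {G \<in> forms d. \<forall>t\<in>Poly_Mapping.keys G. local_deg 3 t < e'}" for e'
  define C where "C i e' F = local_part e' (lsubst (x i) F)" for i e' F
  have W'_sub: "tpoly.subspace W'"
    using subspace_ord_ge by (auto simp: W'_def tpoly.subspace_def lsubst_add lsubst_pscale)
       (simp add: lsubst_def)
  have "finite {t. t \<noteq> 0 \<and> tpoly.dim {F \<in> forms d. \<forall>i\<in>{..<n}. \<forall>e'\<le>d. \<exists>h\<in>X e'. C i e' F + h \<in> W'}
    < tpoly.dim {F \<in> forms d. \<forall>i\<in>{..<n}. (\<Sum>e'\<le>d. pscale (t ^ e') (C i e' F)) \<in> W'}}"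
  proof (rule tpoly_tpoly.dim_degeneration[OF finite_monomial_basis _ subspace_forms])
    show "forms d \<subseteq> tpoly.span (monomial_basis d)" by (simp add: forms_eq_span)
    show "Vector_Spaces.linear pscale pscale (C i e')" for i e'
      by (simp add: Vector_Spaces.linear_iff C_def lsubst_add lsubst_pscale local_part_add local_part_pscale
          tpoly.vector_space_axioms)
    show "tpoly.subspace (X e')" for e'
    proof -
      have "X e' = forms d \<inter> {G. \<forall>t. \<not> local_deg 3 t < e' \<longrightarrow> Poly_Mapping.lookup G t = 0}"
        by (auto simp: X_def in_keys_iff)
      moreover have "tpoly.subspace {G :: ternary_poly. \<forall>t. \<not> local_deg 3 t < e' \<longrightarrow> Poly_Mapping.lookup G t = 0}"
        by (auto simp: tpoly.subspace_def lookup_add)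
      ultimately show ?thesis
        using tpoly.subspace_inter[OF subspace_forms] by simp
    qed
    show "C i e\<^sub>1 F \<in> X e\<^sub>2" if "e\<^sub>1 < e\<^sub>2" "F \<in> forms d" for i e\<^sub>1 e\<^sub>2 F
      using that by (auto simp: X_def C_def in_keys_iff intro!: local_part_in_forms lsubst_in_forms split: if_splits)
  qed (rule W'_sub)
  then have "finite ({0} \<union> {t. t \<noteq> 0 \<and> tpoly.dim {F \<in> forms d. \<forall>i\<in>{..<n}. \<forall>e'\<le>d. \<exists>h\<in>X e'. C i e' F + h \<in> W'}
    < tpoly.dim {F \<in> forms d. \<forall>i\<in>{..<n}. (\<Sum>e'\<le>d. pscale (t ^ e') (C i e' F)) \<in> W'}})"
    by simp
  from ex_new_if_finite[OF infinite_UNIV_char_0 this] obtain t where t: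
    "tpoly.dim {F \<in> forms d. \<forall>i\<in>{..<n}. (\<Sum>e'\<le>d. pscale (t ^ e') (C i e' F)) \<in> W'} \<le>
     tpoly.dim {F \<in> forms d. \<forall>i\<in>{..<n}. \<forall>e'\<le>d. \<exists>h\<in>X e'. C i e' F + h \<in> W'}"
    by (auto simp: not_less)
  have "{F \<in> forms d. \<forall>i<n. \<forall>j<k. lsubst (frame_mult (frame_mult (x i) (frame_dilation t)) (P j)) F \<in> ord_ge 3 m} =
      {F \<in> forms d. \<forall>i\<in>{..<n}. (\<Sum>e'\<le>d. pscale (t ^ e') (C i e' F)) \<in> W'}"
  proof -
    have "(\<Sum>e'\<le>d. pscale (t ^ e') (C i e' F)) \<in> W' \<longleftrightarrow>
      (\<forall>j<k. lsubst (frame_mult (frame_mult (x i) (frame_dilation t)) (P j)) F \<in> ord_ge 3 m)" if "F \<in> forms d" for i F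
      unfolding C_def lsubst_frame_dilation[OF lsubst_in_forms[OF that], symmetric]
      by (simp add: W'_def lsubst_lsubst)
    then show ?thesis by auto
  qed
  moreover have "{F \<in> forms d. \<forall>i\<in>{..<n}. \<forall>e'\<le>d. \<exists>h\<in>X e'. C i e' F + h \<in> W'} \<subseteq>
      cluster_space d e W n {..<n} {} x"
  proof
    fix F assume "F \<in> {F \<in> forms d. \<forall>i\<in>{..<n}. \<forall>e'\<le>d. \<exists>h\<in>X e'. C i e' F + h \<in> W'}"
    then have F: "F \<in> forms d" "\<And>i e'. i < n \<Longrightarrow> e' \<le> d \<Longrightarrow> \<exists>h\<in>X e'. C i e' F + h \<in> W'"
      by auto
    have "lsubst (x i) F \<in> ord_ge 3 e \<and> leading_form e (lsubst (x i) F) \<in> W" if i: "i < n" for i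
    proof -
      let ?G = "lsubst (x i) F"
      have G: "?G \<in> forms d" using F(1) by (rule lsubst_in_forms)
      have high: "local_part e' ?G = 0" if "\<not> e' \<le> d" for e'
      proof (rule poly_mapping_eqI)
        fix u
        show "Poly_Mapping.lookup (local_part e' ?G) u = Poly_Mapping.lookup 0 u"
          using lookup_eq_0_if_homog[OF G[unfolded forms_eq_homog], of u] that mono_deg_local_deg[of u 3]
          by auto
      qed
      have key: "\<exists>K\<in>forms e'. (\<forall>j<k. lsubst (P j) K \<in> ord_ge 3 m) \<and>
        local_part e' ?G = local_part e' (pvar 3 ^ (d - e') * K)" if e': "e' \<le> d" for e'
      proof -
        obtain h where h: "h \<in> X e'" "C i e' F + h \<in> W'"
          using F(2)[OF i e'] by blast
        let ?H = "C i e' F + h"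
        have H: "?H \<in> forms d"
          using h(1) G by (auto simp: X_def C_def intro!: tpoly.subspace_add[OF subspace_forms] local_part_in_forms)
        have wH: "local_part e' ?H = local_part e' ?G"
          using h(1) by (intro poly_mapping_eqI) (auto simp: C_def X_def lookup_add in_keys_iff)
        have "local_deg 3 u \<le> e'" if "u \<in> Poly_Mapping.keys ?H" for u
        proof -
          have "u \<in> Poly_Mapping.keys (C i e' F) \<or> u \<in> Poly_Mapping.keys h"
            using that keys_add[of "C i e' F" h] by auto
          moreover have "local_deg 3 u = e'" if "u \<in> Poly_Mapping.keys (C i e' F)"
            using that by (auto simp: C_def in_keys_iff split: if_splits)
          moreover have "local_deg 3 u < e'" if "u \<in> Poly_Mapping.keys h"
            using h(1) that by (simp add: X_def)
          ultimately show ?thesis by fastforce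
        qed
        then obtain K where K: "K \<in> forms e'" "?H = pvar 3 ^ (d - e') * K"
          using dehomogenize[OF H e'] by blast
        have "lsubst (P j) K \<in> ord_ge 3 m" if "j < k" for j
        proof (rule ord_ge_cancel_unit_power)
          have "lsubst (P j) ?H = linear_form (P j) 3 ^ (d - e') * lsubst (P j) K"
            by (simp add: K(2) lsubst_def psubst_mult psubst_power)
          then show "linear_form (P j) 3 ^ (d - e') * lsubst (P j) K \<in> ord_ge 3 m"
            using h(2) that by (auto simp: W'_def)
        qed (rule P[OF that])
        then show ?thesis
          using K wH by metis
      qed
      have "local_part e' ?G = 0" if "e' < e" for e'
      proof (cases "e' \<le> d")
        case True
        then obtain K where K: "K \<in> forms e'" "\<forall>j<k. lsubst (P j) K \<in> ord_ge 3 m"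
          "local_part e' ?G = local_part e' (pvar 3 ^ (d - e') * K)"
          using key by blast
        then have "K = 0" using low that by blast
        then show ?thesis using K(3) by (simp add: local_part_def)
      qed (rule high)
      then have "?G \<in> ord_ge 3 e" by (simp add: ord_ge_iff_local_part)
      moreover have "leading_form e ?G \<in> W"
      proof (cases "e \<le> d")
        case True
        then obtain K where K: "K \<in> forms e" "\<forall>j<k. lsubst (P j) K \<in> ord_ge 3 m"
          "local_part e ?G = local_part e (pvar 3 ^ (d - e) * K)"
          using key by blast
        then have "leading_form e ?G = leading_form e K"
          using leading_form_pvar_power_mult[OF K(1) True] by (simp add: leading_form_def)
        then show ?thesis using leading_form_W K by simp
      next
        case False
        then have "leading_form e ?G = 0" using high by (simp add: leading_form_def)
        then show ?thesis using cpoly.subspace_0[OF W] by simp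
      qed
      ultimately show ?thesis by blast
    qed
    then show "F \<in> cluster_space d e W n {..<n} {} x"
      using F(1) by (auto simp: cluster_space_def)
  qed
  then have "tpoly.dim {F \<in> forms d. \<forall>i\<in>{..<n}. \<forall>e'\<le>d. \<exists>h\<in>X e'. C i e' F + h \<in> W'} \<le>
      tpoly.dim (cluster_space d e W n {..<n} {} x)"
    by (rule tpoly.dim_mono_finite[OF finite_monomial_basis cluster_space_subset_span])
  ultimately show ?thesis using t that[of t] by simp
qed

section \<open>From frames to points of the plane\<close>

definition points_space :: "nat \<Rightarrow> nat \<Rightarrow> nat \<Rightarrow> (nat \<Rightarrow> frame) \<Rightarrow> ternary_poly set" where
  "points_space d m n x = {F \<in> forms d. \<forall>i<n. lsubst (x i) F \<in> ord_ge 3 m}"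

text \<open>
  The standard affine chart centred at the point \<open>v\<close>, as a linear substitution: the \<open>k\<close>-th coordinate
  point goes to \<open>v\<close>, normalised to have \<open>k\<close>-th coordinate \<open>1\<close>.
\<close>

definition chart :: "3 \<Rightarrow> complex ^ 3 \<Rightarrow> frame" where
  "chart k v i j = (if j = k then v $ i / v $ k else if i = j then 1 else 0)"

lemma pconst_1: "pconst 1 = 1"
  by (simp add: pconst_def)

lemma taylor_eq_chart:
  assumes "v $ k \<noteq> 0"
  shows "taylor k v F = psubst (\<lambda>i. if i = k then 1 else pvar i) (lsubst (chart k v) F)"
proof -
  have "psubst (\<lambda>i. if i = k then 1 else pvar i) (linear_form (chart k v) i) =
    (if i = k then 1 else pconst (v $ i / v $ k) + pvar i)" for i
  proof -
    have "psubst (\<lambda>i. if i = k then 1 else pvar i) (linear_form (chart k v) i) =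
      (\<Sum>j\<in>UNIV. pscale (chart k v i j) (if j = k then 1 else pvar j))"
      by (simp add: linear_form_def psubst_sum psubst_pscale)
    also have "\<dots> = pscale (v $ i / v $ k) 1 + (\<Sum>j\<in>UNIV - {k}. pscale (if i = j then 1 else 0) (pvar j))"
      by (subst sum.remove[of _ k]) (auto simp: chart_def intro!: sum.cong)
    also have "(\<Sum>j\<in>UNIV - {k}. pscale (if i = j then 1 else 0) (pvar j)) =
      (\<Sum>j\<in>UNIV - {k}. if j = i then pvar i else 0)"
      by (rule sum.cong) auto
    also have "\<dots> = (if i = k then 0 else pvar i)"
      by (auto simp: sum.delta)
    finally show ?thesis
      using assms by (auto simp: pscale_conv_mult pconst_1)
  qed
  then show ?thesis
    unfolding taylor_def lsubst_def psubst_psubst by presburger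
qed

definition drop_var :: "3 \<Rightarrow> (3 \<Rightarrow>\<^sub>0 nat) \<Rightarrow> 3 \<Rightarrow>\<^sub>0 nat" where
  "drop_var k t = t - Poly_Mapping.single k (Poly_Mapping.lookup t k)"

lemma lookup_drop_var: "Poly_Mapping.lookup (drop_var k t) i = (if i = k then 0 else Poly_Mapping.lookup t i)"
  by (simp add: drop_var_def lookup_minus lookup_single when_def)

lemma mono_deg_drop_var: "mono_deg (drop_var k t) = local_deg k t"
  unfolding mono_deg_local_deg[of _ k] by (simp add: lookup_drop_var local_deg_def)

lemma drop_var_inj:
  assumes "drop_var k s = drop_var k t" "mono_deg s = mono_deg t"
  shows "s = t"
proof (rule poly_mapping_eqI)
  fix i
  have "local_deg k s = local_deg k t"
    using assms(1) by (metis mono_deg_drop_var)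
  then have "Poly_Mapping.lookup s k = Poly_Mapping.lookup t k"
    using assms(2) mono_deg_local_deg[of s k] mono_deg_local_deg[of t k] by simp
  then show "Poly_Mapping.lookup s i = Poly_Mapping.lookup t i"
    using arg_cong[OF assms(1), of "\<lambda>u. Poly_Mapping.lookup u i"]
    by (auto simp: lookup_drop_var split: if_splits)
qed

lemma lookup_psubst_drop_var:
  "Poly_Mapping.lookup (psubst (\<lambda>i. if i = k then 1 else pvar i) G) u =
    (\<Sum>t\<in>Poly_Mapping.keys G. if drop_var k t = u then Poly_Mapping.lookup G t else 0)"
proof -
  have "mon_eval (\<lambda>i. if i = k then 1 else pvar i) t = Poly_Mapping.single (drop_var k t) 1" for t
  proof -
    have "mon_eval (\<lambda>i. if i = k then 1 else pvar i) t = mon_eval pvar (drop_var k t)"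
      unfolding mon_eval_def by (rule prod.cong) (auto simp: lookup_drop_var)
    then show ?thesis by (simp add: mon_eval_pvar)
  qed
  then show ?thesis
    by (simp add: psubst_superset[of "Poly_Mapping.keys G"] lookup_sum lookup_single when_def if_distrib cong: if_cong)
qed

text \<open>
  Setting the \<open>k\<close>-th variable to \<open>1\<close> loses no information on forms of a given degree, since the
  exponent of that variable can be recovered.
\<close>

lemma dehomogenized_order_iff:
  assumes G: "G \<in> forms d"
  shows "(\<forall>u. mono_deg u < m \<longrightarrow>
      Poly_Mapping.lookup (psubst (\<lambda>i. if i = k then 1 else pvar i) G) u = 0) \<longleftrightarrow> G \<in> ord_ge k m"
proof
  assume L: "\<forall>u. mono_deg u < m \<longrightarrow>
      Poly_Mapping.lookup (psubst (\<lambda>i. if i = k then 1 else pvar i) G) u = 0"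
  show "G \<in> ord_ge k m"
    unfolding ord_ge_def
  proof (intro CollectI ballI, rule ccontr)
    fix t assume t: "t \<in> Poly_Mapping.keys G" "\<not> m \<le> local_deg k t"
    have "drop_var k s = drop_var k t \<longleftrightarrow> s = t" if "s \<in> Poly_Mapping.keys G" for s
      using drop_var_inj[of k s t] that t(1) G by (auto simp: forms_def)
    then have "(\<Sum>s\<in>Poly_Mapping.keys G. if drop_var k s = drop_var k t then Poly_Mapping.lookup G s else 0) =
      (\<Sum>s\<in>Poly_Mapping.keys G. if s = t then Poly_Mapping.lookup G s else 0)"
      by (intro sum.cong) auto
    then have "Poly_Mapping.lookup G t = 0"
      using L[rule_format, of "drop_var k t"] t
      by (simp add: lookup_psubst_drop_var mono_deg_drop_var sum.delta)
    then show False using t(1) by (simp add: in_keys_iff)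
  qed
next
  assume R: "G \<in> ord_ge k m"
  show "\<forall>u. mono_deg u < m \<longrightarrow>
      Poly_Mapping.lookup (psubst (\<lambda>i. if i = k then 1 else pvar i) G) u = 0"
  proof (intro allI impI)
    fix u assume u: "mono_deg u < m"
    have "drop_var k t \<noteq> u" if "t \<in> Poly_Mapping.keys G" for t
      using R that u mono_deg_drop_var[of k t] by (force simp: ord_ge_def)
    then show "Poly_Mapping.lookup (psubst (\<lambda>i. if i = k then 1 else pvar i) G) u = 0"
      unfolding lookup_psubst_drop_var by (intro sum.neutral) auto
  qed
qed

lemma proportional_self: "v \<noteq> 0 \<Longrightarrow> proportional v v"
  by (auto simp: proportional_def intro: exI[of _ 1])

lemma vanishes_to_order_iff:
  assumes F: "F \<in> forms d" and v: "v \<noteq> 0"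
  shows "vanishes_to_order m F (abs_proj_plane v) \<longleftrightarrow>
    (\<forall>k. v $ k \<noteq> 0 \<longrightarrow> lsubst (chart k v) F \<in> ord_ge k m)"
proof -
  have "(\<forall>t. mono_deg t < m \<longrightarrow> Poly_Mapping.lookup (taylor k v F) t = 0) \<longleftrightarrow>
    lsubst (chart k v) F \<in> ord_ge k m" if "v $ k \<noteq> 0" for k
    unfolding taylor_eq_chart[OF that] by (rule dehomogenized_order_iff[OF lsubst_in_forms[OF F]])
  then show ?thesis
    unfolding vanishes_to_order.abs_eq[OF proportional_self[OF v]] by blast
qed

text \<open>
  The matrix \<open>M\<close> is the product of the chart and the matrix \<open>B\<close>, the inverse of the chart times \<open>M\<close>.
  Both \<open>M\<close> and the chart send a coordinate point to \<open>v\<close>, so \<open>B\<close> sends one coordinate point to the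
  other, and \<open>lsubst_ord_ge\<close> applies to it.
\<close>

lemma ord_ge_change_frame:
  assumes ord: "lsubst (chart k v) F \<in> ord_ge k m" and k: "v $ k \<noteq> 0"
    and M: "\<And>i. M i l = c * v $ i"
  shows "lsubst M F \<in> ord_ge l m"
proof -
  define B where "B i j = (if i = k then M k j else M i j - v $ i / v $ k * M k j)" for i j
  have "frame_mult (chart k v) B = M"
  proof (intro ext)
    fix i j
    have "(\<Sum>a\<in>UNIV - {k}. chart k v i a * B a j) = (\<Sum>a\<in>UNIV - {k}. if a = i then B i j else 0)"
      by (rule sum.cong) (auto simp: chart_def)
    then have "frame_mult (chart k v) B i j =
        v $ i / v $ k * M k j + (\<Sum>a\<in>UNIV - {k}. if a = i then B i j else 0)"
      unfolding frame_mult_def by (subst sum.remove[of _ k]) (simp_all add: chart_def B_def)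
    also have "\<dots> = M i j"
      using k by (cases "i = k") (auto simp: sum.delta B_def)
    finally show "frame_mult (chart k v) B i j = M i j" .
  qed
  then have "lsubst M F = lsubst B (lsubst (chart k v) F)"
    by (simp add: lsubst_lsubst)
  also have "\<dots> \<in> ord_ge l m"
    using k by (intro lsubst_ord_ge[OF ord]) (auto simp: B_def M)
  finally show ?thesis .
qed

lemma exists_frame_at:
  assumes v: "v \<noteq> 0"
  obtains M where "\<And>F d m. F \<in> forms d \<Longrightarrow> lsubst M F \<in> ord_ge 3 m \<Longrightarrow>
    vanishes_to_order m F (abs_proj_plane v)"
proof -
  obtain k where k: "v $ k \<noteq> 0"
    using v by (auto simp: vec_eq_iff)
  (* the k-th chart, with its columns permuted and rescaled so that v comes last *)
  define M :: frame where "M i j = (if j = 3 then v $ i else if j = k then (if i = 3 then 1 else 0)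
      else if i = j then 1 else 0)" for i j
  define S :: frame where "S a b = (if b = k then (if a = 3 then 1 / v $ k else 0)
      else if b = 3 then (if a = k then 1 else 0) else if a = b then 1 else 0)" for a b
  have MS: "frame_mult M S = chart k v"
  proof (intro ext)
    fix i b
    have "frame_mult M S i b = (\<Sum>a\<in>UNIV. if a = (if b = k then 3 else if b = 3 then k else b)
        then M i a * (if b = k then 1 / v $ k else 1) else 0)"
      unfolding frame_mult_def by (rule sum.cong) (auto simp: S_def)
    also have "\<dots> = chart k v i b"
      by (auto simp: M_def chart_def)
    finally show "frame_mult M S i b = chart k v i b" .
  qed
  show ?thesis
  proof (rule that[of M])
    fix F d m assume F: "F \<in> forms d" and ord: "lsubst M F \<in> ord_ge 3 m"
    have "lsubst S (lsubst M F) \<in> ord_ge k m"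
      by (rule lsubst_ord_ge[OF ord]) (auto simp: S_def)
    then have chart_k: "lsubst (chart k v) F \<in> ord_ge k m"
      by (simp add: lsubst_lsubst MS)
    have "lsubst (chart l v) F \<in> ord_ge l m" if "v $ l \<noteq> 0" for l
      by (rule ord_ge_change_frame[OF chart_k k, of _ _ "1 / v $ l"]) (simp add: chart_def)
    then show "vanishes_to_order m F (abs_proj_plane v)"
      unfolding vanishes_to_order_iff[OF F v] by blast
  qed
qed

lemma ord_ge_if_vanishes:
  assumes F: "F \<in> forms d" and v: "v \<noteq> 0" "\<And>i. M i 3 = v $ i"
    and vanish: "vanishes_to_order m F (abs_proj_plane v)"
  shows "lsubst M F \<in> ord_ge 3 m"
proof -
  obtain k where k: "v $ k \<noteq> 0"
    using v by (auto simp: vec_eq_iff)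
  then have "lsubst (chart k v) F \<in> ord_ge k m"
    using vanish unfolding vanishes_to_order_iff[OF F v(1)] by blast
  then show ?thesis
    using k v(2) by (intro ord_ge_change_frame[of k v F m M 3 1]) auto
qed

lemma proj_plane_representative:
  obtains v where "v \<noteq> 0" "abs_proj_plane v = q"
proof -
  have "proportional (rep_proj_plane q) (rep_proj_plane q)"
    by (rule Quotient3_rep_reflp[OF Quotient3_proj_plane])
  then show ?thesis
    using that Quotient3_abs_rep[OF Quotient3_proj_plane] by (auto simp: proportional_def)
qed

lemma abs_proj_plane_eqD:
  assumes "v \<noteq> 0" "w \<noteq> 0" "abs_proj_plane v = abs_proj_plane w"
  shows "v $ i * w $ j = w $ i * v $ j"
proof -
  have "proportional v w"
    using Quotient3_rel[OF Quotient3_proj_plane] assms proportional_self by metis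
  then show ?thesis by (auto simp: proportional_def)
qed

text \<open>The number of conditions imposed by a point of multiplicity \<open>k\<close>.\<close>

definition triangular :: "nat \<Rightarrow> nat" where
  "triangular k = k * (k + 1) div 2"

lemma triangular_Suc: "triangular (Suc k) = triangular k + Suc k"
  unfolding triangular_def by simp

lemma triangular_mono: "k \<le> l \<Longrightarrow> triangular k \<le> triangular l"
  unfolding triangular_def by (intro div_le_mono mult_le_mono) auto

lemma exists_triangular_bracket: "\<exists>e. triangular e \<le> N \<and> N < triangular (Suc e)"
proof (induction N)
  case 0
  show ?case by (rule exI[of _ 0]) (simp add: triangular_def)
next
  case (Suc N)
  then obtain e where e: "triangular e \<le> N" "N < triangular (Suc e)" by blast
  show ?case
  proof (cases "Suc N < triangular (Suc e)")
    case True
    then show ?thesis using e by (intro exI[of _ e]) simp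
  next
    case False
    then show ?thesis using e triangular_Suc[of "Suc e"] by (intro exI[of _ "Suc e"]) simp
  qed
qed

lemma expected_dim_eq:
  "expected_dim d m n + 1 = max 0 (int (triangular (d + 1)) - int n * int (triangular m))"
proof -
  have "int d * (int d + 3) div 2 + 1 = (int d * (int d + 3) + 2) div 2" by simp
  also have "int d * (int d + 3) + 2 = (int d + 1) * (int d + 2)" by (simp add: algebra_simps)
  finally have "int d * (int d + 3) div 2 + 1 = int (triangular (d + 1))"
    by (simp add: triangular_def zdiv_int algebra_simps)
  moreover have "int m * (int m + 1) div 2 = int (triangular m)"
    by (simp add: triangular_def zdiv_int algebra_simps)
  ultimately show ?thesis
    by (simp add: expected_dim_def virtual_dim_def)
qed

lemma points_space_subset_span: "points_space d m n x \<subseteq> tpoly.span (monomial_basis d)"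
  by (auto simp: points_space_def forms_eq_span)

lemma system_space_subset_span: "system_space d m n q \<subseteq> tpoly.span (monomial_basis d)"
  by (auto simp: system_space_def forms_eq_span)

lemma points_space_eq_cluster_space: "points_space d m n x = cluster_space d m UNIV n {} {} x"
  by (simp add: points_space_def cluster_space_def)

lemma dim_points_space_ge:
  "int (triangular (d + 1)) - int n * int (triangular m) \<le> int (tpoly.dim (points_space d m n x))"
proof -
  let ?T = "{t. mono_deg t = d \<and> local_deg 3 t < m}"
  let ?I = "{..<n} \<times> ?T"
  let ?f = "\<lambda>(i, t) F. Poly_Mapping.lookup (lsubst (x i) F) t"
  have "tpoly.dim (forms d) \<le> tpoly.dim {F \<in> forms d. \<forall>r\<in>?I. ?f r F = 0} + card ?I"
    using card_monomials_of_low_weight(1)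
    by (intro tpoly.dim_cut[OF finite_monomial_basis[of d]])
       (auto simp: forms_eq_span functional_lookup_lsubst tpoly.subspace_span)
  moreover have eq: "{F \<in> forms d. \<forall>r\<in>?I. ?f r F = 0} = points_space d m n x"
  proof -
    have "lsubst (x i) F \<in> ord_ge 3 m \<longleftrightarrow> (\<forall>t\<in>?T. Poly_Mapping.lookup (lsubst (x i) F) t = 0)"
      if "F \<in> forms d" for i F
      using lookup_eq_0_if_homog[OF lsubst_in_forms[OF that, unfolded forms_eq_homog]]
      by (auto simp: ord_ge_iff)
    then show ?thesis by (auto simp: points_space_def)
  qed
  moreover have "card ?I \<le> n * triangular m"
    using card_monomials_of_low_weight(2)[of d m] by (simp add: card_cartesian_product triangular_def)
  moreover have "tpoly.dim (forms d) = triangular (d + 1)"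
    by (simp add: dim_forms triangular_def)
  ultimately have "triangular (d + 1) \<le> tpoly.dim (points_space d m n x) + n * triangular m"
    unfolding eq by linarith
  then have "int (triangular (d + 1)) \<le> int (tpoly.dim (points_space d m n x) + n * triangular m)"
    by (simp only: of_nat_le_iff)
  then show ?thesis by simp
qed

lemma exists_frames_at:
  obtains x where "points_space d m n x \<subseteq> system_space d m n q"
proof -
  have "\<exists>M. \<forall>F\<in>forms d. lsubst M F \<in> ord_ge 3 m \<longrightarrow> vanishes_to_order m F (q i)" for i
  proof -
    obtain v where v: "v \<noteq> 0" "abs_proj_plane v = q i" by (rule proj_plane_representative)
    obtain M where "\<And>F d m. F \<in> forms d \<Longrightarrow> lsubst M F \<in> ord_ge 3 m \<Longrightarrow>
      vanishes_to_order m F (abs_proj_plane v)"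
      using exists_frame_at[OF v(1)] by metis
    then show ?thesis using v(2) by auto
  qed
  then obtain x where "\<And>i F. F \<in> forms d \<Longrightarrow> lsubst (x i) F \<in> ord_ge 3 m \<Longrightarrow> vanishes_to_order m F (q i)"
    by metis
  then have "points_space d m n x \<subseteq> system_space d m n q"
    by (auto simp: points_space_def system_space_def)
  then show ?thesis by (rule that)
qed

text \<open>
  The given frames may describe coinciding points, or no point at all if a last column is zero. But
  small dimension is a generic property, and so is describing distinct affine points.
\<close>

lemma exists_distinct_points:
  assumes "tpoly.dim (points_space d m n x) \<le> k"
  obtains q where "inj_on q {..<n}" "tpoly.dim (system_space d m n q) \<le> k"
proof -
  have UNIV: "cpoly.subspace UNIV" by (simp add: cpoly.subspace_def)
  have "generic {x. tpoly.dim (points_space d m n x) \<le> k}"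
    unfolding points_space_eq_cluster_space
    using assms by (intro generic_cluster_space[OF UNIV, of d m n "{}" "{}" x]) (simp add: points_space_eq_cluster_space)
  moreover have "generic (\<Inter>i\<in>{..<n}. {x. x i 3 3 \<noteq> 0})"
    by (intro generic_INT generic_nonzero[of _ "\<lambda>_ _ _. 1"]) auto
  moreover have "generic (\<Inter>(i, j)\<in>{(i, j). i < n \<and> j < n \<and> i \<noteq> j}.
      {x. x i 1 3 * x j 3 3 - x j 1 3 * x i 3 3 \<noteq> 0})"
  proof (intro generic_INT)
    show "finite {(i, j). i < n \<and> j < n \<and> i \<noteq> j}"
      by (rule finite_subset[of _ "{..<n} \<times> {..<n}"]) auto
    fix ij assume "ij \<in> {(i, j). i < n \<and> j < n \<and> i \<noteq> j}"
    then obtain i j where ij: "ij = (i, j)" "i \<noteq> j" by auto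
    have "generic {x. x i 1 3 * x j 3 3 - x j 1 3 * x i 3 3 \<noteq> 0}"
      using ij(2)
      by (intro generic_nonzero[where x\<^sub>0 = "\<lambda>i a b. if a = 1 then of_nat i else 1"])
         (auto intro!: poly_on_lines_diff poly_on_lines_mult)
    then show "generic (case ij of (i, j) \<Rightarrow> {x. x i 1 3 * x j 3 3 - x j 1 3 * x i 3 3 \<noteq> 0})"
      by (simp add: ij(1))
  qed
  ultimately have "generic ({x. tpoly.dim (points_space d m n x) \<le> k} \<inter> (\<Inter>i\<in>{..<n}. {x. x i 3 3 \<noteq> 0}) \<inter>
    (\<Inter>(i, j)\<in>{(i, j). i < n \<and> j < n \<and> i \<noteq> j}. {x. x i 1 3 * x j 3 3 - x j 1 3 * x i 3 3 \<noteq> 0}))"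
    by (intro generic_Int)
  then obtain y where y_in: "y \<in> {x. tpoly.dim (points_space d m n x) \<le> k} \<inter> (\<Inter>i\<in>{..<n}. {x. x i 3 3 \<noteq> 0}) \<inter>
    (\<Inter>(i, j)\<in>{(i, j). i < n \<and> j < n \<and> i \<noteq> j}. {x. x i 1 3 * x j 3 3 - x j 1 3 * x i 3 3 \<noteq> 0})"
    using generic_imp_nonempty by blast
  have y: "tpoly.dim (points_space d m n y) \<le> k" "\<And>i. i < n \<Longrightarrow> y i 3 3 \<noteq> 0"
    "\<And>i j. i < n \<Longrightarrow> j < n \<Longrightarrow> i \<noteq> j \<Longrightarrow> y i 1 3 * y j 3 3 \<noteq> y j 1 3 * y i 3 3"
    using y_in by auto
  define v where "v i = (\<chi> a. y i a 3)" for i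
  have v0: "v i \<noteq> 0" if "i < n" for i
    using y(2)[OF that] by (auto simp: v_def vec_eq_iff)
  define q where "q i = abs_proj_plane (v i)" for i
  have "inj_on q {..<n}"
  proof (rule inj_onI, rule ccontr)
    fix i j assume ij: "i \<in> {..<n}" "j \<in> {..<n}" "q i = q j" "i \<noteq> j"
    then have "v i $ 1 * v j $ 3 = v j $ 1 * v i $ 3"
      using v0 by (intro abs_proj_plane_eqD) (auto simp: q_def)
    then show False using y(3)[of i j] ij by (simp add: v_def)
  qed
  moreover have "system_space d m n q \<subseteq> points_space d m n y"
    using ord_ge_if_vanishes[OF _ v0] by (auto simp: system_space_def points_space_def q_def v_def)
  then have "tpoly.dim (system_space d m n q) \<le> k"
    using tpoly.dim_mono_finite[OF finite_monomial_basis points_space_subset_span] y(1) le_trans by blast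
  ultimately show ?thesis by (rule that)
qed

lemma general_dim_attained:
  obtains q where "general_dim d m n = int (tpoly.dim (system_space d m n q)) - 1"
proof -
  (* degree and multiplicity are arbitrary here: the point is that n distinct points exist *)
  obtain q where q: "inj_on q {..<n}"
    "tpoly.dim (system_space 0 0 n q) \<le> tpoly.dim (points_space 0 0 n (\<lambda>_. frame_one))"
    by (rule exists_distinct_points[OF order_refl])
  have "\<exists>l q. inj_on q {..<n} \<and> l = tpoly.dim (system_space d m n q)"
    using q(1) by blast
  from LeastI_ex[OF this] show ?thesis
    using that by (auto simp: general_dim_def)
qed

lemma non_special_imp_frames:
  assumes "non_special d m n"
  obtains x where "int (tpoly.dim (points_space d m n x)) \<le>
    max 0 (int (triangular (d + 1)) - int n * int (triangular m))"
proof -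
  obtain q where q: "general_dim d m n = int (tpoly.dim (system_space d m n q)) - 1"
    by (rule general_dim_attained)
  obtain x where "points_space d m n x \<subseteq> system_space d m n q"
    by (rule exists_frames_at)
  then have "tpoly.dim (points_space d m n x) \<le> tpoly.dim (system_space d m n q)"
    by (rule tpoly.dim_mono_finite[OF finite_monomial_basis system_space_subset_span])
  then show ?thesis
    using that[of x] q assms expected_dim_eq[of d m n] by (simp add: non_special_def)
qed

text \<open>
  A single choice of frames that satisfies the upper bound suffices: distinct points satisfying it
  exist by genericity, and the lower bound holds for all points by counting conditions.
\<close>

lemma frames_imp_non_special:
  assumes "int (tpoly.dim (points_space d m n x)) \<le>
    max 0 (int (triangular (d + 1)) - int n * int (triangular m))"
  shows "non_special d m n"
proof -
  obtain q where q: "inj_on q {..<n}"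
    "tpoly.dim (system_space d m n q) \<le> tpoly.dim (points_space d m n x)"
    by (rule exists_distinct_points[OF order_refl])
  have "(LEAST l. \<exists>q. inj_on q {..<n} \<and> l = tpoly.dim (system_space d m n q)) \<le>
      tpoly.dim (system_space d m n q)"
    using q(1) by (intro Least_le) blast
  then have upper: "general_dim d m n + 1 \<le> max 0 (int (triangular (d + 1)) - int n * int (triangular m))"
    using q(2) assms by (simp add: general_dim_def)
  obtain q' where q': "general_dim d m n = int (tpoly.dim (system_space d m n q')) - 1"
    by (rule general_dim_attained)
  obtain y where "points_space d m n y \<subseteq> system_space d m n q'"
    by (rule exists_frames_at)
  then have "tpoly.dim (points_space d m n y) \<le> tpoly.dim (system_space d m n q')"
    by (rule tpoly.dim_mono_finite[OF finite_monomial_basis system_space_subset_span])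
  then have "max 0 (int (triangular (d + 1)) - int n * int (triangular m)) \<le> general_dim d m n + 1"
    using dim_points_space_ge[of d n m y] q' by simp
  then show ?thesis
    using upper expected_dim_eq[of d m n] unfolding non_special_def by linarith
qed

lemma points_space_trivial:
  assumes "tpoly.dim (points_space d m n x) = 0" "F \<in> points_space d m n x"
  shows "F = 0"
proof -
  obtain C where C: "finite C" "C \<subseteq> points_space d m n x" "tpoly.independent C"
    "points_space d m n x \<subseteq> tpoly.span C" "card C = tpoly.dim (points_space d m n x)"
    by (rule tpoly.finite_basis_of[OF finite_monomial_basis points_space_subset_span])
  then show ?thesis using assms by auto
qed

lemma subspace_points_space: "tpoly.subspace (points_space d m n x)"
  unfolding points_space_eq_cluster_space
  by (rule subspace_cluster_space) (simp add: cpoly.subspace_def)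

section \<open>Products of numbers of points\<close>

text \<open>
  One general group of points has to realise the generic dimension in all degrees up to \<open>e\<close> at the
  same time, and must avoid the line at infinity.
\<close>

lemma exists_collapsing_group:
  assumes nonspec: "\<And>e. non_special e m n" and e: "triangular e \<le> n * triangular m" "n * triangular m < triangular (Suc e)"
  obtains P where "\<And>j. j < n \<Longrightarrow> P j 3 3 \<noteq> 0" "\<And>e'. e' < e \<Longrightarrow> tpoly.dim (points_space e' m n P) = 0"
    "tpoly.dim (points_space e m n P) + n * triangular m \<le> triangular (Suc e)"
proof -
  have UNIV: "cpoly.subspace UNIV" by (simp add: cpoly.subspace_def)
  let ?b = "\<lambda>e'. max 0 (int (triangular (e' + 1)) - int n * int (triangular m))"
  have "generic {x. int (tpoly.dim (points_space e' m n x)) \<le> ?b e'}" for e'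
  proof -
    obtain x where "int (tpoly.dim (points_space e' m n x)) \<le> ?b e'"
      by (rule non_special_imp_frames[OF nonspec])
    then have "generic {x. tpoly.dim (points_space e' m n x) \<le> nat (?b e')}"
      unfolding points_space_eq_cluster_space by (intro generic_cluster_space[OF UNIV, of _ _ _ _ _ x]) linarith
    moreover have "{x. tpoly.dim (points_space e' m n x) \<le> nat (?b e')} =
        {x. int (tpoly.dim (points_space e' m n x)) \<le> ?b e'}"
      by (rule Collect_cong) linarith
    ultimately show ?thesis by simp
  qed
  then have "generic (\<Inter>e'\<in>{..e}. {x. int (tpoly.dim (points_space e' m n x)) \<le> ?b e'})"
    by (intro generic_INT) auto
  moreover have "generic (\<Inter>i\<in>{..<n}. {x. x i 3 3 \<noteq> 0})"
    by (intro generic_INT generic_nonzero[of _ "\<lambda>_ _ _. 1"]) auto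
  ultimately have "generic ((\<Inter>e'\<in>{..e}. {x. int (tpoly.dim (points_space e' m n x)) \<le> ?b e'}) \<inter>
      (\<Inter>i\<in>{..<n}. {x. x i 3 3 \<noteq> 0}))"
    by (rule generic_Int)
  then obtain P where P_in: "P \<in> (\<Inter>e'\<in>{..e}. {x. int (tpoly.dim (points_space e' m n x)) \<le> ?b e'}) \<inter>
      (\<Inter>i\<in>{..<n}. {x. x i 3 3 \<noteq> 0})"
    using generic_imp_nonempty by blast
  have P: "int (tpoly.dim (points_space e' m n P)) \<le> ?b e'" if "e' \<le> e" for e'
    using P_in that by simp
  have P33: "P j 3 3 \<noteq> 0" if "j < n" for j
    using P_in that by simp
  have bound: "tpoly.dim (points_space e' m n P) \<le> triangular (e' + 1) - n * triangular m" if "e' \<le> e" for e'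
  proof -
    define K where "K = n * triangular m"
    have "int n * int (triangular m) = int K"
      by (simp add: K_def)
    then have "tpoly.dim (points_space e' m n P) \<le> triangular (e' + 1) - K"
      using P[OF that] by linarith
    then show ?thesis by (simp add: K_def)
  qed
  show ?thesis
  proof (rule that[of P])
    show "P j 3 3 \<noteq> 0" if "j < n" for j
      using P33 that .
  next
    fix e' assume "e' < e"
    then show "tpoly.dim (points_space e' m n P) = 0"
      using bound[of e'] e(1) triangular_mono[of "e' + 1" e] by simp
  next
    show "tpoly.dim (points_space e m n P) + n * triangular m \<le> triangular (Suc e)"
      using bound[of e] e(2) by simp
  qed
qed

theorem theorem1:
  fixes n1 n2 :: nat
  assumes "n1 \<ge> 1" and "n2 \<ge> 1"
    and "\<And>d m :: nat. m \<ge> 1 \<Longrightarrow> non_special d m n1"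
    and "\<And>d m :: nat. m \<ge> 1 \<Longrightarrow> non_special d m n2"
  shows "\<forall>d m :: nat. m \<ge> 1 \<longrightarrow> non_special d m (n1 * n2)"
proof (intro allI impI)
  fix d m :: nat assume m: "m \<ge> 1"
  define N where "N = n1 * triangular m"
  obtain e where e: "triangular e \<le> N" "N < triangular (Suc e)"
    using exists_triangular_bracket by blast
  have "triangular m \<ge> 1" using triangular_mono[OF m] by (simp add: triangular_def)
  then have "N \<ge> 1" using assms(1) unfolding N_def by (metis mult_le_mono nat_mult_1)
  then have e1: "e \<ge> 1" using e(2) by (cases e) (auto simp: triangular_def)
  define c where "c = N - triangular e"
  obtain P where P: "\<And>j. j < n1 \<Longrightarrow> P j 3 3 \<noteq> 0"
    "\<And>e'. e' < e \<Longrightarrow> tpoly.dim (points_space e' m n1 P) = 0"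
    "tpoly.dim (points_space e m n1 P) + N \<le> triangular (Suc e)"
    using exists_collapsing_group[OF assms(3)[OF m], of e] e unfolding N_def by metis
  define W where "W = leading_form e ` points_space e m n1 P"
  interpret leading_form: Vector_Spaces.linear pscale smult "leading_form e"
    by (simp add: Vector_Spaces.linear_iff leading_form_add leading_form_pscale tpoly.vector_space_axioms cpoly.vector_space_axioms)
  obtain C where C: "finite C" "C \<subseteq> points_space e m n1 P" "tpoly.independent C"
    "points_space e m n1 P \<subseteq> tpoly.span C" "card C = tpoly.dim (points_space e m n1 P)"
    by (rule tpoly.finite_basis_of[OF finite_monomial_basis points_space_subset_span])
  have W: "cpoly.subspace W" "W \<subseteq> cpoly.span (leading_form e ` C)" "finite (leading_form e ` C)" "card (leading_form e ` C) + c \<le> e + 1"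
  proof -
    show "cpoly.subspace W"
      unfolding W_def by (rule leading_form.subspace_image[OF subspace_points_space])
    show "W \<subseteq> cpoly.span (leading_form e ` C)"
      unfolding W_def leading_form.span_image using C(4) by blast
    show "finite (leading_form e ` C)" using C(1) by simp
    show "card (leading_form e ` C) + c \<le> e + 1"
      using card_image_le[OF C(1), of "leading_form e"] C(5) P(3) e(1) triangular_Suc[of e] unfolding c_def by linarith
  qed
  (* the two endpoints: all points of multiplicity e, respectively all of multiplicity e + 1 *)
  have order_e: "int (cluster_dim d e W n2 {} {}) \<le> max 0 (int (triangular (d + 1)) - int n2 * int (triangular e))"
  proof -
    obtain x where "int (tpoly.dim (points_space d e n2 x)) \<le> max 0 (int (triangular (d + 1)) - int n2 * int (triangular e))"
      by (rule non_special_imp_frames[OF assms(4)[OF e1]])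
    moreover have "cluster_space d e W n2 {} {} x = points_space d e n2 x"
      by (simp add: cluster_space_def points_space_def)
    ultimately show ?thesis using cluster_dim_le[of d e W n2 "{}" "{}" x] by simp
  qed
  have order_Suc_e: "int (cluster_dim d e W n2 {} {..<n2}) \<le>
      max 0 (int (triangular (d + 1)) - int n2 * int (triangular (Suc e)))"
  proof -
    obtain x where "int (tpoly.dim (points_space d (Suc e) n2 x)) \<le>
        max 0 (int (triangular (d + 1)) - int n2 * int (triangular (Suc e)))"
      by (rule non_special_imp_frames[OF assms(4)[of "Suc e"]]) simp
    moreover have "cluster_space d e W n2 {} {..<n2} x = points_space d (Suc e) n2 x"
      by (auto simp: cluster_space_def points_space_def)
    ultimately show ?thesis using cluster_dim_le[of d e W n2 "{}" "{..<n2}" x] by simp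
  qed
  obtain x where x: "tpoly.dim (cluster_space d e W n2 {..<n2} {} x) = cluster_dim d e W n2 {..<n2} {}"
    by (rule cluster_dim_attained)
  obtain t where t: "tpoly.dim {F \<in> forms d. \<forall>i<n2. \<forall>j<n1.
      lsubst (frame_mult (frame_mult (x i) (frame_dilation t)) (P j)) F \<in> ord_ge 3 m} \<le> cluster_dim d e W n2 {..<n2} {}"
  proof (rule cluster_degeneration[OF W(1), where k = n1 and P = P and m = m and e = e and d = d and n = n2 and x = x])
    show "P j 3 3 \<noteq> 0" if "j < n1" for j using P(1) that .
    show "H = 0" if "e' < e" "H \<in> forms e'" "\<forall>j<n1. lsubst (P j) H \<in> ord_ge 3 m" for e' H
      using points_space_trivial[OF P(2)[OF that(1)]] that(2,3) by (simp add: points_space_def)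
    show "leading_form e H \<in> W" if "H \<in> forms e" "\<forall>j<n1. lsubst (P j) H \<in> ord_ge 3 m" for H
      using that by (simp add: W_def points_space_def)
  qed (use x in simp)
  (* enumerate the pairs (i, j) by i * n1 + j *)
  define y where "y l = frame_mult (frame_mult (x (l div n1)) (frame_dilation t)) (P (l mod n1))" for l
  have "points_space d m (n1 * n2) y \<subseteq> {F \<in> forms d. \<forall>i<n2. \<forall>j<n1.
      lsubst (frame_mult (frame_mult (x i) (frame_dilation t)) (P j)) F \<in> ord_ge 3 m}"
  proof
    fix F assume F: "F \<in> points_space d m (n1 * n2) y"
    have "lsubst (frame_mult (frame_mult (x i) (frame_dilation t)) (P j)) F \<in> ord_ge 3 m" if ij: "i < n2" "j < n1" for i j
    proof -
      let ?l = "i * n1 + j"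
      have "?l < (i + 1) * n1" using ij by simp
      also have "\<dots> \<le> n2 * n1" using ij by (intro mult_le_mono1) simp
      finally have "?l < n1 * n2" by (simp add: mult.commute)
      then have "lsubst (y ?l) F \<in> ord_ge 3 m"
        using F by (simp add: points_space_def)
      then show ?thesis using ij by (simp add: y_def)
    qed
    then show "F \<in> {F \<in> forms d. \<forall>i<n2. \<forall>j<n1.
      lsubst (frame_mult (frame_mult (x i) (frame_dilation t)) (P j)) F \<in> ord_ge 3 m}"
      using F by (auto simp: points_space_def)
  qed
  then have "tpoly.dim (points_space d m (n1 * n2) y) \<le> cluster_dim d e W n2 {..<n2} {}"
    by (rule order_trans[OF tpoly.dim_mono_finite[OF finite_monomial_basis[of d], rotated] t])
       (auto simp: forms_eq_span)
  also have "\<dots> \<le> max (cluster_dim d e W n2 {} {} - c * n2) (cluster_dim d e W n2 {} {..<n2})"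
    by (rule cluster_dim_endpoints[OF W])
  finally have le: "tpoly.dim (points_space d m (n1 * n2) y) \<le>
    max (cluster_dim d e W n2 {} {} - c * n2) (cluster_dim d e W n2 {} {..<n2})" .
  have N2: "int (n1 * n2) * int (triangular m) = int n2 * int N"
    by (simp add: N_def)
  have cN: "int n2 * int N = int n2 * int (triangular e) + int (c * n2)"
    using e(1) by (simp add: c_def of_nat_diff algebra_simps)
  have eN: "int n2 * int N \<le> int n2 * int (triangular (Suc e))"
    using e(2) by (intro mult_left_mono) auto
  show "non_special d m (n1 * n2)"
  proof (rule frames_imp_non_special[of _ _ _ y], unfold N2)
    show "int (tpoly.dim (points_space d m (n1 * n2) y)) \<le> max 0 (int (triangular (d + 1)) - int n2 * int N)"
      using le order_e order_Suc_e cN eN by linarith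
  qed
qed

end
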